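(* Let $I$ be an ideal of $B(H)$. If $I$ is invariant under $\mathscr C$ and is soft-edged or soft-complemented, then $I$ is am-closed.
   Context: $H$ is a separable infinite-dimensional Hilbert space. $c_0^*$ is the cone of nonincreasing sequences of nonnegative reals converging to $0$ (not a dual space). An ideal is a (proper) two-sided ideal of $B(H)$, hence consists of compact operators; its characteristic set is $\Sigma(I)=\{s(X): X\in I\}\subset c_0^*$, where $s(X)$ is the singular number sequence of $X$ (eigenvalues of $|X|$ in decreasing order, repeated with multiplicity). $I\mapsto\Sigma(I)$ is a bijection onto the hereditary (solid) subcones of $c_0^*$ invariant under all ampliations $\xi\mapsto\langle\xi_1,\dots,\xi_1,\xi_2,\dots,\xi_2,\dots\rangle$ (each entry repeated $m$ times). For $\xi\in c_0^*$, $\xi_a:=\langle\frac1n\sum_{j=1}^n\xi_j\rangle_n$. The ideals ${}_aI$ and $I_a$ are defined by $\Sigma({}_aI)=\{\xi\in c_0^*:\xi_a\in\Sigma(I)\}$ and $\Sigma(I_a)=\{\xi\in c_0^*:\xi=O(\eta_a)\text{ for some }\eta\in\Sigma(I)\}$. The am-closure of $I$ is $I^-:={}_a(I_a)$, and $I$ is am-closed if $I=I^-$. $I$ is soft-edged if every $\xi\in\Sigma(I)$ is a (termwise) product $\xi=\alpha\eta$ for some $\alpha\in c_0^*$ and some $\eta\in\Sigma(I)$. $I$ is soft-complemented if, for $\xi\in c_0^*$, one has $\xi\in\Sigma(I)$ if and only if $\alpha\xi\in\Sigma(I)$ for all $\alpha\in c_0^*$ (termwise product). Infinite matrices are indexed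 by $\mathbb N\times\mathbb N$, $\mathbb N=\{1,2,\dots\}$, and $(P\rho)_i=\sum_jP_{ij}\rho_j$. A matrix with nonnegative entries is substochastic if all its row and column sums are at most $1$. $\mathscr C:=\{\sum_{j=1}^\infty t_j\Pi_j : \Pi_j\text{ permutation matrices},\ 0\le t_j\le1,\ \sum_{j=1}^\infty t_j=1\}$. If $\xi\in c_0^*$ and $P$ is substochastic then $P\xi$ is a nonnegative sequence converging to $0$; for such a sequence $\rho$, $\rho^*\in c_0^*$ denotes its monotone nonincreasing rearrangement (its $n$-th term is the $n$-th largest value of $\rho$, counted with multiplicity). Given a collection $\mathscr P$ of substochastic matrices, $I$ is invariant under $\mathscr P$ if $(P\xi)^*\in\Sigma(I)$ for every $P\in\mathscr P$ and every $\xi\in\Sigma(I)$. *)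

theory Defs
  imports "HOL-Analysis.Analysis"
begin

section \<open>Complex Hilbert spaces\<close>

text \<open>
  A complex Hilbert space, presented as an extension of the library's real inner product spaces:
  the real inner product is the real part of the complex one, so the norm and the topology are the
  usual ones, and positive definiteness is inherited. \<open>cinner\<close> is linear in its first argument.
\<close>

class complex_hilbert_space = real_inner + complete_space +
  fixes scaleC :: "complex \<Rightarrow> 'a \<Rightarrow> 'a" (infixr "*\<^sub>C" 75)
    and cinner :: "'a \<Rightarrow> 'a \<Rightarrow> complex"
  assumes scaleC_add_right: "c *\<^sub>C (x + y) = c *\<^sub>C x + c *\<^sub>C y"
    and scaleC_add_left: "(c + d) *\<^sub>C x = c *\<^sub>C x + d *\<^sub>C x"
    and scaleC_scaleC: "c *\<^sub>C (d *\<^sub>C x) = (c * d) *\<^sub>C x"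
    and scaleC_one: "1 *\<^sub>C x = x"
    and scaleR_scaleC: "r *\<^sub>R x = complex_of_real r *\<^sub>C x"
    and cinner_commute: "cinner x y = cnj (cinner y x)"
    and cinner_add_left: "cinner (x + y) z = cinner x z + cinner y z"
    and cinner_scaleC_left: "cinner (c *\<^sub>C x) y = c * cinner x y"
    and inner_eq_Re_cinner: "inner x y = Re (cinner x y)"

global_interpretation complex_vector:
  vector_space "scaleC :: complex \<Rightarrow> 'a \<Rightarrow> 'a::complex_hilbert_space"
  by unfold_locales
    (simp_all add: scaleC_add_right scaleC_add_left scaleC_scaleC scaleC_one)

definition infinite_dimensional :: "'a::complex_hilbert_space itself \<Rightarrow> bool" where
  "infinite_dimensional _ \<longleftrightarrow>
     \<not> (\<exists>B :: 'a set. finite B \<and> complex_vector.span B = UNIV)"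


section \<open>Bounded operators and ideals\<close>

text \<open>
  The library type of bounded operators only asks for real linearity; \<open>BH\<close> is \<open>B(H)\<close>, the set of
  the complex-linear ones.
\<close>

definition BH :: "('a::complex_hilbert_space \<Rightarrow>\<^sub>L 'a) set" where
  "BH = {X. \<forall>c x. blinfun_apply X (c *\<^sub>C x) = c *\<^sub>C blinfun_apply X x}"

text \<open>
  Closure under scalar multiples follows from multiplying by the operators \<open>c *\<^sub>C id\<close>.
\<close>

definition operator_ideal :: "('a::complex_hilbert_space \<Rightarrow>\<^sub>L 'a) set \<Rightarrow> bool" where
  "operator_ideal I \<longleftrightarrow>
     I \<subseteq> BH \<and> I \<noteq> BH \<and> 0 \<in> I \<and>
     (\<forall>X\<in>I. \<forall>Y\<in>I. X + Y \<in> I) \<and>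
     (\<forall>X\<in>I. \<forall>A\<in>BH. A o\<^sub>L X \<in> I \<and> X o\<^sub>L A \<in> I)"

definition op_adjoint ::
    "('a::complex_hilbert_space \<Rightarrow>\<^sub>L 'a) \<Rightarrow> ('a \<Rightarrow>\<^sub>L 'a)" where
  "op_adjoint X = (THE Y. Y \<in> BH \<and>
     (\<forall>x y. cinner (blinfun_apply X x) y = cinner x (blinfun_apply Y y)))"

definition positive_op :: "('a::complex_hilbert_space \<Rightarrow>\<^sub>L 'a) \<Rightarrow> bool" where
  "positive_op P \<longleftrightarrow> P \<in> BH \<and>
     (\<forall>x. Im (cinner (blinfun_apply P x) x) = 0 \<and> 0 \<le> Re (cinner (blinfun_apply P x) x))"

definition op_abs ::
    "('a::complex_hilbert_space \<Rightarrow>\<^sub>L 'a) \<Rightarrow> ('a \<Rightarrow>\<^sub>L 'a)" where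
  "op_abs X = (THE P. positive_op P \<and> P o\<^sub>L P = op_adjoint X o\<^sub>L X)"


section \<open>Sequences\<close>

text \<open>
  Sequences and matrices are indexed from \<open>0\<close>, so the term with index \<open>n\<close> here is the term with
  index \<open>n + 1\<close> in the usual notation.
\<close>

definition c0_star :: "(nat \<Rightarrow> real) set" where
  "c0_star = {\<xi>. antimono \<xi> \<and> (\<forall>n. 0 \<le> \<xi> n) \<and> \<xi> \<longlonglongrightarrow> 0}"

text \<open>
  The decreasing list of the positive reals \<open>v\<close>, each repeated \<open>m v\<close> times, continued by zeros if
  it is finite. A sequence in \<open>c0_star\<close> is determined by the multiplicities of its positive values.
\<close>

definition decreasing_list :: "(real \<Rightarrow> nat) \<Rightarrow> nat \<Rightarrow> real" where
  "decreasing_list m = (THE \<xi>. \<xi> \<in> c0_star \<and> (\<forall>v>0. card {n. \<xi> n = v} = m v))"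

text \<open>
  Eigenvalues of \<open>|X|\<close> in decreasing order with multiplicity, for compact \<open>X\<close>; the eigenspaces of
  positive eigenvalues are then finite-dimensional.
\<close>

definition singular_numbers :: "('a::complex_hilbert_space \<Rightarrow>\<^sub>L 'a) \<Rightarrow> nat \<Rightarrow> real" where
  "singular_numbers X =
     decreasing_list (\<lambda>v. complex_vector.dim {x. blinfun_apply (op_abs X) x = complex_of_real v *\<^sub>C x})"

text \<open>For a nonnegative sequence converging to \<open>0\<close>.\<close>

definition monotone_rearrangement :: "(nat \<Rightarrow> real) \<Rightarrow> nat \<Rightarrow> real" where
  "monotone_rearrangement \<rho> = decreasing_list (\<lambda>v. card {n. \<rho> n = v})"

definition arith_mean :: "(nat \<Rightarrow> real) \<Rightarrow> nat \<Rightarrow> real" where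
  "arith_mean \<xi> n = (\<Sum>j\<le>n. \<xi> j) / real (n + 1)"


section \<open>Characteristic sets and arithmetic mean ideals\<close>

definition char_set :: "('a::complex_hilbert_space \<Rightarrow>\<^sub>L 'a) set \<Rightarrow> (nat \<Rightarrow> real) set" where
  "char_set I = singular_numbers ` I"

definition ideal_of_char_set :: "(nat \<Rightarrow> real) set \<Rightarrow> ('a::complex_hilbert_space \<Rightarrow>\<^sub>L 'a) set" where
  "ideal_of_char_set S = (THE J. operator_ideal J \<and> char_set J = S)"

definition pre_am_ideal ::
    "('a::complex_hilbert_space \<Rightarrow>\<^sub>L 'a) set \<Rightarrow> ('a \<Rightarrow>\<^sub>L 'a) set" where
  "pre_am_ideal I = ideal_of_char_set {\<xi>\<in>c0_star. arith_mean \<xi> \<in> char_set I}"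

text \<open>
  The relation \<open>\<xi> = O(\<eta>\<^sub>a)\<close> is required at all indices. This differs from the library's asymptotic
  \<open>O\<close> only for \<open>\<eta> = 0\<close>, since otherwise \<open>\<eta>\<^sub>a\<close> is everywhere positive.
\<close>

definition am_ideal ::
    "('a::complex_hilbert_space \<Rightarrow>\<^sub>L 'a) set \<Rightarrow> ('a \<Rightarrow>\<^sub>L 'a) set" where
  "am_ideal I = ideal_of_char_set
     {\<xi>\<in>c0_star. \<exists>\<eta>\<in>char_set I. \<exists>C. \<forall>n. \<xi> n \<le> C * arith_mean \<eta> n}"

definition am_closure ::
    "('a::complex_hilbert_space \<Rightarrow>\<^sub>L 'a) set \<Rightarrow> ('a \<Rightarrow>\<^sub>L 'a) set" where
  "am_closure I = pre_am_ideal (am_ideal I)"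

definition am_closed :: "('a::complex_hilbert_space \<Rightarrow>\<^sub>L 'a) set \<Rightarrow> bool" where
  "am_closed I \<longleftrightarrow> I = am_closure I"

definition soft_edged :: "('a::complex_hilbert_space \<Rightarrow>\<^sub>L 'a) set \<Rightarrow> bool" where
  "soft_edged I \<longleftrightarrow>
     (\<forall>\<xi>\<in>char_set I. \<exists>\<alpha>\<in>c0_star. \<exists>\<eta>\<in>char_set I. \<xi> = (\<lambda>n. \<alpha> n * \<eta> n))"

definition soft_complemented :: "('a::complex_hilbert_space \<Rightarrow>\<^sub>L 'a) set \<Rightarrow> bool" where
  "soft_complemented I \<longleftrightarrow>
     (\<forall>\<xi>\<in>c0_star. \<xi> \<in> char_set I \<longleftrightarrow> (\<forall>\<alpha>\<in>c0_star. (\<lambda>n. \<alpha> n * \<xi> n) \<in> char_set I))"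


section \<open>Infinite matrices\<close>

type_synonym inf_matrix = "nat \<Rightarrow> nat \<Rightarrow> real"

definition mat_apply :: "inf_matrix \<Rightarrow> (nat \<Rightarrow> real) \<Rightarrow> nat \<Rightarrow> real" where
  "mat_apply P \<rho> i = (\<Sum>j. P i j * \<rho> j)"

definition permutation_matrix :: "inf_matrix \<Rightarrow> bool" where
  "permutation_matrix P \<longleftrightarrow> (\<exists>\<sigma>. bij \<sigma> \<and> P = (\<lambda>i j. if i = \<sigma> j then 1 else 0))"

definition infinite_convex_permutations :: "inf_matrix set" ("\<C>") where
  "\<C> = {P. \<exists>t Q. (\<forall>k. permutation_matrix (Q k)) \<and> (\<forall>k. 0 \<le> t k \<and> t k \<le> 1) \<and> t sums 1 \<and>
     P = (\<lambda>i j. \<Sum>k. t k * Q k i j)}"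

definition invariant_under ::
    "('a::complex_hilbert_space \<Rightarrow>\<^sub>L 'a) set \<Rightarrow> inf_matrix set \<Rightarrow> bool" where
  "invariant_under I \<P> \<longleftrightarrow>
     (\<forall>P\<in>\<P>. \<forall>\<xi>\<in>char_set I. monotone_rearrangement (mat_apply P \<xi>) \<in> char_set I)"

end

theory Submission
  imports Defs
begin

text \<open>
  Through the Schmidt decomposition of compact operators, an ideal is determined by its
  characteristic set, and \<open>I\<close> is am-closed as soon as \<open>\<xi>\<^sub>a = O(\<eta>\<^sub>a)\<close> with \<open>\<eta> \<in> \<Sigma>(I)\<close> implies
  \<open>\<xi> \<in> \<Sigma>(I)\<close>. Either softness hypothesis provides a null factor: it reduces the claim to sequences
  \<open>\<xi>\<close> whose partial sums are bounded by those of \<open>\<beta>\<eta>\<close> with \<open>\<beta> \<in> c\<^sub>0\<^sup>*\<close> and \<open>\<eta> \<in> \<Sigma>(I)\<close>. For such \<open>\<xi>\<close> the tail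
  starting at a large index \<open>N\<^sub>k\<close> is majorized by \<open>2\<^sup>-\<^sup>k\<eta>\<close>, up to a constant independent of \<open>k\<close>. Thus the
  finite block of \<open>\<xi>\<close> between \<open>N\<^sub>k\<close> and \<open>N\<^sub>k\<^sub>+\<^sub>1\<close> is dominated by \<open>2\<^sup>-\<^sup>kQ\<^sub>k\<eta>\<close>, where \<open>Q\<^sub>k\<close> is a convex combination
  of permutation matrices, and the single matrix \<open>\<Sum>\<^sub>k 2\<^sup>-\<^sup>k\<^sup>-\<^sup>1Q\<^sub>k \<in> \<C>\<close> takes care of all blocks at once.
\<close>


subsection \<open>Complex inner products\<close>

text \<open>Finite blocks are forced by the shape of \<open>\<C>\<close>. Majorization of a finite
  block takes finitely many T-transforms and stays among convex combinations of permutations;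
  infinitely many successive T-transforms give no such control. Infinitely many blocks must share
  the total weight 1, so block k, carried with weight \<open>w k\<close>, is available only at the
  price \<open>1 / w k\<close>. This is where the null factor is spent: it makes the comparison
  constants \<open>d k\<close> decay at the rate of the weights, and \<open>d k / w k\<close> is the
  same number for all k.

  Matrices act on sequences that end up unsorted, so the comparison with \<xi> is made index by
  index on diagonal operators, and sorting enters only through their singular numbers.

  Both am-operations are definite descriptions. For the inner one an ideal with the prescribed
  characteristic set has to be constructed; for the outer one the set turns out to be that of
  \<open>I\<close>, and uniqueness is enough. The construction works with Gelfand numbers, that is,
  with norms under finitely many orthogonality conditions, since conditions are easily combined for
  sums and transported for products.\<close>

instance complex_hilbert_space \<subseteq> banach ..

lemma cinner_add_right: "cinner x (y + z) = cinner x y + cinner x (z::'a::complex_hilbert_space)"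
  by (metis cinner_add_left cinner_commute complex_cnj_add)

lemma cinner_scaleC_right: "cinner x (c *\<^sub>C y) = cnj c * cinner x (y::'a::complex_hilbert_space)"
  by (metis cinner_commute cinner_scaleC_left complex_cnj_mult)

lemma cinner_scaleR_left: "cinner (r *\<^sub>R x) y = of_real r * cinner x (y::'a::complex_hilbert_space)"
  by (simp add: scaleR_scaleC cinner_scaleC_left)

lemma cinner_scaleR_right: "cinner x (r *\<^sub>R y) = of_real r * cinner x (y::'a::complex_hilbert_space)"
  by (simp add: scaleR_scaleC cinner_scaleC_right)

lemma cinner_self: "cinner x x = of_real ((norm (x::'a::complex_hilbert_space))\<^sup>2)"
proof -
  have "Im (cinner x x) = 0"
    using arg_cong[OF cinner_commute[of x x], of Im] by simp
  then show ?thesis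
    by (simp add: complex_eq_iff power2_norm_eq_inner inner_eq_Re_cinner)
qed

lemma norm_scaleC: "norm (c *\<^sub>C x) = cmod c * norm (x::'a::complex_hilbert_space)"
proof -
  have "complex_of_real ((norm (c *\<^sub>C x))\<^sup>2) = (c * cnj c) * of_real ((norm x)\<^sup>2)"
    by (simp only: cinner_self[symmetric] cinner_scaleC_left cinner_scaleC_right mult_ac)
  also have "\<dots> = of_real ((cmod c * norm x)\<^sup>2)"
    by (simp only: complex_norm_square[symmetric] power_mult_distrib of_real_mult)
  finally have "complex_of_real ((norm (c *\<^sub>C x))\<^sup>2) = of_real ((cmod c * norm x)\<^sup>2)" .
  then have "(norm (c *\<^sub>C x))\<^sup>2 = (cmod c * norm x)\<^sup>2"
    using of_real_eq_iff by blast
  then show ?thesis by simp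
qed

lemma norm_cinner_le: "cmod (cinner x y) \<le> norm x * norm (y::'a::complex_hilbert_space)"
proof -
  let ?c = "cinner x y"
  have "cmod ?c = Re (cnj (sgn ?c) * ?c)"
  proof (cases "?c = 0")
    case False
    have "cnj (sgn ?c) * ?c = of_real ((cmod ?c)\<^sup>2) / of_real (cmod ?c)"
      by (simp only: sgn_eq complex_norm_square) (simp add: mult.commute)
    also have "\<dots> = of_real (cmod ?c)"
      using False by (simp add: power2_eq_square)
    finally show ?thesis by simp
  qed simp
  also have "\<dots> = inner (cnj (sgn ?c) *\<^sub>C x) y"
    by (simp add: inner_eq_Re_cinner cinner_scaleC_left)
  also have "\<dots> \<le> norm (cnj (sgn ?c) *\<^sub>C x) * norm y"
    by (rule norm_cauchy_schwarz)
  also have "\<dots> \<le> norm x * norm y"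
    by (simp add: norm_scaleC norm_sgn)
  finally show ?thesis .
qed

lemma bounded_bilinear_cinner:
  "bounded_bilinear (cinner :: 'a::complex_hilbert_space \<Rightarrow> 'a \<Rightarrow> complex)"
  by unfold_locales
    (auto simp: cinner_add_left cinner_add_right cinner_scaleR_left cinner_scaleR_right
      scaleR_conv_of_real intro!: exI[of _ 1] norm_cinner_le)

lemma bounded_bilinear_scaleC:
  "bounded_bilinear (scaleC :: complex \<Rightarrow> 'a::complex_hilbert_space \<Rightarrow> 'a)"
  by unfold_locales
    (auto simp: scaleC_add_left scaleC_add_right scaleR_scaleC scaleC_scaleC scaleR_conv_of_real
      mult_ac norm_scaleC intro!: exI[of _ 1])

interpretation cinner: bounded_bilinear
    "cinner :: 'a::complex_hilbert_space \<Rightarrow> 'a \<Rightarrow> complex"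
  by (rule bounded_bilinear_cinner)

interpretation scaleC: bounded_bilinear
    "scaleC :: complex \<Rightarrow> 'a::complex_hilbert_space \<Rightarrow> 'a"
  by (rule bounded_bilinear_scaleC)

lemma cinner_eq_0_sym: "cinner x y = 0 \<Longrightarrow> cinner y (x::'a::complex_hilbert_space) = 0"
  by (metis cinner_commute complex_cnj_zero_iff)

lemma cinner_ext: "(\<And>z. cinner z x = cinner z y) \<Longrightarrow> x = (y::'a::complex_hilbert_space)"
  by (metis cinner.diff_right cinner_self eq_iff_diff_eq_0 norm_eq_zero of_real_eq_0_iff
      zero_eq_power2)

lemma pythagoras:
  "cinner x y = 0 \<Longrightarrow> (norm (x + y))\<^sup>2 = (norm x)\<^sup>2 + (norm (y::'a::complex_hilbert_space))\<^sup>2"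
  using cinner_eq_0_sym[of x y]
  by (simp add: power2_norm_eq_inner inner_eq_Re_cinner cinner_add_left cinner_add_right)

subsection \<open>Finite orthonormal sets\<close>

definition orthonormal_set :: "'a::complex_hilbert_space set \<Rightarrow> bool" where
  "orthonormal_set B \<longleftrightarrow> (\<forall>x\<in>B. \<forall>y\<in>B. cinner x y = (if x = y then 1 else 0))"

definition proj :: "'a::complex_hilbert_space set \<Rightarrow> 'a \<Rightarrow> 'a" where
  "proj B x = (\<Sum>b\<in>B. cinner x b *\<^sub>C b)"

text \<open>With a finite set \<open>F\<close> this describes a subspace of finite codimension;
  compactness and Gelfand numbers are phrased through it.\<close>

abbreviation perp :: "'a::complex_hilbert_space \<Rightarrow> 'a set \<Rightarrow> bool" where
  "perp x F \<equiv> \<forall>u\<in>F. cinner x u = 0"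

lemma perp_span:
  assumes "perp x F" "u \<in> complex_vector.span F"
  shows "cinner x u = 0"
  using assms(2)
  by (induction rule: complex_vector.span_induct_alt)
    (use assms(1) in \<open>auto simp: cinner.zero_right cinner_add_right cinner_scaleC_right\<close>)

lemma perp_scaleC: "perp x F \<Longrightarrow> perp (c *\<^sub>C x) F"
  by (simp add: cinner_scaleC_left)

lemma cinner_proj:
  assumes "orthonormal_set B" "finite B" "b \<in> B"
  shows "cinner (proj B x) b = cinner x b"
proof -
  have "cinner (proj B x) b = (\<Sum>c\<in>B. cinner x c * (if c = b then 1 else 0))"
    unfolding proj_def cinner.sum_left cinner_scaleC_left
    by (intro sum.cong refl) (use assms in \<open>auto simp: orthonormal_set_def\<close>)
  then show ?thesis using assms by (simp add: if_distrib cong: if_cong)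
qed

lemma proj_in_span: "proj B x \<in> complex_vector.span B"
  unfolding proj_def
  by (intro complex_vector.span_sum complex_vector.span_scale complex_vector.span_base)

lemma perp_diff_proj:
  assumes "orthonormal_set B" "finite B"
  shows "perp (x - proj B x) B"
  using cinner_proj[OF assms] by (simp add: cinner.diff_left)

lemma proj_of_span:
  assumes "orthonormal_set B" "finite B" "x \<in> complex_vector.span B"
  shows "proj B x = x"
proof -
  have "x - proj B x \<in> complex_vector.span B"
    using assms(3) proj_in_span complex_vector.span_diff by blast
  then have "cinner (x - proj B x) (x - proj B x) = 0"
    using perp_span[OF perp_diff_proj] assms by blast
  then show ?thesis by (simp add: cinner_self)
qed

lemma norm_proj_pythagoras:
  assumes "orthonormal_set B" "finite B"
  shows "(norm x)\<^sup>2 = (norm (proj B x))\<^sup>2 + (norm (x - proj B x))\<^sup>2"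
  using pythagoras[of "proj B x" "x - proj B x"]
    cinner_eq_0_sym[OF perp_span[OF perp_diff_proj[OF assms] proj_in_span]]
  by simp

lemma norm_diff_proj_le:
  assumes "orthonormal_set B" "finite B"
  shows "norm (x - proj B x) \<le> norm x"
  by (rule power2_le_imp_le) (use norm_proj_pythagoras[OF assms, of x] in auto)

lemma norm_proj_le:
  assumes "orthonormal_set B" "finite B"
  shows "norm (proj B x) \<le> norm x"
  by (rule power2_le_imp_le) (use norm_proj_pythagoras[OF assms, of x] in auto)

lemma norm_orthonormal_sum:
  assumes "orthonormal_set B" "finite B"
  shows "(norm (\<Sum>b\<in>B. c b *\<^sub>C b))\<^sup>2 = (\<Sum>b\<in>B. (cmod (c b))\<^sup>2)"
proof -
  let ?x = "\<Sum>b\<in>B. c b *\<^sub>C b"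
  have *: "cinner ?x b = c b" if "b \<in> B" for b
  proof -
    have "cinner ?x b = (\<Sum>a\<in>B. c a * (if a = b then 1 else 0))"
      unfolding cinner.sum_left cinner_scaleC_left
      by (intro sum.cong refl) (use assms that in \<open>auto simp: orthonormal_set_def\<close>)
    then show ?thesis using assms that by (simp add: if_distrib cong: if_cong)
  qed
  have "complex_of_real ((norm ?x)\<^sup>2) = cinner ?x ?x"
    by (simp add: cinner_self)
  also have "\<dots> = (\<Sum>b\<in>B. cnj (c b) * cinner ?x b)"
    by (subst cinner.sum_right) (simp add: cinner_scaleC_right)
  also have "\<dots> = (\<Sum>b\<in>B. complex_of_real ((cmod (c b))\<^sup>2))"
    by (intro sum.cong refl) (simp only: * complex_norm_square mult.commute)
  also have "\<dots> = complex_of_real (\<Sum>b\<in>B. (cmod (c b))\<^sup>2)" by simp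
  finally show ?thesis using of_real_eq_iff by blast
qed

lemma bessel:
  assumes "orthonormal_set B" "finite B"
  shows "(\<Sum>b\<in>B. (cmod (cinner x b))\<^sup>2) \<le> (norm x)\<^sup>2"
  using norm_orthonormal_sum[OF assms, of "cinner x"]
    power_mono[OF norm_proj_le[OF assms, of x] norm_ge_zero, of 2]
  by (simp add: proj_def)

lemma orthonormal_set_independent:
  assumes B: "orthonormal_set B"
  shows "complex_vector.independent B"
proof (subst complex_vector.independent_explicit_finite_subsets, intro allI impI ballI)
  fix A c a assume A: "A \<subseteq> B" "finite A" "(\<Sum>v\<in>A. c v *\<^sub>C v) = 0" "a \<in> A"
  have "orthonormal_set A" using B A(1) unfolding orthonormal_set_def by blast
  from norm_orthonormal_sum[OF this A(2), of c] A(3) have "(\<Sum>b\<in>A. (cmod (c b))\<^sup>2) = 0" by simp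
  then show "c a = 0" using A(2,4) by (simp add: sum_nonneg_eq_0_iff)
qed

text \<open>One Gram-Schmidt step. The two span conditions together say that \<open>v\<close> and
  \<open>x\<close> enlarge the span of \<open>B\<close> to the same subspace.\<close>

lemma orthonormal_set_insert_residual:
  assumes "orthonormal_set B" "finite B" "x \<notin> complex_vector.span B"
  obtains v where "norm v = 1" "perp v B" "x \<in> complex_vector.span (insert v B)"
    "v \<in> complex_vector.span (insert x B)"
proof -
  let ?r = "x - proj B x" let ?v = "of_real (inverse (norm ?r)) *\<^sub>C ?r"
  have r: "?r \<noteq> 0" using assms(3) proj_in_span[of B x] by auto
  have sp: "proj B x \<in> complex_vector.span (insert u B)" for u
    using proj_in_span[of B x] complex_vector.span_mono[of B "insert u B"] by blast
  have "x = proj B x + of_real (norm ?r) *\<^sub>C ?v"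
    using r by (simp add: scaleC_scaleC scaleC_one flip: of_real_mult)
  also have "\<dots> \<in> complex_vector.span (insert ?v B)"
    by (rule complex_vector.span_add[OF sp complex_vector.span_scale])
      (rule complex_vector.span_base, simp)
  finally have "x \<in> complex_vector.span (insert ?v B)" .
  moreover have "?v \<in> complex_vector.span (insert x B)"
    by (rule complex_vector.span_scale, rule complex_vector.span_diff[OF _ sp])
      (rule complex_vector.span_base, simp)
  moreover have "norm ?v = 1" using r by (simp add: norm_scaleC norm_inverse)
  moreover have "perp ?v B" by (rule perp_scaleC[OF perp_diff_proj[OF assms(1,2)]])
  ultimately show ?thesis using that[of ?v] by blast
qed

lemma orthonormal_set_insert:
  assumes "orthonormal_set B" "norm v = 1" "perp v B"
  shows "orthonormal_set (insert v B)"
  using assms cinner_eq_0_sym[of v] by (auto simp: orthonormal_set_def cinner_self)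

lemma finite_orthonormal_basis:
  assumes "finite F"
  shows "\<exists>B. finite B \<and> orthonormal_set B \<and> complex_vector.span B = complex_vector.span F"
  using assms
proof (induction F)
  case empty
  show ?case by (intro exI[of _ "{}"]) (simp add: orthonormal_set_def)
next
  case (insert x F)
  then obtain B where B: "finite B" "orthonormal_set B"
    "complex_vector.span B = complex_vector.span F" by blast
  show ?case
  proof (cases "x \<in> complex_vector.span B")
    case True
    then show ?thesis using B complex_vector.span_redundant by (metis)
  next
    case False
    from orthonormal_set_insert_residual[OF B(2,1) False] obtain v where
      v: "norm v = 1" "perp v B" "x \<in> complex_vector.span (insert v B)"
      "v \<in> complex_vector.span (insert x B)" .
    have "complex_vector.span (insert v B) = complex_vector.span (insert x B)"
    proof (rule subset_antisym)
      show "complex_vector.span (insert v B) \<subseteq> complex_vector.span (insert x B)"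
        by (rule complex_vector.span_minimal)
          (auto intro: v(4) complex_vector.span_base complex_vector.subspace_span)
      show "complex_vector.span (insert x B) \<subseteq> complex_vector.span (insert v B)"
        by (rule complex_vector.span_minimal)
          (auto intro: v(3) complex_vector.span_base complex_vector.subspace_span)
    qed
    also have "\<dots> = complex_vector.span (insert x F)"
      using B(3) by (simp add: complex_vector.span_insert)
    finally show ?thesis
      using B v orthonormal_set_insert by (intro exI[of _ "insert v B"]) auto
  qed
qed

lemma exists_unit_perp:
  assumes "infinite_dimensional TYPE('a::complex_hilbert_space)" "finite (F :: 'a set)"
  obtains v where "norm v = 1" "perp v F"
proof -
  obtain B where B: "finite B" "orthonormal_set B"
    "complex_vector.span B = complex_vector.span F"
    using finite_orthonormal_basis[OF assms(2)] by blast
  obtain x where "x \<notin> complex_vector.span B"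
    using assms(1) B(1) unfolding infinite_dimensional_def by blast
  from orthonormal_set_insert_residual[OF B(2,1) this] obtain v where "norm v = 1" "perp v B" .
  then show ?thesis
    using that perp_span[where x=v and F=B] B(3) complex_vector.span_base by blast
qed

subsection \<open>Orthonormal sequences\<close>

definition orthonormal :: "(nat \<Rightarrow> 'a::complex_hilbert_space) \<Rightarrow> bool" where
  "orthonormal e \<longleftrightarrow> (\<forall>i j. cinner (e i) (e j) = (if i = j then 1 else 0))"

lemma orthonormal_inj: "orthonormal e \<Longrightarrow> inj e"
  unfolding orthonormal_def inj_def by (metis zero_neq_one)

lemma cinner_self_eq_1: "cinner x x = 1 \<longleftrightarrow> norm (x::'a::complex_hilbert_space) = 1"
  unfolding cinner_self by (metis norm_ge_zero of_real_eq_1_iff power2_eq_1_iff power_one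
      zero_le_one power2_eq_iff_nonneg)

lemma orthonormal_norm: "orthonormal e \<Longrightarrow> norm (e n) = 1"
  by (simp add: orthonormal_def flip: cinner_self_eq_1)

lemma orthonormal_image: "orthonormal e \<Longrightarrow> orthonormal_set (e ` A)"
  using orthonormal_inj[of e]
  unfolding orthonormal_def orthonormal_set_def by (auto simp: inj_eq)

text \<open>Common source of four sequences: vectors orthogonal to a finite set, maximizing vectors
  of a compact operator, a basis obtained from a dense sequence, and vectors on which a noncompact
  operator is bounded below. \<open>P\<close> sees the earlier vectors only as a set, so a choice
  function on finite sets suffices.\<close>

lemma orthonormal_greedy:
  assumes "\<And>F. finite F \<Longrightarrow> orthonormal_set F \<Longrightarrow>
    \<exists>v::'a::complex_hilbert_space. norm v = 1 \<and> perp v F \<and> P F v"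
  obtains e :: "nat \<Rightarrow> 'a::complex_hilbert_space"
  where "orthonormal e" "\<And>n. P (e ` {..<n}) (e n)"
proof -
  define c where "c F = (SOME v. norm v = 1 \<and> perp v F \<and> P F v)" for F :: "'a set"
  define S where "S = rec_nat {} (\<lambda>_ F. insert (c F) F)"
  define e where "e n = c (S n)" for n
  have S: "S n = e ` {..<n}" for n
    by (induction n) (auto simp: S_def e_def lessThan_Suc)
  have c: "norm (c F) = 1 \<and> perp (c F) F \<and> P F (c F)"
    if "finite F" "orthonormal_set F" for F
    unfolding c_def by (rule someI_ex) (rule assms[OF that])
  have ons: "finite (S n) \<and> orthonormal_set (S n)" for n
  proof (induction n)
    case 0
    show ?case by (simp add: S_def orthonormal_set_def)
  next
    case (Suc n)
    then show ?case
      using c[of "S n"] orthonormal_set_insert[of "S n" "c (S n)"] by (simp add: S_def)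
  qed
  have e: "norm (e n) = 1" "perp (e n) (e ` {..<n})" "P (e ` {..<n}) (e n)" for n
    unfolding S[symmetric] using c[of "S n"] ons[of n] by (auto simp: e_def)
  have "cinner (e i) (e j) = 0" if "i \<noteq> j" for i j
    using e(2)[of i] e(2)[of j] that
    by (metis cinner_eq_0_sym imageI lessThan_iff linorder_neqE_nat)
  then have "orthonormal e"
    using e(1) by (auto simp: orthonormal_def cinner_self)
  then show ?thesis using that e(3) by blast
qed

lemma exists_orthonormal_perp:
  assumes "infinite_dimensional TYPE('a::complex_hilbert_space)" "finite (F :: 'a set)"
  obtains e :: "nat \<Rightarrow> 'a::complex_hilbert_space" where "orthonormal e" "\<And>n. perp (e n) F"
proof -
  have "\<exists>v. norm v = 1 \<and> perp v G \<and> perp v F" if "finite G" for G :: "'a set"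
    using exists_unit_perp[OF assms(1), of "G \<union> F"] that assms(2) by (metis UnCI finite_UnI)
  then show ?thesis
    using orthonormal_greedy[of "\<lambda>_ v. perp v F"] that by metis
qed

text \<open>Needed for finite rank operators, whose normalized nonzero images have to be completed
  to an infinite sequence.\<close>

lemma orthonormal_extend:
  fixes f :: "nat \<Rightarrow> 'a::complex_hilbert_space"
  assumes "infinite_dimensional TYPE('a)"
    and f: "\<And>i j. i < k \<Longrightarrow> j < k \<Longrightarrow> cinner (f i) (f j) = (if i = j then 1 else 0)"
  obtains g :: "nat \<Rightarrow> 'a::complex_hilbert_space" where "orthonormal g" "\<And>i. i < k \<Longrightarrow> g i = f i"
proof -
  obtain h where h: "orthonormal h" "\<And>n. perp (h n) (f ` {..<k})"
    using exists_orthonormal_perp[OF assms(1), of "f ` {..<k}"] by auto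
  have h2: "cinner (h n) (f i) = 0" "cinner (f i) (h n) = 0" if "i < k" for n i
    using h(2) that cinner_eq_0_sym[of "h n" "f i"] by auto
  let ?g = "\<lambda>n. if n < k then f n else h (n - k)"
  have "orthonormal ?g"
    unfolding orthonormal_def using f h(1) h2 by (auto simp: orthonormal_def)
  then show ?thesis using that[of ?g] by auto
qed

text \<open>
  The projections of the elements of \<open>F\<close> onto the span of \<open>e\<^sub>0, \<dots>, e\<^sub>n\<close> cannot generate it, so some
  \<open>e\<^sub>i\<close> has a nonzero component orthogonal to all of them.
\<close>

lemma exists_perp_in_span:
  assumes e: "orthonormal e" and F: "finite F" "card F \<le> n"
  obtains x where "x \<in> complex_vector.span (e ` {..n})" "x \<noteq> 0" "perp x F"
proof -
  let ?W = "e ` {..n}"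
  note W = orthonormal_image[OF e, of "{..n}"]
  have "complex_vector.independent ?W" by (rule orthonormal_set_independent[OF W])
  moreover have "card ?W = Suc n"
    using orthonormal_inj[OF e] by (simp add: card_image inj_on_subset)
  moreover have "card (proj ?W ` F) \<le> n" using F card_image_le le_trans by blast
  ultimately have "\<not> ?W \<subseteq> complex_vector.span (proj ?W ` F)"
    using complex_vector.independent_span_bound[of "proj ?W ` F" ?W] F(1) by force
  then obtain w where w: "w \<in> ?W" "w \<notin> complex_vector.span (proj ?W ` F)" by blast
  obtain B where B: "finite B" "orthonormal_set B"
    "complex_vector.span B = complex_vector.span (proj ?W ` F)"
    using finite_orthonormal_basis[of "proj ?W ` F"] F(1) by blast
  let ?x = "w - proj B w"
  have sub: "complex_vector.span (proj ?W ` F) \<subseteq> complex_vector.span ?W"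
    by (rule complex_vector.span_minimal)
      (auto intro: proj_in_span complex_vector.subspace_span)
  have "?x \<in> complex_vector.span ?W"
    using w(1) sub B(3) proj_in_span[of B w]
    by (intro complex_vector.span_diff) (auto intro: complex_vector.span_base)
  moreover have "?x \<noteq> 0" using w(2) B(3) proj_in_span[of B w] by auto
  moreover have "cinner ?x u = 0" if "u \<in> F" for u
  proof -
    have "cinner ?x (proj ?W u) = 0"
      using perp_span[OF perp_diff_proj[OF B(2,1)]] B(3) that
      by (auto intro: complex_vector.span_base)
    moreover have "cinner ?x (u - proj ?W u) = 0"
      using cinner_eq_0_sym[OF perp_span[OF perp_diff_proj[OF W finite_imageI[OF finite_atMost]]]]
        \<open>?x \<in> complex_vector.span ?W\<close> by blast
    ultimately show ?thesis by (simp add: cinner.diff_right)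
  qed
  ultimately show ?thesis using that[of ?x] by blast
qed


subsection \<open>Diagonal operators between orthonormal sequences\<close>

lemma norm_orthonormal_sum_seq:
  assumes "orthonormal f" "finite A"
  shows "(norm (\<Sum>n\<in>A. c n *\<^sub>C f n))\<^sup>2 = (\<Sum>n\<in>A. (cmod (c n))\<^sup>2)"
proof -
  note inj = inj_on_subset[OF orthonormal_inj[OF assms(1)] subset_UNIV, of A]
  let ?c = "\<lambda>b. c (the_inv_into A f b)"
  have "(\<Sum>n\<in>A. c n *\<^sub>C f n) = (\<Sum>b\<in>f ` A. ?c b *\<^sub>C b)"
    by (simp add: sum.reindex[OF inj] the_inv_into_f_f[OF inj])
  moreover have "(\<Sum>n\<in>A. (cmod (c n))\<^sup>2) = (\<Sum>b\<in>f ` A. (cmod (?c b))\<^sup>2)"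
    by (simp add: sum.reindex[OF inj] the_inv_into_f_f[OF inj])
  ultimately show ?thesis
    using norm_orthonormal_sum[OF orthonormal_image[OF assms(1)], of A ?c] assms(2) by simp
qed

lemma bessel_sum:
  assumes "orthonormal e" "finite A"
  shows "(\<Sum>n\<in>A. (cmod (cinner x (e n)))\<^sup>2) \<le> (norm x)\<^sup>2"
proof -
  have "(\<Sum>n\<in>A. (cmod (cinner x (e n)))\<^sup>2) = (\<Sum>b\<in>e ` A. (cmod (cinner x b))\<^sup>2)"
    by (simp add: sum.reindex inj_on_subset[OF orthonormal_inj[OF assms(1)] subset_UNIV])
  then show ?thesis
    using bessel[OF orthonormal_image[OF assms(1)], of A x] assms(2) by simp
qed

lemma bessel_summable:
  assumes "orthonormal e"
  shows "summable (\<lambda>n. (cmod (cinner x (e n)))\<^sup>2)"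
  by (rule summableI_nonneg_bounded[where x = "(norm x)\<^sup>2"])
    (use bessel_sum[OF assms] in auto)

text \<open>Riesz-Fischer: by Pythagoras the Cauchy criterion for the vectors is that for the
  squared coefficients.\<close>

lemma orthonormal_summable:
  assumes f: "orthonormal f" and c: "summable (\<lambda>n. (cmod (c n))\<^sup>2)"
  shows "summable (\<lambda>n. c n *\<^sub>C f n)"
proof (subst summable_Cauchy, intro allI impI)
  fix r :: real assume r: "r > 0"
  then obtain N where N: "\<And>m n. m \<ge> N \<Longrightarrow> norm (\<Sum>k\<in>{m..<n}. (cmod (c k))\<^sup>2) < r\<^sup>2"
    using c[unfolded summable_Cauchy] by (metis zero_less_power)
  have "norm (\<Sum>k\<in>{m..<n}. c k *\<^sub>C f k) < r" if "m \<ge> N" for m n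
  proof -
    have "(norm (\<Sum>k\<in>{m..<n}. c k *\<^sub>C f k))\<^sup>2 < r\<^sup>2"
      using N[OF that, of n] by (simp add: norm_orthonormal_sum_seq[OF f] sum_nonneg)
    then show ?thesis using r by (simp add: power2_less_imp_less)
  qed
  then show "\<exists>N. \<forall>m\<ge>N. \<forall>n. norm (\<Sum>k\<in>{m..<n}. c k *\<^sub>C f k) < r" by blast
qed

text \<open>Neither sequence has to be complete: the operator vanishes on the orthogonal complement
  of the \<open>e n\<close>. This covers diagonal operators, Schmidt decompositions and, with
  \<open>s\<close> constantly 1, the partial isometries carrying one orthonormal sequence to
  another.\<close>

definition diag ::
    "(nat \<Rightarrow> real) \<Rightarrow> (nat \<Rightarrow> 'a) \<Rightarrow> (nat \<Rightarrow> 'a) \<Rightarrow> 'a::complex_hilbert_space \<Rightarrow>\<^sub>L 'a" where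
  "diag s e f = Blinfun (\<lambda>x. \<Sum>n. (of_real (s n) * cinner x (e n)) *\<^sub>C f n)"

text \<open>The bound on \<open>s\<close> is asked only where \<open>x\<close> has a nonzero
  coefficient, so the norm estimate improves on vectors orthogonal to the first few
  \<open>e n\<close>.\<close>

lemma diag_series:
  assumes e: "orthonormal e" and f: "orthonormal f" and M: "0 \<le> M"
    and s: "\<And>n. cinner x (e n) \<noteq> 0 \<Longrightarrow> \<bar>s n\<bar> \<le> M"
  shows "summable (\<lambda>n. (of_real (s n) * cinner x (e n)) *\<^sub>C f n)" (is "summable ?a")
    and "norm (\<Sum>n. (of_real (s n) * cinner x (e n)) *\<^sub>C f n) \<le> M * norm x"
proof -
  have le: "(cmod (of_real (s n) * cinner x (e n)))\<^sup>2 \<le> M\<^sup>2 * (cmod (cinner x (e n)))\<^sup>2" for n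
  proof (cases "cinner x (e n) = 0")
    case False
    from power_mono[OF s[OF this] abs_ge_zero, of 2] show ?thesis
      by (simp add: norm_mult power_mult_distrib mult_right_mono)
  qed simp
  have "summable (\<lambda>n. (cmod (of_real (s n) * cinner x (e n)))\<^sup>2)"
    by (rule summable_comparison_test'[OF summable_mult[OF bessel_summable[OF e, of x], of "M\<^sup>2"], of 0])
      (use le in simp)
  from orthonormal_summable[OF f this] show sm: "summable ?a" .
  have "norm (\<Sum>k<n. ?a k) \<le> M * norm x" for n
  proof (rule power2_le_imp_le)
    have "(norm (\<Sum>k<n. ?a k))\<^sup>2 = (\<Sum>k<n. (cmod (of_real (s k) * cinner x (e k)))\<^sup>2)"
      by (rule norm_orthonormal_sum_seq[OF f]) simp
    also have "\<dots> \<le> (\<Sum>k<n. M\<^sup>2 * (cmod (cinner x (e k)))\<^sup>2)"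
      by (rule sum_mono) (rule le)
    also have "\<dots> \<le> M\<^sup>2 * (norm x)\<^sup>2"
      unfolding sum_distrib_left[symmetric]
      by (intro mult_left_mono bessel_sum e) auto
    finally show "(norm (\<Sum>k<n. ?a k))\<^sup>2 \<le> (M * norm x)\<^sup>2" by (simp add: power_mult_distrib)
  qed (use M in auto)
  moreover have "(\<lambda>n. norm (\<Sum>k<n. ?a k)) \<longlonglongrightarrow> norm (suminf ?a)"
    by (intro tendsto_norm summable_LIMSEQ sm)
  ultimately show "norm (suminf ?a) \<le> M * norm x"
    by (intro LIMSEQ_le_const2) auto
qed

locale diag_op =
  fixes s :: "nat \<Rightarrow> real" and e f :: "nat \<Rightarrow> 'a::complex_hilbert_space"
  assumes orth_e: "orthonormal e" and orth_f: "orthonormal f" and bdd_s: "bounded (range s)"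
begin

lemma diag_sums: "(\<lambda>n. (of_real (s n) * cinner x (e n)) *\<^sub>C f n) sums diag s e f x"
proof -
  obtain M where "\<And>n. norm (s n) \<le> M" using bdd_s by (auto simp: bounded_iff)
  then have M: "\<And>n. \<bar>s n\<bar> \<le> max M 0" by (simp add: le_max_iff_disj)
  let ?D = "\<lambda>x. \<Sum>n. (of_real (s n) * cinner x (e n)) *\<^sub>C f n"
  have sums: "(\<lambda>n. (of_real (s n) * cinner x (e n)) *\<^sub>C f n) sums ?D x" for x
    by (intro summable_sums diag_series(1)[OF orth_e orth_f max.cobounded2 M])
  have "bounded_linear ?D"
  proof (rule bounded_linear_intro[where K = "max M 0"])
    fix x y :: 'a and r :: real
    show "?D (x + y) = ?D x + ?D y"
      using sums_add[OF sums[of x] sums[of y]] sums[of "x + y"]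
      by (simp add: cinner_add_left distrib_left scaleC_add_left sums_unique2)
    show "?D (r *\<^sub>R x) = r *\<^sub>R ?D x"
      using sums_scaleR_right[OF sums[of x], of r] sums[of "r *\<^sub>R x"]
      by (simp add: cinner_scaleC_left scaleR_scaleC scaleC_scaleC sums_unique2 mult.left_commute)
    show "norm (?D x) \<le> norm x * max M 0"
      by (subst mult.commute) (rule diag_series(2)[OF orth_e orth_f max.cobounded2 M])
  qed
  then show ?thesis
    using sums[of x] by (simp add: diag_def bounded_linear_Blinfun_apply)
qed

lemma diag_unique: "(\<lambda>n. (of_real (s n) * cinner x (e n)) *\<^sub>C f n) sums y \<Longrightarrow> diag s e f x = y"
  using diag_sums sums_unique2 by blast

lemma cinner_diag_left: "(\<lambda>n. of_real (s n) * cinner x (e n) * cinner (f n) y) sums cinner (diag s e f x) y"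
  using bounded_linear.sums[OF cinner.bounded_linear_left diag_sums, of x y]
  by (simp add: cinner_scaleC_left)

lemma cinner_diag: "cinner (diag s e f x) (f n) = of_real (s n) * cinner x (e n)"
proof -
  have "(\<lambda>k. of_real (s k) * cinner x (e k) * cinner (f k) (f n)) =
    (\<lambda>k. if k = n then of_real (s k) * cinner x (e k) else 0)"
    using orth_f by (auto simp: orthonormal_def)
  then show ?thesis
    using cinner_diag_left[of x "f n"] sums_single[of n "\<lambda>k. of_real (s k) * cinner x (e k)"]
      sums_unique2 by metis
qed

lemma diag_basis: "diag s e f (e n) = of_real (s n) *\<^sub>C f n"
proof (rule diag_unique)
  have "(\<lambda>k. (of_real (s k) * cinner (e n) (e k)) *\<^sub>C f k) =
    (\<lambda>k. if k = n then of_real (s k) *\<^sub>C f k else 0)"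
    using orth_e by (auto simp: orthonormal_def)
  then show "(\<lambda>k. (of_real (s k) * cinner (e n) (e k)) *\<^sub>C f k) sums (of_real (s n) *\<^sub>C f n)"
    using sums_single[of n "\<lambda>k. of_real (s k) *\<^sub>C f k"] by simp
qed

lemma norm_diag_le:
  assumes "0 \<le> M" "\<And>n. cinner x (e n) \<noteq> 0 \<Longrightarrow> \<bar>s n\<bar> \<le> M"
  shows "norm (diag s e f x) \<le> M * norm x"
  by (subst sums_unique[OF diag_sums]) (rule diag_series(2)[OF orth_e orth_f assms])

lemma diag_in_BH: "diag s e f \<in> BH"
proof -
  have "diag s e f (c *\<^sub>C x) = c *\<^sub>C diag s e f x" for c x
  proof (rule diag_unique)
    show "(\<lambda>n. (of_real (s n) * cinner (c *\<^sub>C x) (e n)) *\<^sub>C f n) sums (c *\<^sub>C diag s e f x)"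
      using bounded_linear.sums[OF scaleC.bounded_linear_right diag_sums, of c x]
      by (simp add: cinner_scaleC_left scaleC_scaleC mult.left_commute)
  qed
  then show ?thesis by (simp add: BH_def)
qed

lemma diag_adjoint: "cinner (diag s e f x) y = cinner x (diag s f e y)"
proof -
  interpret adj: diag_op s f e by unfold_locales (rule orth_e orth_f bdd_s)+
  have "(\<lambda>n. cinner x ((of_real (s n) * cinner y (f n)) *\<^sub>C e n)) sums cinner x (diag s f e y)"
    by (rule bounded_linear.sums[OF cinner.bounded_linear_right adj.diag_sums])
  moreover have "cinner x ((of_real (s n) * cinner y (f n)) *\<^sub>C e n) =
      of_real (s n) * cinner x (e n) * cinner (f n) y" for n
    by (simp add: cinner_scaleC_right mult_ac cinner_commute[of "f n" y])
  ultimately show ?thesis using cinner_diag_left[of x y] sums_unique2 by force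
qed

end

lemma diag_compose:
  assumes "diag_op s e f" "diag_op t f g"
  shows "diag t f g o\<^sub>L diag s e f = diag (\<lambda>n. t n * s n) e g"
proof (rule blinfun_eqI)
  fix x
  interpret s: diag_op s e f by fact
  interpret t: diag_op t f g by fact
  have "bounded (range (\<lambda>n. t n * s n))"
  proof -
    obtain K M where K: "\<And>n. \<bar>t n\<bar> \<le> K" and M: "\<And>n. \<bar>s n\<bar> \<le> M"
      using s.bdd_s t.bdd_s by (auto simp: bounded_iff)
    have "\<bar>t n * s n\<bar> \<le> K * M" for n
      unfolding abs_mult by (intro mult_mono K M order_trans[OF abs_ge_zero K] abs_ge_zero)
    then show ?thesis by (auto simp: bounded_iff)
  qed
  then interpret ts: diag_op "\<lambda>n. t n * s n" e g
    using s.orth_e t.orth_f by unfold_locales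
  have "diag t f g (diag s e f x) = diag (\<lambda>n. t n * s n) e g x"
    by (rule t.diag_unique)
      (use ts.diag_sums[of x] in \<open>simp add: s.cinner_diag mult.assoc\<close>)
  then show "(diag t f g o\<^sub>L diag s e f) x = diag (\<lambda>n. t n * s n) e g x" by simp
qed

lemma diag_add:
  assumes "diag_op s e f" "diag_op t e f"
  shows "diag s e f + diag t e f = diag (\<lambda>n. s n + t n) e f"
proof (rule blinfun_eqI)
  fix x
  interpret s: diag_op s e f by fact
  interpret t: diag_op t e f by fact
  interpret st: diag_op "\<lambda>n. s n + t n" e f
    by unfold_locales (use s.orth_e s.orth_f s.bdd_s t.bdd_s in \<open>auto intro: bounded_plus_comp\<close>)
  have "diag (\<lambda>n. s n + t n) e f x = diag s e f x + diag t e f x"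
    by (rule st.diag_unique)
      (use sums_add[OF s.diag_sums[of x] t.diag_sums[of x]] in
        \<open>simp add: distrib_right scaleC_add_left\<close>)
  then show "(diag s e f + diag t e f) x = diag (\<lambda>n. s n + t n) e f x"
    by (simp add: blinfun.add_left)
qed

lemma c0_star_bounded: "s \<in> c0_star \<Longrightarrow> bounded (range s)"
  unfolding c0_star_def using convergent_imp_bounded by auto


subsection \<open>Compact operators and the Schmidt decomposition\<close>

text \<open>Compactness in the form that Gelfand numbers tend to zero. It passes directly to sums
  and products: finite sets of conditions are united, or moved by an adjoint.\<close>

definition compact_op :: "('a::complex_hilbert_space \<Rightarrow>\<^sub>L 'a) \<Rightarrow> bool" where
  "compact_op X \<longleftrightarrow>
    (\<forall>r>0. \<exists>F. finite F \<and> (\<forall>x. perp x F \<longrightarrow> norm (X x) \<le> r * norm x))"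

lemma BH_scaleC: "X \<in> BH \<Longrightarrow> blinfun_apply X (c *\<^sub>C x) = c *\<^sub>C X x"
  by (simp add: BH_def)

lemma norm_add_squared:
  "(norm (x + y))\<^sup>2 = (norm x)\<^sup>2 + 2 * Re (cinner x y) + (norm (y::'a::complex_hilbert_space))\<^sup>2"
  by (simp add: power2_norm_eq_inner inner_add_left inner_add_right inner_commute
      flip: inner_eq_Re_cinner)

section \<open>Norm attainment for compact operators\<close>

lemma compact_finite_combinations:
  fixes u :: "'b \<Rightarrow> 'a::complex_hilbert_space"
  assumes "finite B"
  shows "\<exists>K. compact K \<and> (\<forall>c. (\<forall>b\<in>B. cmod (c b) \<le> 1) \<longrightarrow> (\<Sum>b\<in>B. c b *\<^sub>C u b) \<in> K)"
  using assms
proof (induction B)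
  case empty
  show ?case by (intro exI[of _ "{0}"]) simp
next
  case (insert b B)
  then obtain K where K: "compact K"
    "\<And>c. (\<forall>b\<in>B. cmod (c b) \<le> 1) \<Longrightarrow> (\<Sum>b\<in>B. c b *\<^sub>C u b) \<in> K" by blast
  let ?L = "(\<lambda>c. c *\<^sub>C u b) ` cball 0 1"
  have "compact ?L"
    by (intro compact_continuous_image compact_cball
        linear_continuous_on scaleC.bounded_linear_left)
  then have "compact {x + y | x y. x \<in> ?L \<and> y \<in> K}"
    by (rule compact_sums[OF _ K(1)])
  moreover have "(\<Sum>b\<in>insert b B. c b *\<^sub>C u b) \<in> {x + y | x y. x \<in> ?L \<and> y \<in> K}"
    if "\<forall>b\<in>insert b B. cmod (c b) \<le> 1" for c
  proof -
    have "c b *\<^sub>C u b \<in> ?L" "(\<Sum>b\<in>B. c b *\<^sub>C u b) \<in> K" using that K(2)[of c] by auto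
    then show ?thesis unfolding sum.insert[OF insert.hyps] by blast
  qed
  ultimately show ?case by blast
qed

text \<open>The image of the ball stays within \<open>r/4\<close> of a compact set: the component of
  \<open>x\<close> in the span of \<open>F\<close> has bounded coefficients on \<open>B\<close>, so
  its image lies in \<open>K\<close>, and the image of the remaining component has norm at most
  \<open>r/4\<close>.\<close>

lemma compact_op_closure_image:
  fixes X :: "'a::complex_hilbert_space \<Rightarrow>\<^sub>L 'a"
  assumes X: "X \<in> BH" "compact_op X"
  shows "compact (closure (X ` cball 0 1))"
  unfolding compact_eq_totally_bounded
proof (intro conjI allI impI)
  show "complete (closure (X ` cball 0 1))"
    by (simp add: complete_eq_closed)
  fix r :: real assume r: "r > 0"
  then obtain F where F: "finite F" "\<And>x. perp x F \<Longrightarrow> norm (X x) \<le> (r/4) * norm x"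
    using X(2) unfolding compact_op_def by (meson divide_pos_pos zero_less_numeral)
  obtain B where B: "finite B" "orthonormal_set B"
    "complex_vector.span B = complex_vector.span F"
    using finite_orthonormal_basis[OF F(1)] by blast
  obtain K where K: "compact K"
    "\<And>c. (\<forall>b\<in>B. cmod (c b) \<le> 1) \<Longrightarrow> (\<Sum>b\<in>B. c b *\<^sub>C X b) \<in> K"
    using compact_finite_combinations[OF B(1), of X] by blast
  obtain k where k: "finite k" "K \<subseteq> (\<Union>x\<in>k. ball x (r/4))"
    using K(1) r unfolding compact_eq_totally_bounded by (meson divide_pos_pos zero_less_numeral)
  have "y \<in> (\<Union>x\<in>k. ball x r)" if y: "y \<in> closure (X ` cball 0 1)" for y
  proof -
    obtain x where x: "norm x \<le> 1" "dist (X x) y < r/4"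
      using y r unfolding closure_approachable by (fastforce dest: spec[of _ "r/4"])
    have "X (proj B x) = (\<Sum>b\<in>B. cinner x b *\<^sub>C X b)"
      by (simp add: proj_def blinfun.sum_right BH_scaleC[OF X(1)])
    also have "\<dots> \<in> K"
    proof (intro K(2) ballI)
      fix b assume "b \<in> B"
      then have "cinner b b = 1" using B(2) by (auto simp: orthonormal_set_def)
      then have "norm b = 1" by (simp only: cinner_self_eq_1)
      then show "cmod (cinner x b) \<le> 1" using norm_cinner_le[of x b] x(1) by simp
    qed
    finally obtain z where z: "z \<in> k" "dist z (X (proj B x)) < r/4" using k(2) by fastforce
    have "perp (x - proj B x) F"
      using perp_span[OF perp_diff_proj[OF B(2,1)]] B(3) complex_vector.span_base by blast
    then have "norm (X (x - proj B x)) \<le> (r/4) * norm (x - proj B x)" by (rule F(2))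
    also have "\<dots> \<le> (r/4) * 1"
      by (intro mult_left_mono order_trans[OF norm_diff_proj_le[OF B(2,1)] x(1)]) (use r in auto)
    finally have "dist (X x) (X (proj B x)) \<le> r/4"
      by (simp add: dist_norm blinfun.diff_right)
    then have "dist z y < r"
      using r z(2) x(2) dist_triangle[of z y "X (proj B x)"] dist_triangle[of "X (proj B x)" y "X x"]
      unfolding dist_commute[of "X (proj B x)" "X x"] by linarith
    then show ?thesis using z(1) by auto
  qed
  then show "\<exists>k. finite k \<and> closure (X ` cball 0 1) \<subseteq> (\<Union>x\<in>k. ball x r)"
    using k(1) by blast
qed

lemma parallelogram_law:
  "(norm (x + y))\<^sup>2 + (norm (x - y))\<^sup>2 = 2 * (norm x)\<^sup>2 + 2 * (norm (y::'a::real_inner))\<^sup>2"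
  by (simp add: power2_norm_eq_inner inner_add_left inner_add_right inner_diff_left
      inner_diff_right)

text \<open>
  By the parallelogram law a maximizing sequence whose images form a Cauchy sequence is itself
  Cauchy.
\<close>

lemma compact_op_attains_norm:
  fixes X :: "'a::complex_hilbert_space \<Rightarrow>\<^sub>L 'a"
  assumes dim: "infinite_dimensional TYPE('a)" and X: "X \<in> BH" "compact_op X" and F: "finite F"
  shows "\<exists>v. norm v = 1 \<and> perp v F \<and> (\<forall>w. perp w F \<longrightarrow> norm (X w) \<le> norm (X v) * norm w)"
proof -
  define S where "S = {norm (X w) | w. norm w = 1 \<and> perp w F}"
  define M where "M = Sup S"
  obtain v0 where v0: "norm v0 = 1" "perp v0 F" using exists_unit_perp[OF dim F] by blast
  have ne: "S \<noteq> {}" using v0 by (auto simp: S_def)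
  have "norm (X w) \<le> norm X" if "norm w = 1" for w
    using norm_blinfun[of X w] that by simp
  then have bdd: "bdd_above S" by (auto simp: S_def intro!: bdd_aboveI[of _ "norm X"])
  have M: "norm (X w) \<le> M * norm w" if w: "perp w F" for w
  proof (cases "w = 0")
    case False
    let ?u = "of_real (inverse (norm w)) *\<^sub>C w"
    have "norm ?u = 1" using False by (simp add: norm_scaleC norm_inverse)
    then have "norm (X ?u) \<in> S" using perp_scaleC[OF w] unfolding S_def by blast
    then have "norm (X ?u) \<le> M" unfolding M_def by (rule cSup_upper[OF _ bdd])
    then show ?thesis using False
      by (simp add: BH_scaleC[OF X(1)] norm_scaleC norm_inverse norm_divide divide_simps mult.commute)
  qed simp
  have M0: "0 \<le> M" using order_trans[OF norm_ge_zero M[OF v0(2)]] v0(1) by simp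
  show ?thesis
  proof (cases "M = 0")
    case True
    then show ?thesis using v0 M by (intro exI[of _ v0]) fastforce
  next
    case False
    have "\<exists>x. norm x = 1 \<and> perp x F \<and> M - inverse (real (Suc n)) < norm (X x)" for n
    proof -
      have "M - inverse (real (Suc n)) < Sup S" by (simp add: M_def)
      then show ?thesis using less_cSupD[OF ne] unfolding S_def by blast
    qed
    then obtain x where x: "\<And>n. norm (x n) = 1" "\<And>n. perp (x n) F"
      "\<And>n. M - inverse (real (Suc n)) < norm (X (x n))" by metis
    have "X (x n) \<in> closure (X ` cball 0 1)" for n
      by (rule subsetD[OF closure_subset imageI]) (simp add: x(1))
    then obtain l r where "strict_mono r" "((\<lambda>n. X (x n)) \<circ> r) \<longlonglongrightarrow> l"
      using compact_op_closure_image[OF X, unfolded compact_def, rule_format, of "\<lambda>n. X (x n)"]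
      by blast
    then have r: "strict_mono r" "(\<lambda>n. X (x (r n))) \<longlonglongrightarrow> l" by (simp_all add: o_def)
    define y where "y n = x (r n)" for n
    have y: "norm (y n) = 1" "perp (y n) F" for n using x by (auto simp: y_def)
    have Xy_le: "norm (X (y n)) \<le> M" for n using M[OF y(2)] y(1) by simp
    have lim: "(\<lambda>n. norm (X (y n))) \<longlonglongrightarrow> M"
    proof (rule tendsto_sandwich)
      have "(\<lambda>n. M - inverse (real (Suc n))) \<longlonglongrightarrow> M - 0"
        by (intro tendsto_diff tendsto_const LIMSEQ_inverse_real_of_nat)
      then show "(\<lambda>n. M - inverse (real (Suc (r n)))) \<longlonglongrightarrow> M"
        using LIMSEQ_subseq_LIMSEQ[OF _ r(1)] by (force simp: o_def)
      show "\<forall>\<^sub>F n in sequentially. M - inverse (real (Suc (r n))) \<le> norm (X (y n))"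
        using x(3) by (simp add: y_def less_imp_le)
    qed (use Xy_le in auto)
    \<comment> \<open>The parallelogram law twice: for the unit vectors \<open>y m\<close> and
      \<open>y n\<close>, whose sum is again orthogonal to \<open>F\<close>, and for their
      images.\<close>
    have para: "M\<^sup>2 * (norm (y m - y n))\<^sup>2 \<le>
        4 * M\<^sup>2 - 2 * (norm (X (y m)))\<^sup>2 - 2 * (norm (X (y n)))\<^sup>2 + (norm (X (y m) - X (y n)))\<^sup>2" for m n
    proof -
      have "perp (y m + y n) F" using y(2) by (simp add: cinner_add_left)
      then have "(norm (X (y m + y n)))\<^sup>2 \<le> (M * norm (y m + y n))\<^sup>2"
        by (intro power_mono M) auto
      also have "\<dots> = M\<^sup>2 * (4 - (norm (y m - y n))\<^sup>2)"
        using parallelogram_law[of "y m" "y n"] y(1) by (simp add: power_mult_distrib)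
      finally show ?thesis
        using parallelogram_law[of "X (y m)" "X (y n)"]
        by (simp add: blinfun.add_right algebra_simps)
    qed
    have "Cauchy y"
    proof (rule metric_CauchyI)
      fix d :: real assume d: "0 < d"
      have "0 < M\<^sup>2 * d\<^sup>2" using False d by simp
      have "(\<lambda>n. (norm (X (y n)))\<^sup>2) \<longlonglongrightarrow> M\<^sup>2" by (intro tendsto_power lim)
      \<comment> \<open>With this threshold the first three terms on the right of
        \<open>para\<close> add up to less than half of \<open>M\<^sup>2 * d\<^sup>2\<close>. The
        bound \<open>M * d / 2\<close> on the images adds at most a quarter.\<close>
      moreover have "M\<^sup>2 - M\<^sup>2 * d\<^sup>2 / 8 < M\<^sup>2" using False d by simp
      ultimately have "\<forall>\<^sub>F n in sequentially. M\<^sup>2 - M\<^sup>2 * d\<^sup>2 / 8 < (norm (X (y n)))\<^sup>2"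
        by (rule order_tendstoD)
      then obtain N1 where N1: "\<And>n. n \<ge> N1 \<Longrightarrow> M\<^sup>2 - M\<^sup>2 * d\<^sup>2 / 8 < (norm (X (y n)))\<^sup>2"
        by (auto simp: eventually_sequentially)
      have "Cauchy (\<lambda>n. X (y n))" using r(2) by (auto simp: y_def intro: LIMSEQ_imp_Cauchy)
      moreover have "0 < M * d / 2" using M0 False d by simp
      ultimately obtain N2 where N2: "\<And>m n. m \<ge> N2 \<Longrightarrow> n \<ge> N2 \<Longrightarrow> dist (X (y m)) (X (y n)) < M * d / 2"
        unfolding Cauchy_def by metis
      have "dist (y m) (y n) < d" if mn: "m \<ge> max N1 N2" "n \<ge> max N1 N2" for m n
      proof -
        have "(norm (X (y m) - X (y n)))\<^sup>2 < (M * d / 2)\<^sup>2"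
          using N2[of m n] mn by (intro power_strict_mono) (auto simp: dist_norm)
        also have "\<dots> = M\<^sup>2 * d\<^sup>2 / 4" by (simp add: power2_eq_square)
        finally have "M\<^sup>2 * (norm (y m - y n))\<^sup>2 < M\<^sup>2 * d\<^sup>2"
          using para[of m n] N1[of m] N1[of n] mn \<open>0 < M\<^sup>2 * d\<^sup>2\<close> by simp
        then have "(norm (y m - y n))\<^sup>2 < d\<^sup>2" using False by simp
        then show ?thesis using d by (simp add: dist_norm power2_less_imp_less)
      qed
      then show "\<exists>N. \<forall>m\<ge>N. \<forall>n\<ge>N. dist (y m) (y n) < d" by blast
    qed
    then obtain v where v: "y \<longlonglongrightarrow> v" using Cauchy_convergent convergent_def by blast
    have "norm v = 1"
      using tendsto_norm[OF v] y(1) by (simp add: LIMSEQ_const_iff)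
    moreover have "perp v F"
    proof
      fix u assume "u \<in> F"
      then show "cinner v u = 0"
        using bounded_linear.tendsto[OF cinner.bounded_linear_left v, of u] y(2)
        by (simp add: LIMSEQ_const_iff)
    qed
    moreover have "norm (X v) = M"
      using LIMSEQ_unique[OF lim] tendsto_norm[OF blinfun.tendsto[OF tendsto_const v]] by blast
    ultimately show ?thesis using M by blast
  qed
qed

text \<open>First variation: moving \<open>v\<close> by a small multiple of \<open>w\<close>, with
  phase taken from \<open>?c\<close>, gains a term linear in \<open>r\<close>, while the admissible
  bound grows only quadratically. The choice \<open>r = 1 / (K + 1)\<close> gives
  \<open>r * K < 1\<close>, so the gain would win.\<close>

lemma maximal_vector_orthogonal:
  assumes X: "X \<in> BH" and v: "norm v = 1" "perp v F"
    and max: "\<And>w. perp w F \<Longrightarrow> norm (X w) \<le> norm (X v) * norm w"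
    and w: "perp w F" "cinner v w = 0"
  shows "cinner (X v) (X w) = 0"
proof (rule ccontr)
  let ?c = "cinner (X v) (X w)" and ?M = "norm (X v)"
  assume c: "?c \<noteq> 0"
  define K where "K = ?M\<^sup>2 * (norm w)\<^sup>2"
  define r where "r = 1 / (K + 1)"
  have K: "K \<ge> 0" by (simp add: K_def)
  then have r: "r > 0" by (simp add: r_def)
  let ?z = "(of_real r * ?c) *\<^sub>C w"
  have zw: "norm ?z = r * cmod ?c * norm w" using r by (simp add: norm_scaleC norm_mult)
  have "cinner (X v) (X ?z) = of_real r * (?c * cnj ?c)"
    by (simp add: BH_scaleC[OF X] cinner_scaleC_right mult_ac)
  then have Re: "Re (cinner (X v) (X ?z)) = r * (cmod ?c)\<^sup>2"
    by (simp flip: complex_norm_square)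
  have "perp (v + ?z) F" using v(2) w(1) by (simp add: cinner_add_left cinner_scaleC_left)
  then have "(norm (X (v + ?z)))\<^sup>2 \<le> (?M * norm (v + ?z))\<^sup>2"
    by (intro power_mono max) auto
  also have "\<dots> = ?M\<^sup>2 * (1 + (norm ?z)\<^sup>2)"
    using pythagoras[of v ?z] w(2) v(1) by (simp add: power_mult_distrib cinner_scaleC_right)
  finally have "2 * (r * (cmod ?c)\<^sup>2) \<le> ?M\<^sup>2 * (norm ?z)\<^sup>2"
    using norm_add_squared[of "X v" "X ?z", unfolded Re] zero_le_power2[of "norm (X ?z)"]
    unfolding blinfun.add_right distrib_left mult_1_right by linarith
  also have "\<dots> = (r * (cmod ?c)\<^sup>2) * (r * K)"
    by (simp add: zw K_def power_mult_distrib) (simp add: power2_eq_square)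
  finally have "2 \<le> r * K" using c r by simp
  then show False using K by (simp add: r_def field_simps)
qed

lemma orthonormal_weakly_null:
  assumes "orthonormal e"
  shows "(\<lambda>n. cmod (cinner (e n) x)) \<longlonglongrightarrow> 0"
proof -
  have "(\<lambda>n. sqrt ((cmod (cinner x (e n)))\<^sup>2)) \<longlonglongrightarrow> sqrt 0"
    by (intro tendsto_real_sqrt summable_LIMSEQ_zero bessel_summable assms)
  then show ?thesis by (simp add: cinner_commute[of "e _" x])
qed

text \<open>The components in the span of a finite set tend to zero because orthonormal sequences
  are weakly null; on the rest \<open>X\<close> is small by compactness.\<close>

lemma compact_op_orthonormal_null:
  assumes X: "X \<in> BH" "compact_op X" and e: "orthonormal e"
  shows "(\<lambda>n. norm (X (e n))) \<longlonglongrightarrow> 0"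
proof (rule LIMSEQ_I)
  fix r :: real assume r: "r > 0"
  then obtain F where F: "finite F" "\<And>x. perp x F \<Longrightarrow> norm (X x) \<le> (r/2) * norm x"
    using X(2) unfolding compact_op_def by (meson half_gt_zero)
  obtain B where B: "finite B" "orthonormal_set B"
    "complex_vector.span B = complex_vector.span F"
    using finite_orthonormal_basis[OF F(1)] by blast
  have "(\<lambda>n. \<Sum>b\<in>B. cmod (cinner (e n) b) * norm (X b)) \<longlonglongrightarrow> (\<Sum>b\<in>B. 0 * norm (X b))"
    by (intro tendsto_sum tendsto_mult tendsto_const orthonormal_weakly_null e)
  then have "\<forall>\<^sub>F n in sequentially. (\<Sum>b\<in>B. cmod (cinner (e n) b) * norm (X b)) < r/2"
    using r by (intro order_tendstoD(2)) auto
  then obtain N where N: "\<And>n. n \<ge> N \<Longrightarrow> (\<Sum>b\<in>B. cmod (cinner (e n) b) * norm (X b)) < r/2"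
    by (auto simp: eventually_sequentially)
  have "norm (X (e n)) < r" if "n \<ge> N" for n
  proof -
    have "perp (e n - proj B (e n)) F"
      using perp_span[OF perp_diff_proj[OF B(2,1)]] B(3) complex_vector.span_base by blast
    then have "norm (X (e n - proj B (e n))) \<le> (r/2) * norm (e n - proj B (e n))" by (rule F(2))
    also have "\<dots> \<le> (r/2) * norm (e n)"
      using r by (intro mult_left_mono norm_diff_proj_le[OF B(2,1)]) auto
    finally have 1: "norm (X (e n - proj B (e n))) \<le> r/2" by (simp add: orthonormal_norm[OF e])
    have "norm (X (proj B (e n))) \<le> (\<Sum>b\<in>B. cmod (cinner (e n) b) * norm (X b))"
      unfolding proj_def blinfun.sum_right
      by (rule order_trans[OF norm_sum]) (simp add: BH_scaleC[OF X(1)] norm_scaleC)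
    with N[OF that] have 2: "norm (X (proj B (e n))) < r/2" by simp
    have "norm (X (e n)) \<le> norm (X (e n - proj B (e n))) + norm (X (proj B (e n)))"
      using norm_triangle_ineq[of "X (e n - proj B (e n))" "X (proj B (e n))"]
      by (simp add: blinfun.diff_right)
    then show ?thesis using 1 2 by simp
  qed
  then show "\<exists>N. \<forall>n\<ge>N. norm (norm (X (e n)) - 0) < r" by auto
qed

text \<open>Each \<open>e n\<close> maximizes the norm of the image among unit vectors orthogonal to
  its predecessors. This makes \<open>s\<close> decreasing and, by first variation, the images
  mutually orthogonal.\<close>

theorem schmidt_decomposition:
  fixes X :: "'a::complex_hilbert_space \<Rightarrow>\<^sub>L 'a"
  assumes dim: "infinite_dimensional TYPE('a)" and X: "X \<in> BH" "compact_op X"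
  obtains s e f where "s \<in> c0_star" "orthonormal e" "orthonormal f" "X = diag s e f"
proof -
  obtain e where e: "orthonormal e"
    and max: "\<And>n w. perp w (e ` {..<n}) \<Longrightarrow> norm (X w) \<le> norm (X (e n)) * norm w"
    using orthonormal_greedy[of "\<lambda>F v. \<forall>w. perp w F \<longrightarrow> norm (X w) \<le> norm (X v) * norm w"]
      compact_op_attains_norm[OF dim X] by (smt (verit))
  define s where "s n = norm (X (e n))" for n
  have perp: "perp (e m) (e ` {..<n})" if "n \<le> m" for m n
    using e that by (auto simp: orthonormal_def)
  have orth: "cinner (X (e n)) (X (e m)) = 0" if "n < m" for m n
  proof (rule maximal_vector_orthogonal[OF X(1), of _ "e ` {..<n}"])
    show "cinner (e n) (e m) = 0" using e that by (simp add: orthonormal_def)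
  qed (use perp[of n n] perp[OF less_imp_le[OF that]] max[of n] orthonormal_norm[OF e] in simp_all)
  have "s m \<le> s n" if "n \<le> m" for m n
    using max[OF perp[OF that]] by (simp add: s_def orthonormal_norm[OF e])
  then have anti: "antimono s" by (simp add: antimonoI)
  then have s: "s \<in> c0_star"
    using compact_op_orthonormal_null[OF X e] by (simp add: c0_star_def s_def[abs_def])
  \<comment> \<open>Since the inverse of 0 is 0, \<open>f0 n\<close> is the zero vector when
    \<open>s n = 0\<close>; it is normalized only where \<open>s n > 0\<close>.\<close>
  define f0 where "f0 n = of_real (inverse (s n)) *\<^sub>C X (e n)" for n
  have f0: "cinner (f0 i) (f0 j) = (if i = j then 1 else 0)" if "s i > 0" "s j > 0" for i j
  proof (cases "i = j")
    case True
    then show ?thesis using that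
      by (simp add: cinner_self_eq_1 f0_def norm_scaleC norm_inverse) (simp add: s_def)
  next
    case False
    then have "cinner (X (e i)) (X (e j)) = 0"
      using orth[of i j] orth[of j i] cinner_eq_0_sym[of "X (e j)" "X (e i)"] by linarith
    then show ?thesis using False by (simp add: f0_def cinner_scaleC_left cinner_scaleC_right)
  qed
  have s0: "0 \<le> s n" for n by (simp add: s_def)
  \<comment> \<open>As \<open>s\<close> decreases, the indices with \<open>s n > 0\<close> are all
    indices or exactly those below some \<open>k\<close>; in the second case \<open>f0\<close> is
    extended from that initial segment.\<close>
  obtain f where f: "orthonormal f" "\<And>n. s n > 0 \<Longrightarrow> f n = f0 n"
  proof (cases "\<forall>n. s n > 0")
    case True
    then show ?thesis using that[of f0] f0 by (simp add: orthonormal_def)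
  next
    case False
    define k where "k = (LEAST n. \<not> s n > 0)"
    have k: "\<not> s k > 0" using False LeastI_ex[of "\<lambda>n. \<not> s n > 0"] by (auto simp: k_def)
    have k1: "s i > 0" if "i < k" for i using not_less_Least[of i "\<lambda>n. \<not> s n > 0"] that by (auto simp: k_def)
    have k2: "i < k" if "s i > 0" for i
      using antimonoD[OF anti, of k i] k that by (meson le_less_linear less_le_trans)
    obtain g where "orthonormal g" "\<And>i. i < k \<Longrightarrow> g i = f0 i"
      using orthonormal_extend[OF dim, of k f0] f0 k1 by blast
    then show ?thesis using that[of g] k2 by blast
  qed
  have sf: "of_real (s n) *\<^sub>C f n = X (e n)" for n
  proof (cases "s n > 0")
    case True
    then show ?thesis by (simp add: f f0_def scaleC_scaleC scaleC_one flip: of_real_mult)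
  next
    case False
    then show ?thesis using s0[of n] by (simp add: s_def)
  qed
  interpret diag_op s e f by unfold_locales (rule e f(1) c0_star_bounded[OF s])+
  have "diag s e f x = X x" for x
  proof (rule diag_unique)
    have part: "(\<Sum>k<n. (of_real (s k) * cinner x (e k)) *\<^sub>C f k) = X (proj (e ` {..<n}) x)" for n
    proof -
      have "(of_real (s k) * cinner x (e k)) *\<^sub>C f k = cinner x (e k) *\<^sub>C X (e k)" for k
        by (simp add: scaleC_scaleC mult.commute flip: sf)
      then show ?thesis
        by (simp add: proj_def blinfun.sum_right BH_scaleC[OF X(1)] sum.reindex
            inj_on_subset[OF orthonormal_inj[OF e] subset_UNIV])
    qed
    \<comment> \<open>The remainder of \<open>x\<close> is orthogonal to the first \<open>n\<close>
      vectors, where \<open>e n\<close> is maximizing and \<open>s n\<close> bounds the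
      operator.\<close>
    have bd: "norm (X x - X (proj (e ` {..<n}) x)) \<le> s n * norm x" for n
    proof -
      note E = orthonormal_image[OF e, of "{..<n}"] finite_imageI[OF finite_lessThan]
      have "norm (X (x - proj (e ` {..<n}) x)) \<le> s n * norm (x - proj (e ` {..<n}) x)"
        unfolding s_def by (intro max perp_diff_proj E)
      also have "\<dots> \<le> s n * norm x" by (intro mult_left_mono norm_diff_proj_le E s0)
      finally show ?thesis by (simp add: blinfun.diff_right)
    qed
    have "(\<lambda>n. s n * norm x) \<longlonglongrightarrow> 0 * norm x"
      using s by (intro tendsto_mult tendsto_const) (simp add: c0_star_def)
    then have "(\<lambda>n. X x - X (proj (e ` {..<n}) x)) \<longlonglongrightarrow> 0"
      by (intro Lim_null_comparison[OF always_eventually[OF allI[OF bd]]]) simp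
    then have "(\<lambda>n. X x - (X x - X (proj (e ` {..<n}) x))) \<longlonglongrightarrow> X x - 0"
      by (intro tendsto_diff tendsto_const)
    then show "(\<lambda>n. (of_real (s n) * cinner x (e n)) *\<^sub>C f n) sums X x"
      by (simp add: sums_def part)
  qed
  then have "X = diag s e f" by (metis blinfun_eqI)
  then show ?thesis using that s e f(1) by blast
qed

lemma compact_op_diag:
  assumes e: "orthonormal e" and f: "orthonormal f" and s: "s \<longlonglongrightarrow> 0"
  shows "compact_op (diag s e f)"
  unfolding compact_op_def
proof (intro allI impI)
  interpret diag_op s e f
    by unfold_locales (use e f convergent_imp_bounded[OF s] in auto)
  fix r :: real assume r: "r > 0"
  then obtain N where N: "\<And>n. n \<ge> N \<Longrightarrow> \<bar>s n\<bar> < r" using LIMSEQ_D[OF s] by auto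
  have "norm (diag s e f x) \<le> r * norm x" if "perp x (e ` {..<N})" for x
  proof (rule norm_diag_le)
    fix n assume "cinner x (e n) \<noteq> 0"
    then show "\<bar>s n\<bar> \<le> r" using that N[of n] by (metis imageI lessThan_iff not_less less_imp_le)
  qed (use r in auto)
  then show "\<exists>F. finite F \<and> (\<forall>x. perp x F \<longrightarrow> norm (diag s e f x) \<le> r * norm x)"
    by (intro exI[of _ "e ` {..<N}"]) auto
qed

text \<open>The two bounds identify \<open>s\<^sub>n\<close> as the \<open>n\<close>-th Gelfand number of \<open>diag s e f\<close>.\<close>

lemma norm_diag_perp_le:
  assumes e: "orthonormal e" and f: "orthonormal f" and s: "s \<in> c0_star" and x: "perp x (e ` {..<n})"
  shows "norm (diag s e f x) \<le> s n * norm x"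
proof -
  interpret diag_op s e f by unfold_locales (rule e f c0_star_bounded[OF s])+
  show ?thesis
  proof (rule norm_diag_le)
    show "0 \<le> s n" using s by (simp add: c0_star_def)
    fix k assume "cinner x (e k) \<noteq> 0"
    then have "n \<le> k" using x by (metis imageI lessThan_iff not_less)
    then show "\<bar>s k\<bar> \<le> s n" using s by (auto simp: c0_star_def antimono_def)
  qed
qed

lemma diag_gelfand_le:
  assumes e: "orthonormal e" and f: "orthonormal f" and s: "s \<in> c0_star"
    and F: "finite F" "card F \<le> n" "\<And>x. perp x F \<Longrightarrow> norm (diag s e f x) \<le> r * norm x"
  shows "s n \<le> r"
proof -
  interpret diag_op s e f by unfold_locales (rule e f c0_star_bounded[OF s])+
  have s': "0 \<le> s k" "k \<le> n \<Longrightarrow> s n \<le> s k" for k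
    using s by (auto simp: c0_star_def antimono_def)
  \<comment> \<open>Dimension count: the \<open>n + 1\<close> vectors \<open>e 0\<close>, ...,
    \<open>e n\<close> against at most \<open>n\<close> orthogonality conditions.\<close>
  obtain x where x: "x \<in> complex_vector.span (e ` {..n})" "x \<noteq> 0" "perp x F"
    using exists_perp_in_span[OF e F(1,2)] .
  let ?c = "\<lambda>k. cinner x (e k)"
  have "proj (e ` {..n}) x = x"
    by (rule proj_of_span[OF orthonormal_image[OF e] _ x(1)]) simp
  then have xs: "x = (\<Sum>k\<le>n. ?c k *\<^sub>C e k)"
    by (simp add: proj_def sum.reindex inj_on_subset[OF orthonormal_inj[OF e] subset_UNIV])
  have "diag s e f x = (\<Sum>k\<le>n. (?c k * of_real (s k)) *\<^sub>C f k)"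
    by (subst xs) (simp add: blinfun.sum_right BH_scaleC[OF diag_in_BH] diag_basis scaleC_scaleC)
  then have "(norm (diag s e f x))\<^sup>2 = (\<Sum>k\<le>n. (cmod (?c k * of_real (s k)))\<^sup>2)"
    by (simp add: norm_orthonormal_sum_seq[OF f])
  also have "\<dots> \<ge> (\<Sum>k\<le>n. (s n)\<^sup>2 * (cmod (?c k))\<^sup>2)"
    using s' by (intro sum_mono)
      (auto simp: norm_mult power_mult_distrib mult.commute intro!: mult_right_mono power_mono)
  also have "(\<Sum>k\<le>n. (s n)\<^sup>2 * (cmod (?c k))\<^sup>2) = (s n * norm x)\<^sup>2"
    using norm_orthonormal_sum_seq[OF e, of "{..n}" ?c] xs
    by (simp add: power_mult_distrib flip: sum_distrib_left)
  finally have "s n * norm x \<le> norm (diag s e f x)"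
    by (rule power2_le_imp_le) simp
  also have "\<dots> \<le> r * norm x" by (rule F(3)[OF x(3)])
  finally show ?thesis using x(2) by simp
qed


subsection \<open>Singular numbers of diagonal operators\<close>

lemma op_adjoint_diag:
  assumes "diag_op s e f"
  shows "op_adjoint (diag s e f) = diag s f e"
  unfolding op_adjoint_def
proof (rule the_equality)
  interpret diag_op s e f by fact
  interpret adj: diag_op s f e by unfold_locales (rule orth_f orth_e bdd_s)+
  show "diag s f e \<in> BH \<and> (\<forall>x y. cinner (diag s e f x) y = cinner x (diag s f e y))"
    using adj.diag_in_BH diag_adjoint by blast
  fix Y :: "'a \<Rightarrow>\<^sub>L 'a"
  assume "Y \<in> BH \<and> (\<forall>x y. cinner (diag s e f x) y = cinner x (Y y))"
  then have "Y y = diag s f e y" for y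
    by (intro cinner_ext) (simp flip: diag_adjoint)
  then show "Y = diag s f e" by (rule blinfun_eqI)
qed

text \<open>Polarization: reality of the quadratic form at \<open>x + y\<close> relates the
  imaginary parts, at \<open>x + \<i> *\<^sub>C y\<close> the real parts.\<close>

lemma positive_op_hermitian:
  assumes "positive_op P"
  shows "cinner (P x) y = cinner x (P y)"
proof -
  have P: "P \<in> BH" and im: "\<And>x. Im (cinner (P x) x) = 0"
    using assms by (auto simp: positive_op_def)
  have "Im (cinner (P x) y) = - Im (cinner (P y) x)"
    using im[of "x + y"] im[of x] im[of y]
    by (simp add: blinfun.add_right cinner_add_left cinner_add_right)
  moreover have "Re (cinner (P x) y) = Re (cinner (P y) x)"
    using im[of "x + \<i> *\<^sub>C y"] im[of x] im[of y]
    by (simp add: blinfun.add_right cinner_add_left cinner_add_right BH_scaleC[OF P]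
        cinner_scaleC_left cinner_scaleC_right)
  ultimately have "cinner (P x) y = cnj (cinner (P y) x)"
    by (simp add: complex_eq_iff)
  then show ?thesis using cinner_commute[of x "P y"] by simp
qed

lemma positive_op_diag:
  assumes "diag_op s e e" and nonneg: "\<And>n. 0 \<le> s n"
  shows "positive_op (diag s e e)"
proof -
  interpret diag_op s e e by fact
  obtain M where M: "\<And>n. \<bar>s n\<bar> \<le> M" using bdd_s by (auto simp: bounded_iff)
  then have "\<bar>sqrt (s n)\<bar> \<le> sqrt M" for n using nonneg[of n] M[of n] by simp
  then have "bounded (range (\<lambda>n. sqrt (s n)))" by (auto simp: bounded_iff)
  then interpret r: diag_op "\<lambda>n. sqrt (s n)" e e using orth_e by unfold_locales
  let ?R = "diag (\<lambda>n. sqrt (s n)) e e"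
  have "?R o\<^sub>L ?R = diag s e e"
    using diag_compose[OF r.diag_op_axioms r.diag_op_axioms] nonneg by simp
  then have "diag s e e x = ?R (?R x)" for x by (metis blinfun_apply_blinfun_compose)
  then have "cinner (diag s e e x) x = of_real ((norm (?R x))\<^sup>2)" for x
    using r.diag_adjoint[of "?R x" x] by (simp add: cinner_self)
  then show ?thesis by (simp add: positive_op_def diag_in_BH)
qed

text \<open>The point is uniqueness of the positive square root. A competitor \<open>P\<close> is
  not known to commute with \<open>diag s e e\<close>, so the two are compared first on the
  \<open>e n\<close> and then on arbitrary vectors, including those outside the closed span of the
  \<open>e n\<close>.\<close>

lemma op_abs_diag:
  assumes "diag_op s e f" and nonneg: "\<And>n. 0 \<le> s n"
  shows "op_abs (diag s e f) = diag s e e"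
  unfolding op_abs_def
proof (rule the_equality)
  interpret diag_op s e f by fact
  interpret adj: diag_op s f e by unfold_locales (rule orth_f orth_e bdd_s)+
  interpret d: diag_op s e e by unfold_locales (rule orth_e bdd_s)+
  let ?D = "diag s e e"
  have DD: "op_adjoint (diag s e f) o\<^sub>L diag s e f = ?D o\<^sub>L ?D"
    by (simp add: op_adjoint_diag diag_compose diag_op_axioms d.diag_op_axioms adj.diag_op_axioms)
  show "positive_op ?D \<and> ?D o\<^sub>L ?D = op_adjoint (diag s e f) o\<^sub>L diag s e f"
    using positive_op_diag[OF d.diag_op_axioms nonneg] DD by simp
  fix P :: "'a \<Rightarrow>\<^sub>L 'a"
  assume P: "positive_op P \<and> P o\<^sub>L P = op_adjoint (diag s e f) o\<^sub>L diag s e f"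
  then have PP: "P (P x) = ?D (?D x)" for x
    unfolding DD by (metis blinfun_apply_blinfun_compose)
  have P_BH: "P \<in> BH" and P_pos: "\<And>x. Re (cinner (P x) x) \<ge> 0"
    using P by (auto simp: positive_op_def)
  note herm = positive_op_hermitian[OF conjunct1[OF P]]
  have Pe: "P (e n) = of_real (s n) *\<^sub>C e n" for n
  proof -
    \<comment> \<open>Because \<open>P\<close> applied twice multiplies \<open>e n\<close> by the
      square of \<open>s n\<close>, \<open>P w\<close> is \<open>- s n\<close> times
      \<open>w\<close>. For \<open>s n > 0\<close> positivity forces \<open>w = 0\<close>; for
      \<open>s n = 0\<close> one has \<open>P w = 0\<close>, and symmetry of \<open>P\<close> gives
      the same.\<close>
    define w where "w = P (e n) - of_real (s n) *\<^sub>C e n"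
    have Pw: "P w = - (of_real (s n) *\<^sub>C w)"
      by (simp add: w_def blinfun.diff_right PP BH_scaleC[OF P_BH] BH_scaleC[OF d.diag_in_BH]
          d.diag_basis scaleC.diff_right scaleC_scaleC)
    have "s n * (norm w)\<^sup>2 = - Re (cinner (P w) w)"
      by (simp add: Pw cinner.minus_left cinner_scaleC_left cinner_self)
    then have "s n * (norm w)\<^sup>2 \<le> 0" using P_pos[of w] by simp
    then have "s n = 0 \<or> w = 0" using nonneg[of n] by (auto simp: mult_le_0_iff)
    moreover have "w = 0" if "s n = 0"
    proof -
      have "cinner w w = cinner (e n) (P w)" using herm that by (simp add: w_def)
      then show ?thesis using Pw that by (simp add: cinner.zero_right cinner_self)
    qed
    ultimately show ?thesis by (auto simp: w_def)
  qed
  have "P x = ?D x" for x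
  proof -
    \<comment> \<open>\<open>w\<close> is orthogonal to every \<open>e n\<close>, so
      \<open>?D w = 0\<close>, and \<open>P w = 0\<close> because both operators have the same
      square. By symmetry \<open>w\<close> is then orthogonal to \<open>P x\<close> and
      \<open>?D x\<close>, hence to itself.\<close>
    define w where "w = P x - ?D x"
    have perp: "cinner w (e n) = 0" for n
      by (simp add: w_def cinner.diff_left herm Pe cinner_scaleC_right d.cinner_diag)
    have "?D w = 0"
      by (rule d.diag_unique) (simp add: perp)
    then have "cinner (P w) (P w) = 0"
      by (simp only: herm PP \<open>?D w = 0\<close> blinfun.zero_right cinner.zero_right)
    then have "P w = 0" by (simp add: cinner_self)
    then have "cinner (P x) w = 0" "cinner (?D x) w = 0"
      by (simp_all add: herm d.diag_adjoint \<open>?D w = 0\<close> cinner.zero_right)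
    then have "cinner w w = 0" by (subst (1) w_def) (simp add: cinner.diff_left)
    then show ?thesis by (simp add: w_def cinner_self)
  qed
  then show "P = ?D" by (rule blinfun_eqI)
qed

section \<open>Eigenvalue multiplicities and decreasing lists\<close>

lemma finite_level_set:
  fixes \<rho> :: "nat \<Rightarrow> real"
  assumes "\<rho> \<longlonglongrightarrow> 0" "v > 0"
  shows "finite {n. \<rho> n = v}"
proof -
  obtain N where "\<And>n. n \<ge> N \<Longrightarrow> \<rho> n < v"
    using order_tendstoD(2)[OF assms] by (auto simp: eventually_sequentially)
  then have "{n. \<rho> n = v} \<subseteq> {..<N}" by (force simp: not_less[symmetric])
  then show ?thesis using finite_subset by blast
qed

text \<open>For \<open>v > 0\<close> an eigenvector is recovered from its image, so it has no
  component outside the \<open>e n\<close> with \<open>s n = v\<close>. For \<open>v = 0\<close> the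
  complement of the whole sequence could contribute.\<close>

lemma dim_eigenspace_diag:
  assumes e: "orthonormal e" and s: "s \<longlonglongrightarrow> 0" and v: "v > 0"
  shows "complex_vector.dim {x. diag s e e x = of_real v *\<^sub>C x} = card {n. s n = v}"
proof -
  interpret diag_op s e e by unfold_locales (use e convergent_imp_bounded[OF s] in auto)
  let ?N = "{n. s n = v}" and ?E = "{x. diag s e e x = of_real v *\<^sub>C x}"
  note fin = finite_level_set[OF s v]
  have "?E = complex_vector.span (e ` ?N)"
  proof (rule subset_antisym)
    show "?E \<subseteq> complex_vector.span (e ` ?N)"
    proof
      fix x assume "x \<in> ?E"
      then have x: "diag s e e x = of_real v *\<^sub>C x" by simp
      have "cinner x (e n) = 0" if "n \<notin> ?N" for n
        using cinner_diag[of x n] that unfolding x by (simp add: cinner_scaleC_left)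
      then have "(\<lambda>n. (of_real (s n) * cinner x (e n)) *\<^sub>C e n) sums
          (\<Sum>n\<in>?N. (of_real (s n) * cinner x (e n)) *\<^sub>C e n)"
        by (intro sums_finite fin) simp
      then have "of_real v *\<^sub>C x = (\<Sum>n\<in>?N. (of_real (s n) * cinner x (e n)) *\<^sub>C e n)"
        using diag_unique x by metis
      also have "\<dots> \<in> complex_vector.span (e ` ?N)"
        by (intro complex_vector.span_sum complex_vector.span_scale complex_vector.span_base) auto
      finally have "of_real (inverse v) *\<^sub>C (of_real v *\<^sub>C x) \<in> complex_vector.span (e ` ?N)"
        by (rule complex_vector.span_scale)
      then show "x \<in> complex_vector.span (e ` ?N)"
        using v by (simp add: scaleC_scaleC scaleC_one)
    qed
    have "complex_vector.subspace ?E"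
      by (simp add: complex_vector.subspace_def blinfun.add_right BH_scaleC[OF diag_in_BH]
          scaleC_add_right scaleC_scaleC mult.commute)
    then show "complex_vector.span (e ` ?N) \<subseteq> ?E"
      by (intro complex_vector.span_minimal) (auto simp: diag_basis)
  qed
  then show ?thesis
    using complex_vector.dim_span_eq_card_independent[OF
        orthonormal_set_independent[OF orthonormal_image[OF e]], of ?N]
      card_image[OF inj_on_subset[OF orthonormal_inj[OF e] subset_UNIV]] by simp
qed

text \<open>At the first index where the sequences differ, the larger value occurs in the smaller
  sequence only before that index, where both agree; the other sequence takes it at least once more.
  This is the uniqueness behind \<open>decreasing_list\<close>.\<close>

lemma c0_star_eqI:
  assumes \<xi>: "\<xi> \<in> c0_star" and \<zeta>: "\<zeta> \<in> c0_star"
    and card: "\<And>v. v > 0 \<Longrightarrow> card {n. \<xi> n = v} = card {n. \<zeta> n = v}"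
  shows "\<xi> = \<zeta>"
proof -
  have main: False
    if \<xi>: "\<xi> \<in> c0_star" and \<zeta>: "\<zeta> \<in> c0_star"
      and card: "\<And>v. v > 0 \<Longrightarrow> card {n. \<xi> n = v} = card {n. \<zeta> n = v}"
      and less: "\<xi> n < \<zeta> n" and eq: "\<And>k. k < n \<Longrightarrow> \<xi> k = \<zeta> k" for \<xi> \<zeta> n
  proof -
    let ?v = "\<zeta> n"
    have v: "?v > 0" using less \<xi> by (auto simp: c0_star_def intro: le_less_trans)
    have "\<zeta> k = ?v" if "\<xi> k = ?v" for k
    proof -
      have "k < n" using that less antimonoD[of \<xi> n k] \<xi> by (force simp: c0_star_def)
      then show ?thesis using eq that by simp
    qed
    then have "{k. \<xi> k = ?v} \<subseteq> {k. \<zeta> k = ?v}" by blast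
    moreover have "n \<in> {k. \<zeta> k = ?v}" "n \<notin> {k. \<xi> k = ?v}" using less by auto
    ultimately have less: "{k. \<xi> k = ?v} \<subset> {k. \<zeta> k = ?v}" by blast
    have "finite {k. \<zeta> k = ?v}"
      using \<zeta> by (intro finite_level_set v) (simp add: c0_star_def)
    from psubset_card_mono[OF this less] show False using card[OF v] by simp
  qed
  have "\<xi> n = \<zeta> n" for n
  proof (induction n rule: less_induct)
    case IH: (less n)
    show ?case
    proof (cases "\<xi> n" "\<zeta> n" rule: linorder_cases)
      case less
      from main[OF \<xi> \<zeta> card this IH] show ?thesis by simp
    next
      case greater
      from main[OF \<zeta> \<xi> card[symmetric] this IH[symmetric]] show ?thesis by simp
    qed
  qed
  then show ?thesis by blast
qed

lemma decreasing_list_eq: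
  assumes "\<xi> \<in> c0_star" "\<And>v. v > 0 \<Longrightarrow> card {n. \<xi> n = v} = m v"
  shows "decreasing_list m = \<xi>"
  unfolding decreasing_list_def
  by (rule the_equality) (use assms in \<open>auto intro!: c0_star_eqI\<close>)

lemma singular_numbers_diag_eq:
  assumes e: "orthonormal e" and f: "orthonormal f"
    and \<rho>: "\<rho> \<longlonglongrightarrow> 0" "\<And>n. 0 \<le> \<rho> n"
    and \<xi>: "\<xi> \<in> c0_star" "\<And>v. v > 0 \<Longrightarrow> card {n. \<xi> n = v} = card {n. \<rho> n = v}"
  shows "singular_numbers (diag \<rho> e f) = \<xi>"
proof -
  interpret diag_op \<rho> e f
    by unfold_locales (use e f convergent_imp_bounded[OF \<rho>(1)] in auto)
  show ?thesis
    unfolding singular_numbers_def op_abs_diag[OF diag_op_axioms \<rho>(2)]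
    by (rule decreasing_list_eq) (use \<xi> dim_eigenspace_diag[OF e \<rho>(1)] in auto)
qed

lemma singular_numbers_diag:
  "orthonormal e \<Longrightarrow> orthonormal f \<Longrightarrow> \<xi> \<in> c0_star \<Longrightarrow> singular_numbers (diag \<xi> e f) = \<xi>"
  by (rule singular_numbers_diag_eq) (auto simp: c0_star_def)

text \<open>
  The decreasing rearrangement exists because the operator with diagonal \<open>\<rho>\<close> has a Schmidt
  decomposition.
\<close>

lemma singular_numbers_diag_rearrangement:
  fixes e :: "nat \<Rightarrow> 'a::complex_hilbert_space"
  assumes dim: "infinite_dimensional TYPE('a)"
    and e: "orthonormal e"
    and \<rho>: "\<rho> \<longlonglongrightarrow> 0" "\<And>n. 0 \<le> \<rho> n"
  shows "singular_numbers (diag \<rho> e e) = monotone_rearrangement \<rho>"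
proof -
  interpret diag_op \<rho> e e
    by unfold_locales (use e convergent_imp_bounded[OF \<rho>(1)] in auto)
  obtain s e' f' where s: "s \<in> c0_star" "orthonormal e'" "orthonormal f'" "diag \<rho> e e = diag s e' f'"
    using schmidt_decomposition[OF dim diag_in_BH compact_op_diag[OF e e \<rho>(1)]] .
  interpret s: diag_op s e' f' by unfold_locales (rule s c0_star_bounded)+
  have "card {n. s n = v} = card {n. \<rho> n = v}" if v: "v > 0" for v
  proof -
    \<comment> \<open>A nonnegative diagonal operator is its own absolute value, so the Schmidt
      decomposition gives a second diagonalization of it, and its eigenspaces can be counted in
      both.\<close>
    have "diag \<rho> e e = op_abs (diag \<rho> e e)"
      by (rule op_abs_diag[OF diag_op_axioms \<rho>(2), symmetric])
    also have "\<dots> = diag s e' e'"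
      unfolding s(4) by (rule op_abs_diag[OF s.diag_op_axioms]) (use s(1) in \<open>simp add: c0_star_def\<close>)
    finally have "diag \<rho> e e = diag s e' e'" .
    then show ?thesis
      using dim_eigenspace_diag[OF e \<rho>(1) v] dim_eigenspace_diag[OF s(2) _ v, of s] s(1)
      by (simp add: c0_star_def)
  qed
  then show ?thesis
    using singular_numbers_diag_eq[OF e e \<rho> s(1)] decreasing_list_eq[OF s(1)]
    by (simp add: monotone_rearrangement_def)
qed

subsection \<open>Orthonormal bases\<close>

definition orthonormal_basis :: "(nat \<Rightarrow> 'a::complex_hilbert_space) \<Rightarrow> bool" where
  "orthonormal_basis h \<longleftrightarrow> orthonormal h \<and> (\<forall>x. (\<forall>n. cinner x (h n) = 0) \<longrightarrow> x = 0)"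

lemma exists_orthonormal_basis:
  assumes sep: "separable_space (euclidean :: 'a::complex_hilbert_space topology)"
    and dim: "infinite_dimensional TYPE('a)"
  obtains h :: "nat \<Rightarrow> 'a::complex_hilbert_space" where "orthonormal_basis h"
proof -
  obtain C :: "'a set" where C: "countable C" "closure C = UNIV"
    using sep unfolding separable_space_def by auto
  have "C \<noteq> {}" using C(2) by auto
  define d where "d = from_nat_into C"
  have d: "range d = C" unfolding d_def by (rule range_from_nat_into[OF \<open>C \<noteq> {}\<close> C(1)])
  \<comment> \<open>\<open>v\<close> absorbs the first \<open>d k\<close> outside the span of
    \<open>F\<close>. Taking the first one guarantees that \<open>n\<close> steps cover all
    \<open>d j\<close> with \<open>j < n\<close>.\<close>
  define P where "P F v \<longleftrightarrow> (\<exists>k. d k \<notin> complex_vector.span F \<and>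
      d k \<in> complex_vector.span (insert v F) \<and> (\<forall>j<k. d j \<in> complex_vector.span F))" for F v
  have step: "\<exists>v. norm v = 1 \<and> perp v F \<and> P F v"
    if F: "finite F" "orthonormal_set F" for F
  proof -
    \<comment> \<open>Otherwise the span of \<open>F\<close>, which is closed as the fixed-point set
      of \<open>proj F\<close>, would contain a dense set.\<close>
    have "\<exists>k. d k \<notin> complex_vector.span F"
    proof (rule ccontr)
      assume "\<not> (\<exists>k. d k \<notin> complex_vector.span F)"
      then have "\<And>y. y \<in> C \<Longrightarrow> proj F y = y" using d proj_of_span[OF F(2,1)] by auto
      moreover have "closed {y. proj F y = y}"
        unfolding proj_def
        by (intro closed_Collect_eq continuous_on_id linear_continuous_on bounded_linear_sum
            bounded_linear_compose[OF scaleC.bounded_linear_left cinner.bounded_linear_left])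
      ultimately have "closure C \<subseteq> {y. proj F y = y}" by (intro closure_minimal) auto
      then have "proj F y = y" for y using C(2) by auto
      then have "complex_vector.span F = UNIV" using proj_in_span[of F] by (metis UNIV_eq_I)
      then show False using dim F(1) by (auto simp: infinite_dimensional_def)
    qed
    then obtain k where k: "d k \<notin> complex_vector.span F" "\<forall>j<k. d j \<in> complex_vector.span F"
      using exists_least_iff[of "\<lambda>k. d k \<notin> complex_vector.span F"] by blast
    from orthonormal_set_insert_residual[OF F(2,1) k(1)] obtain v where
      "norm v = 1" "perp v F" "d k \<in> complex_vector.span (insert v F)" .
    then show ?thesis unfolding P_def using k by blast
  qed
  obtain h where h: "orthonormal h" "\<And>n. P (h ` {..<n}) (h n)"
    using orthonormal_greedy[of P, OF step] by blast
  have dh: "\<forall>j<n. d j \<in> complex_vector.span (h ` {..<n})" for n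
  proof (induction n)
    case (Suc n)
    have eq: "h ` {..<Suc n} = insert (h n) (h ` {..<n})" by (simp add: lessThan_Suc)
    have mono: "complex_vector.span (h ` {..<n}) \<subseteq> complex_vector.span (h ` {..<Suc n})"
      by (intro complex_vector.span_mono) (auto simp: eq)
    obtain k where k: "d k \<notin> complex_vector.span (h ` {..<n})"
      "d k \<in> complex_vector.span (insert (h n) (h ` {..<n}))"
      "\<forall>j<k. d j \<in> complex_vector.span (h ` {..<n})" using h(2)[of n] unfolding P_def by blast
    have "n \<le> k" using k(1) Suc by (meson not_less)
    have "d n \<in> complex_vector.span (h ` {..<Suc n})"
    proof (cases "n = k")
      case True
      with k(2) show ?thesis unfolding eq by simp
    next
      case False
      then show ?thesis using k(3) \<open>n \<le> k\<close> mono by (meson le_neq_implies_less subsetD)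
    qed
    then show ?case using Suc mono by (auto simp: less_Suc_eq)
  qed simp
  have "x = 0" if x: "\<And>n. cinner x (h n) = 0" for x
  proof -
    have "cinner x (d j) = 0" for j
    proof (rule perp_span)
      show "perp x (h ` {..<Suc j})" using x by auto
      show "d j \<in> complex_vector.span (h ` {..<Suc j})" using dh[of "Suc j"] by blast
    qed
    then have "C \<subseteq> {y. cinner x y = 0}" using d by auto
    moreover have "closed {y. cinner x y = 0}"
      by (intro closed_Collect_eq continuous_on_const linear_continuous_on
          cinner.bounded_linear_right)
    ultimately have "closure C \<subseteq> {y. cinner x y = 0}" by (rule closure_minimal)
    then have "cinner x x = 0" using C(2) by auto
    then show "x = 0" by (simp add: cinner_self)
  qed
  then show ?thesis using that[of h] h(1) by (simp add: orthonormal_basis_def)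
qed

lemma basis_expansion:
  assumes h: "orthonormal_basis h"
  shows "(\<lambda>n. cinner x (h n) *\<^sub>C h n) sums x"
proof -
  interpret diag_op "\<lambda>_. 1" h h
    by unfold_locales (use h in \<open>auto simp: orthonormal_basis_def\<close>)
  have "\<forall>n. cinner (x - diag (\<lambda>_. 1) h h x) (h n) = 0"
    by (simp add: cinner.diff_left cinner_diag)
  then have "x - diag (\<lambda>_. 1) h h x = 0" using h unfolding orthonormal_basis_def by blast
  then show ?thesis using diag_sums[of x] by simp
qed

lemma BH_eq_on_basis:
  assumes h: "orthonormal_basis h" and "A \<in> BH" "B \<in> BH" "\<And>n. A (h n) = B (h n)"
  shows "A = B"
proof (rule blinfun_eqI)
  fix x
  have "(\<lambda>n. cinner x (h n) *\<^sub>C T (h n)) sums T x" if "T \<in> BH" for T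
    using bounded_linear.sums[OF blinfun.bounded_linear_right basis_expansion[OF h], of T x]
    by (simp add: BH_scaleC[OF that])
  from this[of A] this[of B] show "A x = B x" using assms(2-) sums_unique2 by force
qed

text \<open>The vector \<open>B y\<close> is built from its coefficients on the basis. Testing
  \<open>A\<close> on a finite section \<open>?z\<close> bounds the norm of \<open>?z\<close> by
  \<open>norm y * norm A\<close>, whence square summability. \<open>B\<close> is a plain function:
  it serves to move orthogonality conditions across \<open>A\<close>.\<close>

lemma exists_adjoint:
  fixes A :: "'a::complex_hilbert_space \<Rightarrow>\<^sub>L 'a" and h :: "nat \<Rightarrow> 'a"
  assumes h: "orthonormal_basis h" and A: "A \<in> BH"
  obtains B where "\<And>x y. cinner (A x) y = cinner x (B y)"
proof -
  have h': "orthonormal h" using h by (simp add: orthonormal_basis_def)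
  have "\<exists>b. \<forall>x. cinner (A x) y = cinner x b" for y
  proof -
    let ?c = "\<lambda>n. cinner y (A (h n))"
    have "(\<Sum>n\<in>N. (cmod (?c n))\<^sup>2) \<le> (norm y * norm A)\<^sup>2" if "finite N" for N
    proof -
      let ?S = "\<Sum>n\<in>N. (cmod (?c n))\<^sup>2" let ?z = "\<Sum>n\<in>N. ?c n *\<^sub>C h n"
      have zS: "(norm ?z)\<^sup>2 = ?S" by (rule norm_orthonormal_sum_seq[OF h' that])
      have "cinner y (A ?z) = (\<Sum>n\<in>N. ?c n * cnj (?c n))"
        by (simp add: blinfun.sum_right BH_scaleC[OF A] cinner.sum_right cinner_scaleC_right
            mult.commute)
      also have "\<dots> = of_real ?S" by (simp only: complex_norm_square[symmetric] of_real_sum)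
      finally have "cinner y (A ?z) = of_real ?S" .
      then have "cmod (cinner y (A ?z)) = \<bar>?S\<bar>" by (simp only: norm_of_real)
      then have "?S = cmod (cinner y (A ?z))" by (simp add: sum_nonneg)
      also have "\<dots> \<le> norm y * (norm A * norm ?z)"
        by (intro order_trans[OF norm_cinner_le] mult_left_mono norm_blinfun norm_ge_zero)
      finally have "norm ?z * norm ?z \<le> (norm y * norm A) * norm ?z"
        unfolding zS[symmetric] by (simp add: power2_eq_square mult.assoc)
      then have "norm ?z \<le> norm y * norm A"
        by (cases "?z = 0") auto
      then show ?thesis unfolding zS[symmetric] by (intro power_mono) auto
    qed
    then have "summable (\<lambda>n. (cmod (?c n))\<^sup>2)"
      by (intro summableI_nonneg_bounded[where x = "(norm y * norm A)\<^sup>2"]) auto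
    then have b: "(\<lambda>n. ?c n *\<^sub>C h n) sums (\<Sum>n. ?c n *\<^sub>C h n)" (is "_ sums ?b")
      by (intro summable_sums orthonormal_summable h')
    have "cinner (A x) y = cinner x ?b" for x
    proof -
      have "bounded_linear (\<lambda>x. cinner (A x) y)"
        by (intro bounded_linear_compose[OF cinner.bounded_linear_left] blinfun.bounded_linear_right)
      from bounded_linear.sums[OF this basis_expansion[OF h, of x]]
      have "(\<lambda>n. cinner x (h n) * cinner (A (h n)) y) sums cinner (A x) y"
        by (simp add: BH_scaleC[OF A] cinner_scaleC_left)
      moreover have "(\<lambda>n. cinner x (?c n *\<^sub>C h n)) sums cinner x ?b"
        by (rule bounded_linear.sums[OF cinner.bounded_linear_right b])
      moreover have "cinner x (?c n *\<^sub>C h n) = cinner x (h n) * cinner (A (h n)) y" for n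
        by (simp add: cinner_scaleC_right cinner_commute[of "A (h n)" y])
      ultimately show ?thesis using sums_unique2 by force
    qed
    then show ?thesis by blast
  qed
  then obtain B where "\<And>x y. cinner (A x) y = cinner x (B y)" by metis
  then show ?thesis using that by blast
qed


subsection \<open>The Calkin correspondence\<close>

lemma compose_in_BH: "A \<in> BH \<Longrightarrow> B \<in> BH \<Longrightarrow> A o\<^sub>L B \<in> BH"
  by (simp add: BH_def)

lemma compact_op_add:
  assumes "compact_op X" "compact_op Y"
  shows "compact_op (X + Y)"
  unfolding compact_op_def
proof (intro allI impI)
  fix r :: real assume r: "r > 0"
  obtain F where F: "finite F" "\<And>x. perp x F \<Longrightarrow> norm (X x) \<le> (r/2) * norm x"
    using assms(1) r unfolding compact_op_def by (meson half_gt_zero)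
  obtain G where G: "finite G" "\<And>x. perp x G \<Longrightarrow> norm (Y x) \<le> (r/2) * norm x"
    using assms(2) r unfolding compact_op_def by (meson half_gt_zero)
  have "norm ((X + Y) x) \<le> r * norm x" if "perp x (F \<union> G)" for x
  proof -
    have "norm ((X + Y) x) \<le> norm (X x) + norm (Y x)"
      by (simp add: blinfun.add_left norm_triangle_ineq)
    also have "\<dots> \<le> (r/2) * norm x + (r/2) * norm x"
      using that by (intro add_mono F G) auto
    finally show ?thesis by (simp add: field_simps)
  qed
  then show "\<exists>F. finite F \<and> (\<forall>x. perp x F \<longrightarrow> norm ((X + Y) x) \<le> r * norm x)"
    using F(1) G(1) by (intro exI[of _ "F \<union> G"]) blast
qed

lemma norm_compose_left_le:
  fixes A X :: "'a::complex_hilbert_space \<Rightarrow>\<^sub>L 'a"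
  assumes "norm (X x) \<le> r * norm x"
  shows "norm ((A o\<^sub>L X) x) \<le> (norm A * r) * norm x"
proof -
  have "norm (A (X x)) \<le> norm A * norm (X x)" by (rule norm_blinfun)
  also have "\<dots> \<le> norm A * (r * norm x)" by (intro mult_left_mono assms norm_ge_zero)
  finally show ?thesis by (simp add: mult.assoc)
qed

lemma norm_compose_right_le:
  fixes A X :: "'a::complex_hilbert_space \<Rightarrow>\<^sub>L 'a"
  assumes "norm (X (A x)) \<le> r * norm (A x)" "0 \<le> r"
  shows "norm ((X o\<^sub>L A) x) \<le> (norm A * r) * norm x"
proof -
  have "norm (X (A x)) \<le> r * (norm A * norm x)"
    by (rule order_trans[OF assms(1)]) (intro mult_left_mono norm_blinfun assms(2))
  then show ?thesis by (simp add: mult_ac)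
qed

lemma scaled_bound_exists:
  fixes A :: "'a::complex_hilbert_space \<Rightarrow>\<^sub>L 'a"
  assumes "r > 0"
  obtains q where "q > 0" "norm A * q \<le> r"
proof
  show "r / (norm A + 1) > 0" using assms by (simp add: add_nonneg_pos)
  show "norm A * (r / (norm A + 1)) \<le> r"
    using assms by (simp add: divide_simps add_nonneg_pos)
qed

lemma compact_op_compose_left:
  fixes A X :: "'a::complex_hilbert_space \<Rightarrow>\<^sub>L 'a"
  assumes "compact_op X"
  shows "compact_op (A o\<^sub>L X)"
  unfolding compact_op_def
proof (intro allI impI)
  fix r :: real assume "r > 0"
  then obtain q where q: "q > 0" "norm A * q \<le> r" by (rule scaled_bound_exists)
  obtain F where F: "finite F" "\<And>x. perp x F \<Longrightarrow> norm (X x) \<le> q * norm x"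
    using assms q(1) unfolding compact_op_def by blast
  have "norm ((A o\<^sub>L X) x) \<le> r * norm x" if "perp x F" for x
    by (rule order_trans[OF norm_compose_left_le[OF F(2)[OF that]]])
      (intro mult_right_mono q norm_ge_zero)
  then show "\<exists>F. finite F \<and> (\<forall>x. perp x F \<longrightarrow> norm ((A o\<^sub>L X) x) \<le> r * norm x)"
    using F(1) by blast
qed

lemma compact_op_compose_right:
  fixes A X :: "'a::complex_hilbert_space \<Rightarrow>\<^sub>L 'a"
  assumes "compact_op X" and adj: "\<And>x y. cinner (A x) y = cinner x (B y)"
  shows "compact_op (X o\<^sub>L A)"
  unfolding compact_op_def
proof (intro allI impI)
  fix r :: real assume "r > 0"
  then obtain q where q: "q > 0" "norm A * q \<le> r" by (rule scaled_bound_exists)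
  obtain F where F: "finite F" "\<And>x. perp x F \<Longrightarrow> norm (X x) \<le> q * norm x"
    using assms q(1) unfolding compact_op_def by blast
  have "norm ((X o\<^sub>L A) x) \<le> r * norm x" if "perp x (B ` F)" for x
  proof (rule order_trans[OF norm_compose_right_le[OF F(2)]])
    show "perp (A x) F" using that by (simp add: adj)
    show "norm A * q * norm x \<le> r * norm x" by (intro mult_right_mono q norm_ge_zero)
  qed (use q in simp)
  then show "\<exists>F. finite F \<and> (\<forall>x. perp x F \<longrightarrow> norm ((X o\<^sub>L A) x) \<le> r * norm x)"
    using F(1) by blast
qed

lemma not_compact_op_id:
  assumes "infinite_dimensional TYPE('a::complex_hilbert_space)"
  shows "\<not> compact_op (id_blinfun :: 'a \<Rightarrow>\<^sub>L 'a)"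
proof
  assume "compact_op (id_blinfun :: 'a \<Rightarrow>\<^sub>L 'a)"
  then obtain F :: "'a set" where F: "finite F" "\<And>x. perp x F \<Longrightarrow> norm x \<le> (1/2) * norm x"
    unfolding compact_op_def by (metis half_gt_zero_iff id_blinfun.rep_eq id_apply zero_less_one)
  obtain v where "norm v = 1" "perp v F" using exists_unit_perp[OF assms F(1)] .
  with F(2)[of v] show False by simp
qed

lemma id_in_BH: "id_blinfun \<in> BH"
  by (simp add: BH_def)

lemma operator_idealD:
  assumes "operator_ideal I"
  shows "I \<subseteq> BH" "I \<noteq> BH" "\<And>X Y. X \<in> I \<Longrightarrow> Y \<in> I \<Longrightarrow> X + Y \<in> I"
    "\<And>X A. X \<in> I \<Longrightarrow> A \<in> BH \<Longrightarrow> A o\<^sub>L X \<in> I" "\<And>X A. X \<in> I \<Longrightarrow> A \<in> BH \<Longrightarrow> X o\<^sub>L A \<in> I"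
  using assms by (auto simp: operator_ideal_def)

text \<open>
  A noncompact operator is bounded below on an orthonormal sequence with orthogonal images, so the
  identity factors through it.
\<close>

lemma operator_ideal_compact:
  fixes h :: "nat \<Rightarrow> 'a::complex_hilbert_space" and X :: "'a \<Rightarrow>\<^sub>L 'a"
  assumes h: "orthonormal_basis h" and I: "operator_ideal I" and X: "X \<in> I"
  shows "compact_op X"
proof (rule ccontr)
  assume "\<not> compact_op X"
  then obtain r where r: "r > 0" "\<And>F. finite F \<Longrightarrow> \<exists>x. perp x F \<and> r * norm x < norm (X x)"
    unfolding compact_op_def by (meson not_le)
  have X_BH: "X \<in> BH" using operator_idealD(1)[OF I] X by blast
  have h': "orthonormal h" using h by (simp add: orthonormal_basis_def)
  obtain B where B: "\<And>x y. cinner (X x) y = cinner x (B y)"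
    using exists_adjoint[OF h X_BH] by blast
  define P where "P F v \<longleftrightarrow> r < norm (X v) \<and> perp (X v) (X ` F)" for F v
  have "\<exists>v. norm v = 1 \<and> perp v F \<and> P F v" if "finite F" for F
  proof -
    \<comment> \<open>The second part of the union makes \<open>X x\<close> orthogonal to the images
      under \<open>X\<close> of the earlier vectors.\<close>
    have "finite (F \<union> B ` X ` F)" using that by simp
    then obtain x where x: "perp x (F \<union> B ` X ` F)" "r * norm x < norm (X x)" using r(2) by blast
    then have "x \<noteq> 0" by auto
    let ?c = "complex_of_real (inverse (norm x))"
    have "norm (?c *\<^sub>C x) = 1" using \<open>x \<noteq> 0\<close> by (simp add: norm_scaleC norm_inverse)
    moreover have "r < norm (X (?c *\<^sub>C x))"
      using x(2) \<open>x \<noteq> 0\<close>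
      by (simp add: BH_scaleC[OF X_BH] norm_scaleC norm_inverse norm_divide field_simps)
    moreover have "perp (?c *\<^sub>C x) F" "perp (X (?c *\<^sub>C x)) (X ` F)"
      using x(1) by (auto simp: B cinner_scaleC_left)
    ultimately show ?thesis unfolding P_def by blast
  qed
  then obtain x where x: "orthonormal x" "\<And>n. P (x ` {..<n}) (x n)"
    using orthonormal_greedy[of P] by blast
  have norm_Xx: "r < norm (X (x n))" for n using x(2)[of n] by (simp add: P_def)
  have perp_less: "cinner (X (x n)) (X (x m)) = 0" if "m < n" for m n
    using x(2)[of n] that by (auto simp: P_def)
  have perp: "cinner (X (x n)) (X (x m)) = 0" if "m \<noteq> n" for m n
    using perp_less[of m n] cinner_eq_0_sym[OF perp_less[of n m]] that by linarith
  define t where "t n = inverse (norm (X (x n)))" for n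
  define g where "g n = of_real (t n) *\<^sub>C X (x n)" for n
  have t0: "t n > 0" for n
    unfolding t_def by (rule positive_imp_inverse_positive) (use norm_Xx[of n] r(1) in linarith)
  have t: "\<bar>t n\<bar> \<le> inverse r" for n
  proof -
    have "t n \<le> inverse r"
      unfolding t_def by (rule le_imp_inverse_le) (use norm_Xx[of n] r(1) in auto)
    then show ?thesis using t0[of n] by simp
  qed
  have "norm (g n) = 1" for n
    using t0[of n] by (auto simp: g_def t_def norm_scaleC norm_inverse)
  then have g: "orthonormal g"
    unfolding orthonormal_def
    using perp by (auto simp: cinner_self_eq_1) (auto simp: g_def cinner_scaleC_left cinner_scaleC_right)
  interpret A: diag_op "\<lambda>_. 1" h x by unfold_locales (use h' x(1) in auto)
  have "bounded (range t)" using t by (auto simp: bounded_iff)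
  then interpret C: diag_op t g h using g h' by unfold_locales
  let ?A = "diag (\<lambda>_. 1) h x" and ?C = "diag t g h"
  have "X (x n) = of_real (inverse (t n)) *\<^sub>C g n" for n
    using t0[of n] by (simp add: g_def scaleC_scaleC scaleC_one)
  then have "(?C o\<^sub>L X o\<^sub>L ?A) (h n) = h n" for n
    using t0[of n] by (simp add: A.diag_basis C.diag_basis scaleC_one scaleC_scaleC BH_scaleC[OF C.diag_in_BH])
  then have "?C o\<^sub>L X o\<^sub>L ?A = id_blinfun"
    by (intro BH_eq_on_basis[OF h] compose_in_BH X_BH id_in_BH A.diag_in_BH C.diag_in_BH) simp
  moreover have "?C o\<^sub>L X o\<^sub>L ?A \<in> I"
    by (intro operator_idealD(4,5)[OF I] X A.diag_in_BH C.diag_in_BH)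
  ultimately have id: "id_blinfun \<in> I" by simp
  have "Y \<in> I" if "Y \<in> BH" for Y
  proof -
    have "Y o\<^sub>L id_blinfun \<in> I" by (rule operator_idealD(4)[OF I id that])
    moreover have "Y o\<^sub>L id_blinfun = Y" by (rule blinfun_eqI) simp
    ultimately show ?thesis by simp
  qed
  then show False using operator_idealD(1,2)[OF I] by blast
qed

text \<open>The basis is a fixed frame: \<open>diag \<xi> h h\<close> is the standard operator with
  singular numbers \<xi>, and relations between sequences are translated into relations between
  these operators.\<close>

locale separable_hilbert =
  fixes h :: "nat \<Rightarrow> 'a::complex_hilbert_space"
  assumes dim: "infinite_dimensional TYPE('a)" and basis: "orthonormal_basis h"
begin

lemma orth: "orthonormal h"
  using basis by (simp add: orthonormal_basis_def)

text \<open>Two compact operators with equal singular numbers have Schmidt decompositions that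
  differ only in the orthonormal sequences, and partial isometries on both sides exchange
  these.\<close>

lemma ideal_memI:
  fixes X :: "'a \<Rightarrow>\<^sub>L 'a"
  assumes I: "operator_ideal I" and X: "X \<in> BH" "compact_op X"
    and mem: "singular_numbers X \<in> char_set I"
  shows "X \<in> I"
proof -
  obtain s e f where s: "s \<in> c0_star" "orthonormal e" "orthonormal f" "X = diag s e f"
    using schmidt_decomposition[OF dim X] .
  obtain Y where Y: "Y \<in> I" "singular_numbers Y = singular_numbers X"
    using mem by (auto simp: char_set_def)
  have "Y \<in> BH" "compact_op Y"
    using Y(1) operator_idealD(1)[OF I] operator_ideal_compact[OF basis I] by auto
  then obtain t e' f' where t: "t \<in> c0_star" "orthonormal e'" "orthonormal f'" "Y = diag t e' f'"
    using schmidt_decomposition[OF dim] by blast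
  have "t = s" using Y(2) s t singular_numbers_diag by metis
  interpret A: diag_op "\<lambda>_. 1" e e' by unfold_locales (use s t in auto)
  interpret B: diag_op "\<lambda>_. 1" f' f by unfold_locales (use s t in auto)
  interpret S: diag_op s e' f' by unfold_locales (use s t c0_star_bounded in auto)
  interpret T: diag_op s e f' by unfold_locales (use s t c0_star_bounded in auto)
  have "Y o\<^sub>L diag (\<lambda>_. 1) e e' = diag s e f'"
    using diag_compose[OF A.diag_op_axioms S.diag_op_axioms] by (simp add: t(4) \<open>t = s\<close>)
  moreover have "diag (\<lambda>_. 1) f' f o\<^sub>L diag s e f' = X"
    using diag_compose[OF T.diag_op_axioms B.diag_op_axioms] by (simp add: s(4))
  ultimately have "X = diag (\<lambda>_. 1) f' f o\<^sub>L (Y o\<^sub>L diag (\<lambda>_. 1) e e')" by simp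
  also have "\<dots> \<in> I"
    by (intro operator_idealD(4,5)[OF I] Y(1) A.diag_in_BH B.diag_in_BH)
  finally show ?thesis .
qed

lemma char_set_inject:
  fixes I J :: "('a \<Rightarrow>\<^sub>L 'a) set"
  assumes "operator_ideal I" "operator_ideal J" "char_set I = char_set J"
  shows "I = J"
proof -
  have "I \<subseteq> J" if "operator_ideal I" "operator_ideal J" "char_set I = char_set J"
    for I J :: "('a \<Rightarrow>\<^sub>L 'a) set"
  proof
    fix X assume X: "X \<in> I"
    show "X \<in> J"
    proof (rule ideal_memI[OF that(2) _ operator_ideal_compact[OF basis that(1) X]])
      show "X \<in> BH" using X operator_idealD(1)[OF that(1)] by blast
      show "singular_numbers X \<in> char_set J"
        unfolding that(3)[symmetric] using X by (simp add: char_set_def)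
    qed
  qed
  from this[OF assms] this[OF assms(2,1) assms(3)[symmetric]] show ?thesis
    by (rule subset_antisym)
qed

lemma ideal_of_char_set_eq:
  assumes "operator_ideal J"
  shows "ideal_of_char_set (char_set J) = (J :: ('a \<Rightarrow>\<^sub>L 'a) set)"
  unfolding ideal_of_char_set_def
  by (rule the_equality) (use assms char_set_inject in auto)

lemma diag_mem_iff:
  assumes I: "operator_ideal I" and \<xi>: "\<xi> \<in> c0_star"
  shows "diag \<xi> h h \<in> I \<longleftrightarrow> \<xi> \<in> char_set I"
proof -
  interpret diag_op \<xi> h h by unfold_locales (rule orth c0_star_bounded[OF \<xi>])+
  have s: "singular_numbers (diag \<xi> h h) = \<xi>"
    by (intro singular_numbers_diag orth \<xi>)
  show ?thesis
  proof
    assume "diag \<xi> h h \<in> I"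
    then show "\<xi> \<in> char_set I" using s by (force simp: char_set_def)
  next
    assume "\<xi> \<in> char_set I"
    moreover have "compact_op (diag \<xi> h h)"
      using \<xi> by (intro compact_op_diag orth) (simp add: c0_star_def)
    ultimately show "diag \<xi> h h \<in> I" using ideal_memI[OF I diag_in_BH] s by simp
  qed
qed

lemma char_set_subset_c0_star:
  assumes I: "operator_ideal I"
  shows "char_set (I :: ('a \<Rightarrow>\<^sub>L 'a) set) \<subseteq> c0_star"
proof
  fix \<xi> assume "\<xi> \<in> char_set I"
  then obtain X where X: "X \<in> I" "\<xi> = singular_numbers X" by (auto simp: char_set_def)
  have "X \<in> BH" "compact_op X"
    using X(1) operator_idealD(1)[OF I] operator_ideal_compact[OF basis I] by auto
  then obtain s e f where s: "s \<in> c0_star" "orthonormal e" "orthonormal f" "X = diag s e f"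
    using schmidt_decomposition[OF dim] by blast
  then show "\<xi> \<in> c0_star" using singular_numbers_diag X(2) by metis
qed

text \<open>The operator with the unsorted diagonal \<rho> lies in \<open>I\<close> by its singular
  numbers; multiplying it by the bounded diagonal of quotients gives \<open>diag \<xi> h h\<close>.
  Thus \<rho> never has to be compared with \<xi> in sorted form.\<close>

lemma char_set_of_le_rearrangement:
  assumes I: "operator_ideal (I :: ('a \<Rightarrow>\<^sub>L 'a) set)"
    and \<rho>: "\<rho> \<longlonglongrightarrow> 0" "\<And>n. 0 \<le> \<rho> n" "monotone_rearrangement \<rho> \<in> char_set I"
    and \<xi>: "\<xi> \<in> c0_star" "\<And>n. \<xi> n \<le> c * \<rho> n"
  shows "\<xi> \<in> char_set I"
proof -
  interpret R: diag_op \<rho> h h by unfold_locales (use orth convergent_imp_bounded[OF \<rho>(1)] in auto)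
  have R: "diag \<rho> h h \<in> I"
    using ideal_memI[OF I R.diag_in_BH compact_op_diag[OF orth orth \<rho>(1)]]
      singular_numbers_diag_rearrangement[OF dim orth \<rho>(1,2)] \<rho>(3) by simp
  \<comment> \<open>Division by zero yields 0, which is the right value because \<xi> vanishes
    wherever \<rho> does.\<close>
  define q where "q n = \<xi> n / \<rho> n" for n
  have \<xi>0: "0 \<le> \<xi> n" for n using \<xi>(1) by (simp add: c0_star_def)
  have z: "\<xi> n = 0" if "\<rho> n = 0" for n using \<xi>(2)[of n] \<xi>0[of n] that by simp
  have "\<bar>q n\<bar> \<le> \<bar>c\<bar>" for n
  proof (cases "\<rho> n = 0")
    case False
    then have "\<rho> n > 0" using \<rho>(2)[of n] by simp
    then show ?thesis using \<xi>(2)[of n] \<xi>0[of n] by (simp add: q_def divide_simps)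
      (smt (verit) mult_right_mono)
  qed (simp add: q_def)
  then have "bounded (range q)" by (auto simp: bounded_iff)
  then interpret Q: diag_op q h h using orth by unfold_locales
  have "(\<lambda>n. q n * \<rho> n) = \<xi>" using z by (auto simp: q_def)
  then have "diag \<xi> h h = diag q h h o\<^sub>L diag \<rho> h h"
    using diag_compose[OF R.diag_op_axioms Q.diag_op_axioms] by simp
  also have "\<dots> \<in> I" by (intro operator_idealD(4)[OF I] R Q.diag_in_BH)
  finally show ?thesis using diag_mem_iff[OF I \<xi>(1)] by simp
qed

lemma char_set_add:
  assumes I: "operator_ideal (I :: ('a \<Rightarrow>\<^sub>L 'a) set)" and "\<xi> \<in> char_set I" "\<zeta> \<in> char_set I"
  shows "(\<lambda>n. \<xi> n + \<zeta> n) \<in> char_set I"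
proof -
  have c: "\<xi> \<in> c0_star" "\<zeta> \<in> c0_star" using assms char_set_subset_c0_star by auto
  then have c': "(\<lambda>n. \<xi> n + \<zeta> n) \<in> c0_star"
    by (auto simp: c0_star_def antimono_def add_mono intro!: tendsto_add_zero)
  have "diag \<xi> h h + diag \<zeta> h h = diag (\<lambda>n. \<xi> n + \<zeta> n) h h"
    by (rule diag_add) (unfold_locales; use orth c c0_star_bounded in auto)+
  moreover have "diag \<xi> h h + diag \<zeta> h h \<in> I"
    using assms diag_mem_iff[OF I] c by (intro operator_idealD(3)[OF I]) auto
  ultimately show ?thesis using diag_mem_iff[OF I c'] by simp
qed

text \<open>Surjectivity of the Calkin correspondence. In \<open>add\<close> the index
  \<open>n div 2\<close> is the 2-fold ampliation: \<open>n div 2\<close> conditions for each of two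
  operators make at most \<open>n\<close> conditions for their sum.\<close>

theorem exists_ideal_of_char_set:
  assumes S: "S \<subseteq> c0_star" "(\<lambda>_. 0) \<in> S"
    and solid: "\<And>\<xi> \<zeta>. \<xi> \<in> c0_star \<Longrightarrow> \<zeta> \<in> S \<Longrightarrow> (\<And>n. \<xi> n \<le> \<zeta> n) \<Longrightarrow> \<xi> \<in> S"
    and scale: "\<And>\<xi> c. \<xi> \<in> S \<Longrightarrow> 0 \<le> c \<Longrightarrow> (\<lambda>n. c * \<xi> n) \<in> S"
    and add: "\<And>\<xi> \<zeta>. \<xi> \<in> S \<Longrightarrow> \<zeta> \<in> S \<Longrightarrow> (\<lambda>n. \<xi> (n div 2) + \<zeta> (n div 2)) \<in> S"
  obtains J :: "('a \<Rightarrow>\<^sub>L 'a) set" where "operator_ideal J" "char_set J = S"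
proof -
  define J :: "('a \<Rightarrow>\<^sub>L 'a) set" where "J = {X \<in> BH. compact_op X \<and> singular_numbers X \<in> S}"
  \<comment> \<open>Membership by Gelfand numbers: dominating them by a member of \<open>S\<close>
    suffices, so sums and products are treated without knowing their Schmidt decompositions.\<close>
  have memI: "X \<in> J"
    if X: "X \<in> BH" "compact_op X" and \<zeta>: "\<zeta> \<in> S"
      and F: "\<And>n. \<exists>F. finite F \<and> card F \<le> n \<and> (\<forall>x. perp x F \<longrightarrow> norm (X x) \<le> \<zeta> n * norm x)"
    for X :: "'a \<Rightarrow>\<^sub>L 'a" and \<zeta>
  proof -
    obtain s e f where s: "s \<in> c0_star" "orthonormal e" "orthonormal f" "X = diag s e f"
      using schmidt_decomposition[OF dim X] .
    have "s n \<le> \<zeta> n" for n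
    proof -
      obtain G where "finite G" "card G \<le> n" "\<And>x. perp x G \<Longrightarrow> norm (X x) \<le> \<zeta> n * norm x"
        using F[of n] by blast
      then show ?thesis by (intro diag_gelfand_le[OF s(2,3,1)]) (simp_all add: s(4))
    qed
    then have "s \<in> S" by (rule solid[OF s(1) \<zeta>])
    then show ?thesis using X s singular_numbers_diag[OF s(2,3,1)] by (simp add: J_def)
  qed
  have memD: "\<exists>F. finite F \<and> card F \<le> n \<and> (\<forall>x. perp x F \<longrightarrow> norm (X x) \<le> singular_numbers X n * norm x)"
    if X: "X \<in> BH" "compact_op X" for X :: "'a \<Rightarrow>\<^sub>L 'a" and n
  proof -
    obtain s e f where s: "s \<in> c0_star" "orthonormal e" "orthonormal f" "X = diag s e f"
      using schmidt_decomposition[OF dim X] .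
    have "card (e ` {..<n}) \<le> n" using card_image_le[of "{..<n}" e] by simp
    moreover have "norm (X x) \<le> singular_numbers X n * norm x" if "perp x (e ` {..<n})" for x
      using norm_diag_perp_le[OF s(2,3,1) that] singular_numbers_diag[OF s(2,3,1)] s(4) by simp
    ultimately show ?thesis by (intro exI[of _ "e ` {..<n}"]) blast
  qed
  have zero: "0 \<in> J"
    by (rule memI[OF _ _ S(2)]) (auto simp: BH_def compact_op_def intro!: exI[of _ "{}"])
  have plus: "X + Y \<in> J" if "X \<in> J" "Y \<in> J" for X Y
  proof -
    have X: "X \<in> BH" "compact_op X" "singular_numbers X \<in> S"
      and Y: "Y \<in> BH" "compact_op Y" "singular_numbers Y \<in> S" using that by (auto simp: J_def)
    show ?thesis
    proof (rule memI[OF _ compact_op_add[OF X(2) Y(2)] add[OF X(3) Y(3)]])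
      show "X + Y \<in> BH"
        using X(1) Y(1) by (simp add: BH_def blinfun.add_left scaleC_add_right)
      fix n
      obtain F where F: "finite F" "card F \<le> n div 2"
        "\<And>x. perp x F \<Longrightarrow> norm (X x) \<le> singular_numbers X (n div 2) * norm x"
        using memD[OF X(1,2)] by blast
      obtain G where G: "finite G" "card G \<le> n div 2"
        "\<And>x. perp x G \<Longrightarrow> norm (Y x) \<le> singular_numbers Y (n div 2) * norm x"
        using memD[OF Y(1,2)] by blast
      have "card (F \<union> G) \<le> n" using card_Un_le[of F G] F(2) G(2) by linarith
      moreover have "norm ((X + Y) x) \<le>
          (singular_numbers X (n div 2) + singular_numbers Y (n div 2)) * norm x"
        if "perp x (F \<union> G)" for x
        using norm_triangle_ineq[of "X x" "Y x"] F(3)[of x] G(3)[of x] that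
        by (simp add: blinfun.add_left distrib_right)
      ultimately show "\<exists>F. finite F \<and> card F \<le> n \<and> (\<forall>x. perp x F \<longrightarrow>
          norm ((X + Y) x) \<le> (singular_numbers X (n div 2) + singular_numbers Y (n div 2)) * norm x)"
        using F(1) G(1) by (intro exI[of _ "F \<union> G"]) blast
    qed
  qed
  have times: "A o\<^sub>L X \<in> J \<and> X o\<^sub>L A \<in> J" if XJ: "X \<in> J" and A: "A \<in> BH" for X A
  proof -
    have X: "X \<in> BH" "compact_op X" "singular_numbers X \<in> S" using XJ by (auto simp: J_def)
    obtain B where B: "\<And>x y. cinner (A x) y = cinner x (B y)"
      using exists_adjoint[OF basis A] by blast
    note \<zeta> = scale[OF X(3), of "norm A", OF norm_ge_zero]
    have pos: "0 \<le> singular_numbers X n" for n using S(1) X(3) by (auto simp: c0_star_def)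
    show ?thesis
    proof (intro conjI memI[OF _ _ \<zeta>])
      fix n
      obtain F where F: "finite F" "card F \<le> n"
        "\<And>x. perp x F \<Longrightarrow> norm (X x) \<le> singular_numbers X n * norm x"
        using memD[OF X(1,2)] by blast
      have "norm ((A o\<^sub>L X) x) \<le> norm A * singular_numbers X n * norm x" if "perp x F" for x
        by (rule norm_compose_left_le[OF F(3)[OF that]])
      then show "\<exists>F. finite F \<and> card F \<le> n \<and> (\<forall>x. perp x F \<longrightarrow>
          norm ((A o\<^sub>L X) x) \<le> norm A * singular_numbers X n * norm x)"
        using F(1,2) by blast
      have "norm ((X o\<^sub>L A) x) \<le> norm A * singular_numbers X n * norm x" if "perp x (B ` F)" for x
        using that by (intro norm_compose_right_le F(3) pos) (simp add: B)
      then show "\<exists>F. finite F \<and> card F \<le> n \<and> (\<forall>x. perp x F \<longrightarrow>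
          norm ((X o\<^sub>L A) x) \<le> norm A * singular_numbers X n * norm x)"
        using F(1,2) card_image_le[OF F(1), of B] by (intro exI[of _ "B ` F"]) auto
    qed (intro compose_in_BH X A compact_op_compose_left compact_op_compose_right[OF _ B])+
  qed
  have "J \<noteq> BH" using not_compact_op_id[OF dim] id_in_BH by (auto simp: J_def)
  then have J: "operator_ideal J"
    using zero plus times by (auto simp: operator_ideal_def J_def)
  moreover have "char_set J = S"
  proof
    show "char_set J \<subseteq> S" by (auto simp: char_set_def J_def)
    show "S \<subseteq> char_set J"
    proof
      fix \<xi> assume \<xi>: "\<xi> \<in> S"
      then have c: "\<xi> \<in> c0_star" using S(1) by blast
      interpret diag_op \<xi> h h by unfold_locales (rule orth c0_star_bounded[OF c])+
      have "diag \<xi> h h \<in> J"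
        using \<xi> c diag_in_BH compact_op_diag[OF orth orth] singular_numbers_diag[OF orth orth c]
        by (simp add: J_def c0_star_def)
      then show "\<xi> \<in> char_set J" using diag_mem_iff[OF J c] by simp
    qed
  qed
  ultimately show ?thesis by (rule that)
qed

end


subsection \<open>Countable averages of permutations of a sequence\<close>

text \<open>Tonelli for series; it serves both to flatten averages of averages and to exchange the
  sums in a matrix product.\<close>

lemma has_sum_iterated_sums:
  fixes a :: "nat \<Rightarrow> nat \<Rightarrow> real"
  assumes "\<And>k l. 0 \<le> a k l" "\<And>k. (\<lambda>l. a k l) sums b k" "b sums c"
  shows "((\<lambda>(k, l). a k l) has_sum c) (UNIV \<times> UNIV)"
proof -
  have b: "0 \<le> b k" for k using sums_le[OF _ sums_zero assms(2)] assms(1) by blast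
  have 1: "((\<lambda>l. case (k, l) of (k, l) \<Rightarrow> a k l) has_sum b k) UNIV" for k
    using sums_nonneg_imp_has_sum[OF assms(2)] assms(1) by simp
  have 2: "(b has_sum c) UNIV" by (rule sums_nonneg_imp_has_sum[OF assms(3) b])
  have "(\<lambda>(k, l). a k l) summable_on (UNIV \<times> UNIV)"
    by (rule summable_on_SigmaI[OF 1 has_sum_imp_summable[OF 2]]) (use assms(1) in simp)
  then show ?thesis by (rule has_sum_SigmaI[OF 1 2])
qed

text \<open>Stands for the images of \<open>y\<close> under \<C>, with permutations acting on
  indices. Each entry is then a single series, and matrices appear only in
  \<open>perm_avg_eq_mat_apply\<close>.\<close>

definition perm_avg :: "(nat \<Rightarrow> real) \<Rightarrow> (nat \<Rightarrow> real) set" where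
  "perm_avg y = {u. \<exists>t \<sigma>. (\<forall>k. bij (\<sigma> k)) \<and> (\<forall>k. 0 \<le> t k) \<and> t sums 1 \<and>
     (\<forall>i. (\<lambda>k. t k * y (\<sigma> k i)) sums u i)}"

lemma perm_avgE:
  assumes "u \<in> perm_avg y"
  obtains t \<sigma> where "\<And>k. bij (\<sigma> k)" "\<And>k. 0 \<le> t k" "t sums 1"
    "\<And>i. (\<lambda>k. t k * y (\<sigma> k i)) sums u i"
  using assms unfolding perm_avg_def by blast

lemma perm_avgI:
  assumes "\<And>k. bij (\<sigma> k)" "\<And>k. 0 \<le> t k" "t sums 1" "\<And>i. (\<lambda>k. t k * y (\<sigma> k i)) sums u i"
  shows "u \<in> perm_avg y"
  using assms unfolding perm_avg_def by blast

lemma perm_avg_perm: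
  assumes "bij \<sigma>"
  shows "(\<lambda>i. y (\<sigma> i)) \<in> perm_avg y"
proof (rule perm_avgI)
  let ?t = "\<lambda>k::nat. if k = 0 then 1 else 0 :: real"
  show "?t sums 1" using sums_single[of 0 "\<lambda>_. 1::real"] by simp
  show "(\<lambda>k. ?t k * y (\<sigma> i)) sums y (\<sigma> i)" for i
    using sums_single[of 0 "\<lambda>_. y (\<sigma> i)"] by (simp add: if_distrib if_distribR cong: if_cong)
qed (use assms in auto)

lemma perm_avg_reindex:
  assumes "u \<in> perm_avg y" "bij \<tau>"
  shows "(\<lambda>i. u (\<tau> i)) \<in> perm_avg y"
proof -
  obtain t \<sigma> where t: "\<And>k. bij (\<sigma> k)" "\<And>k. 0 \<le> t k" "t sums 1"
    "\<And>i. (\<lambda>k. t k * y (\<sigma> k i)) sums u i" by (rule perm_avgE[OF assms(1)], rule that) assumption+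
  show ?thesis
  proof (rule perm_avgI[where \<sigma> = "\<lambda>k. \<sigma> k \<circ> \<tau>" and t = t])
    show "bij (\<sigma> k \<circ> \<tau>)" for k by (rule bij_comp[OF assms(2) t(1)])
    show "(\<lambda>k. t k * y ((\<sigma> k \<circ> \<tau>) i)) sums u (\<tau> i)" for i using t(4)[of "\<tau> i"] by simp
  qed (rule t(2,3))+
qed

lemma perm_avg_bounds:
  assumes "u \<in> perm_avg y" "\<And>i. 0 \<le> y i" "\<And>i. y i \<le> M"
  shows "0 \<le> u i" "u i \<le> M"
proof -
  obtain t \<sigma> where t: "\<And>k. bij (\<sigma> k)" "\<And>k. 0 \<le> t k" "t sums 1"
    "\<And>i. (\<lambda>k. t k * y (\<sigma> k i)) sums u i" by (rule perm_avgE[OF assms(1)], rule that) assumption+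
  show "0 \<le> u i" by (rule sums_le[OF _ sums_zero t(4)]) (use t assms in auto)
  have "u i \<le> 1 * M"
    by (rule sums_le[OF _ t(4) sums_mult2[OF t(3)]]) (use t assms in \<open>auto intro: mult_left_mono\<close>)
  then show "u i \<le> M" by simp
qed

text \<open>The weights multiply to \<open>w k * t k l\<close>, enumerated by the pairing function.
  Countable combinations are what later assembles the blocks.\<close>

lemma perm_avg_convex:
  assumes y: "\<And>i. 0 \<le> y i" and u: "\<And>k. u k \<in> perm_avg y"
    and w: "\<And>k. 0 \<le> w k" "w sums 1" and v: "\<And>i. (\<lambda>k. w k * u k i) sums v i"
  shows "v \<in> perm_avg y"
proof -
  have "\<forall>k. \<exists>t \<sigma>. (\<forall>l. bij (\<sigma> l)) \<and> (\<forall>l. 0 \<le> t l) \<and> t sums 1 \<and>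
      (\<forall>i. (\<lambda>l. t l * y (\<sigma> l i)) sums u k i)"
    using u unfolding perm_avg_def by blast
  then obtain t \<sigma> where t: "\<And>k l. bij (\<sigma> k l)" "\<And>k l. 0 \<le> t k l" "\<And>k. t k sums 1"
      "\<And>k i. (\<lambda>l. t k l * y (\<sigma> k l i)) sums u k i"
    by metis
  have flat: "(\<lambda>n. case prod_decode n of (k, l) \<Rightarrow> a k l) sums c"
    if "((\<lambda>(k, l). a k l) has_sum c) (UNIV \<times> UNIV)" for a :: "nat \<Rightarrow> nat \<Rightarrow> real" and c
    using that has_sum_reindex_bij_betw[OF bij_prod_decode, of "\<lambda>(k, l). a k l" c]
    by (auto intro: has_sum_imp_sums)
  show ?thesis
  proof (rule perm_avgI)
    show "bij (case prod_decode n of (k, l) \<Rightarrow> \<sigma> k l)" for n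
      using t(1) by (simp split: prod.split)
    show "0 \<le> (case prod_decode n of (k, l) \<Rightarrow> w k * t k l)" for n
      using t(2) w(1) by (simp split: prod.split)
    show "(\<lambda>n. case prod_decode n of (k, l) \<Rightarrow> w k * t k l) sums 1"
      using t(2,3) w sums_mult[OF t(3), of "w _"]
      by (intro flat has_sum_iterated_sums[where b = w]) auto
    fix i
    have "(\<lambda>n. case prod_decode n of (k, l) \<Rightarrow> w k * t k l * y (\<sigma> k l i)) sums v i"
      using t(2) w(1) y v sums_mult[OF t(4), of "w _"]
      by (intro flat has_sum_iterated_sums[where b = "\<lambda>k. w k * u k i"]) (auto simp: mult.assoc)
    then show "(\<lambda>n. (case prod_decode n of (k, l) \<Rightarrow> w k * t k l) *
        y ((case prod_decode n of (k, l) \<Rightarrow> \<sigma> k l) i)) sums v i"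
      by (simp add: case_prod_unfold)
  qed
qed

lemma perm_avg_mix:
  assumes y: "\<And>i. 0 \<le> y i" and u: "u \<in> perm_avg y" "v \<in> perm_avg y" and \<theta>: "0 \<le> \<theta>" "\<theta> \<le> 1"
  shows "(\<lambda>i. \<theta> * u i + (1 - \<theta>) * v i) \<in> perm_avg y"
proof (rule perm_avg_convex[OF y])
  let ?w = "\<lambda>k::nat. if k = 0 then \<theta> else if k = 1 then 1 - \<theta> else 0"
  let ?u = "\<lambda>k::nat. if k = 0 then u else v"
  show "?u k \<in> perm_avg y" for k using u by simp
  show "0 \<le> ?w k" for k using \<theta> by simp
  have "?w sums (\<Sum>k<2. ?w k)" by (rule sums_finite) auto
  then show "?w sums 1" by (simp add: numeral_2_eq_2)
  have "(\<lambda>k. ?w k * ?u k i) sums (\<Sum>k<2. ?w k * ?u k i)" for i by (rule sums_finite) auto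
  then show "(\<lambda>k. ?w k * ?u k i) sums (\<theta> * u i + (1 - \<theta>) * v i)" for i
    by (simp add: numeral_2_eq_2)
qed

lemma bij_shift_perm:
  assumes "bij \<sigma>"
  shows "bij (case_nat 0 (\<lambda>j. Suc (\<sigma> j)))"
proof (rule bijI)
  show "inj (case_nat 0 (\<lambda>j. Suc (\<sigma> j)))"
  proof (rule injI)
    fix i j assume "case_nat 0 (\<lambda>j. Suc (\<sigma> j)) i = case_nat 0 (\<lambda>j. Suc (\<sigma> j)) j"
    then show "i = j" using injD[OF bij_is_inj[OF assms]] by (cases i; cases j) simp_all
  qed
  show "surj (case_nat 0 (\<lambda>j. Suc (\<sigma> j)))"
  proof (rule surjI)
    fix n show "case_nat 0 (\<lambda>j. Suc (\<sigma> j)) (case_nat 0 (\<lambda>j. Suc (inv \<sigma> j)) n) = n"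
      using surj_f_inv_f[OF bij_is_surj[OF assms]] by (cases n) simp_all
  qed
qed

text \<open>
  A T-transform of \<open>y\<close> fixes the first entry to \<open>x 0\<close>, and the induction hypothesis applies to the
  remaining entries. The sequence \<open>y\<close> need not be decreasing, so no sorting is necessary after the
  T-transform.
\<close>

lemma finite_majorization:
  assumes "\<And>i j. i \<le> j \<Longrightarrow> j < L \<Longrightarrow> x j \<le> x i" "\<And>i. 0 \<le> y i"
    "\<And>m. m \<le> L \<Longrightarrow> (\<Sum>j<m. x j) \<le> (\<Sum>j<m. y j)"
  shows "\<exists>u\<in>perm_avg y. \<forall>j<L. x j \<le> u j"
  using assms
proof (induction L arbitrary: x y)
  case 0
  then show ?case using perm_avg_perm[OF bij_id, of y] by auto
next
  case (Suc L)
  note anti = Suc.prems(1) and y0 = Suc.prems(2) and maj = Suc.prems(3)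
  show ?case
  proof (cases "\<forall>k\<le>L. x 0 \<le> y k")
    case True
    then have "\<forall>j<Suc L. x j \<le> y j" using anti[of 0] by (meson le0 less_Suc_eq_le order_trans)
    then show ?thesis using perm_avg_perm[OF bij_id, of y] by auto
  next
    case False
    then have ex: "\<exists>k. k \<le> L \<and> y k < x 0" by (simp add: not_le)
    \<comment> \<open>The first entry below \<open>x 0\<close>. The entries before \<open>k\<close>
      dominate every \<open>x j\<close> in range, which settles the partial sums there term by term;
      once \<open>k\<close> is included, the T-transform preserves the partial sums of
      \<open>y\<close>.\<close>
    define k where "k = (LEAST k. k \<le> L \<and> y k < x 0)"
    have k: "k \<le> L" "y k < x 0" using LeastI_ex[OF ex] by (simp_all add: k_def)
    have k_min: "x 0 \<le> y i" if "i < k" for i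
      using not_less_Least[of i "\<lambda>k. k \<le> L \<and> y k < x 0"] that k(1) by (simp add: k_def[symmetric])
    have x0: "x 0 \<le> y 0" using maj[of 1] by simp
    then have "k \<noteq> 0" using k(2) by (intro notI) simp
    define y' where "y' j = y j + (if j = 0 then x 0 - y 0 else 0) + (if j = k then y 0 - x 0 else 0)" for j
    \<comment> \<open>Weight of the identity in its mixture with the transposition of 0 and
      \<open>k\<close>, solved so that entry 0 becomes \<open>x 0\<close>; the surplus
      \<open>y 0 - x 0\<close> moves to position \<open>k\<close>.\<close>
    define \<theta> where "\<theta> = (x 0 - y k) / (y 0 - y k)"
    have yk: "y k < y 0" using x0 k(2) by simp
    have \<theta>: "0 \<le> \<theta>" "\<theta> \<le> 1" using x0 k(2) by (auto simp: \<theta>_def)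
    have th: "\<theta> * y 0 + (1 - \<theta>) * y k = x 0"
    proof -
      have "\<theta> * y 0 + (1 - \<theta>) * y k = y k + \<theta> * (y 0 - y k)" by (simp add: algebra_simps)
      then show ?thesis using yk by (simp add: \<theta>_def)
    qed
    have y'_eq: "y' j = \<theta> * y j + (1 - \<theta>) * y (Transposition.transpose 0 k j)" for j
      using th \<open>k \<noteq> 0\<close> by (auto simp: y'_def transpose_def algebra_simps)
    have y'_avg: "(\<lambda>i. y' (\<tau> i)) \<in> perm_avg y" if "bij \<tau>" for \<tau>
      unfolding y'_eq
      using perm_avg_mix[OF y0 perm_avg_perm[OF that] perm_avg_perm[OF bij_comp[OF that bij_transpose[of 0 k]]] \<theta>]
      by (simp add: o_def)
    have y'_nonneg: "0 \<le> y' j" for j unfolding y'_eq using y0 \<theta> by simp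
    have "\<exists>u\<in>perm_avg (\<lambda>j. y' (Suc j)). \<forall>j<L. x (Suc j) \<le> u j"
    proof (rule Suc.IH)
      fix m assume m: "m \<le> L"
      show "(\<Sum>j<m. x (Suc j)) \<le> (\<Sum>j<m. y' (Suc j))"
      proof (cases "m < k")
        case True
        show ?thesis
        proof (rule sum_mono)
          fix j assume "j \<in> {..<m}"
          then show "x (Suc j) \<le> y' (Suc j)"
            using True m k_min[of "Suc j"] anti[of 0 "Suc j"] by (simp add: y'_def)
        qed
      next
        case False
        have "(\<Sum>j<Suc m. y' j) = (\<Sum>j<Suc m. y j)"
          unfolding y'_def sum.distrib using False \<open>k \<noteq> 0\<close> by (simp add: sum.delta del: sum.lessThan_Suc)
        then have "(\<Sum>j<Suc m. x j) \<le> (\<Sum>j<Suc m. y' j)" using maj[of "Suc m"] m by simp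
        then show ?thesis
          using \<open>k \<noteq> 0\<close> by (simp add: sum.lessThan_Suc_shift y'_def del: sum.lessThan_Suc)
      qed
    qed (use anti y'_nonneg in auto)
    then obtain u where u: "u \<in> perm_avg (\<lambda>j. y' (Suc j))" "\<And>j. j < L \<Longrightarrow> x (Suc j) \<le> u j" by blast
    obtain t \<sigma> where t: "\<And>k. bij (\<sigma> k)" "\<And>k. 0 \<le> t k" "t sums 1"
      "\<And>i. (\<lambda>k. t k * y' (Suc (\<sigma> k i))) sums u i" by (rule perm_avgE[OF u(1)], rule that) assumption+
    have "case_nat (x 0) u \<in> perm_avg y"
    \<comment> \<open>The permutations of the tail are extended by fixing 0. Each summand then has
      entry \<open>x 0\<close> at 0, and so has the average.\<close>
    proof (rule perm_avg_convex[OF y0 y'_avg[OF bij_shift_perm[OF t(1)]] t(2,3)])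
      fix i
      have "y' 0 = x 0" using \<open>k \<noteq> 0\<close> by (simp add: y'_def)
      then show "(\<lambda>k. t k * y' (case_nat 0 (\<lambda>j. Suc (\<sigma> k j)) i)) sums (case_nat (x 0) u i)"
        using t(4) sums_mult2[OF t(3), of "x 0"] by (simp split: nat.split)
    qed
    moreover have "\<forall>j<Suc L. x j \<le> case_nat (x 0) u j"
      using u(2) by (simp split: nat.split)
    ultimately show ?thesis by blast
  qed
qed

subsection \<open>Majorization with a null factor\<close>

text \<open>If \<eta> is summable, so is \<xi>, and far tails of \<xi> sum to less than
  \<open>d * \<eta> 0\<close>. Otherwise the partial sums of \<eta> are unbounded: for large
  \<open>m\<close> they absorb the head where \<beta> is not small, and for the finitely many other
  \<open>m\<close> the tail starts where the entries of \<xi> are tiny.\<close>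

lemma majorized_tail_small:
  fixes \<beta> \<eta> \<xi> :: "nat \<Rightarrow> real"
  assumes \<xi>: "\<xi> \<in> c0_star" and \<eta>: "\<eta> \<in> c0_star" "\<eta> 0 > 0" and \<beta>: "\<beta> \<in> c0_star"
    and maj: "\<And>m. (\<Sum>j<m. \<xi> j) \<le> (\<Sum>j<m. \<beta> j * \<eta> j)" and d: "d > 0"
  shows "\<exists>N\<ge>N0. \<forall>m. (\<Sum>j<m. \<xi> (N + j)) \<le> d * (\<Sum>j<m. \<eta> j)"
proof -
  have \<xi>0: "0 \<le> \<xi> n" and \<eta>0: "0 \<le> \<eta> n" and \<beta>0: "0 \<le> \<beta> n" "\<beta> n \<le> \<beta> 0" for n
    using \<xi> \<eta> \<beta> by (auto simp: c0_star_def antimono_def)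
  have \<xi>_anti: "m \<le> n \<Longrightarrow> \<xi> n \<le> \<xi> m" for m n using \<xi> by (auto simp: c0_star_def antimono_def)
  define H where "H m = (\<Sum>j<m. \<eta> j)" for m
  have H_mono: "H m \<le> H n" if "m \<le> n" for m n
    unfolding H_def using that \<eta>0 by (intro sum_mono2) auto
  have H1: "\<eta> 0 \<le> H m" if "m > 0" for m
    using H_mono[of 1 m] that by (simp add: H_def)
  have H0: "0 \<le> H m" for m by (simp add: H_def sum_nonneg \<eta>0)
  show ?thesis
  proof (cases "summable \<eta>")
    case True
    have "(\<Sum>j<m. \<xi> j) \<le> \<beta> 0 * suminf \<eta>" for m
    proof -
      have "(\<Sum>j<m. \<xi> j) \<le> (\<Sum>j<m. \<beta> 0 * \<eta> j)"
        by (rule order_trans[OF maj]) (intro sum_mono mult_right_mono \<beta>0 \<eta>0)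
      also have "\<dots> \<le> \<beta> 0 * suminf \<eta>"
        unfolding sum_distrib_left[symmetric]
        by (intro mult_left_mono sum_le_suminf True \<eta>0 \<beta>0) auto
      finally show ?thesis .
    qed
    then have sm: "summable \<xi>" by (intro summableI_nonneg_bounded \<xi>0)
    obtain N where N: "\<And>n. n \<ge> N \<Longrightarrow> norm (\<Sum>i. \<xi> (i + n)) < d * \<eta> 0"
      using suminf_exist_split[OF _ sm, of "d * \<eta> 0"] d \<eta>(2) by auto
    let ?N = "max N N0"
    have "(\<Sum>j<m. \<xi> (?N + j)) \<le> d * H m" for m
    proof (cases "m = 0")
      case False
      have "(\<Sum>j<m. \<xi> (j + ?N)) \<le> (\<Sum>j. \<xi> (j + ?N))"
        by (intro sum_le_suminf summable_ignore_initial_segment sm) (use \<xi>0 in auto)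
      also have "\<dots> \<le> d * \<eta> 0" using N[of ?N] by simp
      also have "\<dots> \<le> d * H m" using H1 False d by simp
      finally show ?thesis by (simp add: add.commute)
    qed (simp add: H_def)
    then show ?thesis unfolding H_def by (intro exI[of _ ?N]) auto
  next
    case False
    have "\<beta> \<longlonglongrightarrow> 0" using \<beta> by (simp add: c0_star_def)
    then obtain n1 where n1: "\<And>n. n \<ge> n1 \<Longrightarrow> \<beta> n < d / 2"
      using order_tendstoD(2)[of \<beta> 0 sequentially "d / 2"] d by (auto simp: eventually_sequentially)
    have split: "(\<Sum>j<m. \<xi> j) \<le> \<beta> 0 * H n1 + d / 2 * H m" for m
    proof -
      have "\<beta> j * \<eta> j \<le> (if j < n1 then \<beta> 0 * \<eta> j else 0) + d / 2 * \<eta> j" for j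
      proof (cases "j < n1")
        case True
        then show ?thesis
          using mult_right_mono[OF \<beta>0(2)[of j] \<eta>0[of j]] mult_nonneg_nonneg[OF less_imp_le[OF d] \<eta>0[of j]]
          by simp
      next
        case False
        then show ?thesis using mult_right_mono[OF less_imp_le[OF n1[of j]] \<eta>0[of j]] by simp
      qed
      then have "(\<Sum>j<m. \<xi> j) \<le> (\<Sum>j<m. (if j < n1 then \<beta> 0 * \<eta> j else 0) + d / 2 * \<eta> j)"
        by (intro order_trans[OF maj] sum_mono)
      also have "\<dots> = (\<Sum>j\<in>{..<m} \<inter> {..<n1}. \<beta> 0 * \<eta> j) + d / 2 * H m"
        by (simp add: sum.distrib sum.inter_restrict H_def sum_distrib_left)
      also have "(\<Sum>j\<in>{..<m} \<inter> {..<n1}. \<beta> 0 * \<eta> j) \<le> \<beta> 0 * H n1"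
        unfolding H_def sum_distrib_left by (intro sum_mono2) (use \<beta>0 \<eta>0 in auto)
      finally show ?thesis by simp
    qed
    \<comment> \<open>From \<open>m0\<close> on, the half of \<open>d\<close> left over by
      \<open>split\<close> pays for its constant term.\<close>
    obtain m0 where m0: "2 * \<beta> 0 * H n1 / d \<le> H m0"
    proof (rule ccontr)
      assume "\<not> thesis"
      then have "H m \<le> 2 * \<beta> 0 * H n1 / d" for m using that by (meson linear)
      then have "summable \<eta>"
        unfolding H_def by (intro summableI_nonneg_bounded \<eta>0)
      then show False using False by simp
    qed
    have "\<xi> \<longlonglongrightarrow> 0" using \<xi> by (simp add: c0_star_def)
    \<comment> \<open>Fewer than \<open>m0\<close> entries below this threshold sum to at most
      \<open>d * \<eta> 0\<close>, which is at most \<open>d * H m\<close> as soon as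
      \<open>m > 0\<close>.\<close>
    moreover have "d * \<eta> 0 / real (m0 + 1) > 0" using d \<eta>(2) by simp
    ultimately obtain n2 where n2: "\<And>n. n \<ge> n2 \<Longrightarrow> \<xi> n < d * \<eta> 0 / real (m0 + 1)"
      using order_tendstoD(2) by (metis (no_types, lifting) eventually_sequentially)
    let ?N = "max n2 N0"
    have "(\<Sum>j<m. \<xi> (?N + j)) \<le> d * H m" for m
    proof (cases "m0 \<le> m")
      case True
      have "(\<Sum>j<m. \<xi> (?N + j)) \<le> (\<Sum>j<m. \<xi> j)" by (intro sum_mono \<xi>_anti) simp
      also have "\<dots> \<le> \<beta> 0 * H n1 + d / 2 * H m" by (rule split)
      also have "\<beta> 0 * H n1 \<le> d / 2 * H m0" using m0 d by (simp add: field_simps)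
      also have "d / 2 * H m0 \<le> d / 2 * H m" using H_mono[OF True] d by simp
      finally show ?thesis by simp
    next
      case m: False
      show ?thesis
      proof (cases "m = 0")
        case False
        have "(\<Sum>j<m. \<xi> (?N + j)) \<le> (\<Sum>j<m. d * \<eta> 0 / real (m0 + 1))"
          by (rule sum_mono, rule less_imp_le, rule n2) simp
        also have "\<dots> = real m * (d * \<eta> 0 / real (m0 + 1))" by simp
        also have "\<dots> \<le> real (m0 + 1) * (d * \<eta> 0 / real (m0 + 1))"
          using m d \<eta>(2) by (intro mult_right_mono) auto
        also have "\<dots> = d * \<eta> 0" by simp
        also have "\<dots> \<le> d * H m" using H1 False d by simp
        finally show ?thesis .
      qed (simp add: H_def)
    qed
    then show ?thesis unfolding H_def by (intro exI[of _ ?N]) auto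
  qed
qed

text \<open>Position \<open>N + j\<close> with \<open>j < L\<close> reads entry \<open>j\<close>, so
  an average fitted to an initial segment is transported to the positions from \<open>N\<close>
  on.\<close>

lemma bij_block_swap: "bij (\<lambda>i::nat. if i < N then i + L else if i < N + L then i - N else i)"
  by (rule bij_betw_byWitness[where f' = "\<lambda>i. if i < L then i + N else if i < N + L then i - L else i"])
    auto

lemma majorized_le_perm_avg:
  fixes \<beta> \<eta> \<xi> :: "nat \<Rightarrow> real"
  assumes \<xi>: "\<xi> \<in> c0_star" and \<eta>: "\<eta> \<in> c0_star" "\<eta> 0 > 0" and \<beta>: "\<beta> \<in> c0_star"
    and maj: "\<And>m. (\<Sum>j<m. \<xi> j) \<le> (\<Sum>j<m. \<beta> j * \<eta> j)"
  shows "\<exists>u\<in>perm_avg \<eta>. \<exists>c. \<forall>i. \<xi> i \<le> c * u i"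
proof -
  have \<eta>0: "0 \<le> \<eta> n" "\<eta> n \<le> \<eta> 0" and \<beta>0: "0 \<le> \<beta> n" "\<beta> n \<le> \<beta> 0" for n
    using \<eta> \<beta> by (auto simp: c0_star_def antimono_def)
  have \<xi>_anti: "m \<le> n \<Longrightarrow> \<xi> n \<le> \<xi> m" for m n using \<xi> by (auto simp: c0_star_def antimono_def)
  \<comment> \<open>Large enough to compare block 0 with \<open>d 0 = A\<close>; the added 1 keeps
    \<open>A\<close> positive when \<open>\<beta> 0 = 0\<close>.\<close>
  define A where "A = \<beta> 0 + 1"
  have A: "A > 0" using \<beta>0(1)[of 0] by (simp add: A_def)
  define d where "d k = A * (1/2)^k" for k :: nat
  have d: "d k > 0" for k using A by (simp add: d_def)
  have "\<forall>k. \<exists>N\<ge>k. \<forall>m. (\<Sum>j<m. \<xi> (N + j)) \<le> d k * (\<Sum>j<m. \<eta> j)"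
    by (intro allI majorized_tail_small[OF \<xi> \<eta> \<beta> maj d])
  from choice[OF this] obtain N' where N': "\<And>k. N' k \<ge> k"
    "\<And>k m. (\<Sum>j<m. \<xi> (N' k + j)) \<le> d k * (\<Sum>j<m. \<eta> j)" by blast
  \<comment> \<open>Starting at 0 makes the blocks cover all indices; there the majorization comes
    from \<open>maj\<close> and the size of \<open>A\<close>.\<close>
  define N where "N k = (if k = 0 then 0 else N' k)" for k
  have "(\<Sum>j<m. \<xi> j) \<le> d 0 * (\<Sum>j<m. \<eta> j)" for m
    unfolding sum_distrib_left
    by (rule order_trans[OF maj sum_mono], rule mult_right_mono)
      (use \<beta>0 \<eta>0 in \<open>auto simp: d_def A_def intro: add_increasing2\<close>)
  then have N: "k \<le> N k" "(\<Sum>j<m. \<xi> (N k + j)) \<le> d k * (\<Sum>j<m. \<eta> j)" for k m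
    using N' by (auto simp: N_def)
  have "\<forall>k. \<exists>u. u \<in> perm_avg \<eta> \<and> (\<forall>i. N k \<le> i \<longrightarrow> i < N (Suc k) \<longrightarrow> \<xi> i \<le> d k * u i)"
  proof
    fix k
    \<comment> \<open>A bound for the length of the block, whichever of \<open>N k\<close> and
      \<open>N (Suc k)\<close> is larger.\<close>
    let ?L = "N (Suc k)"
    have "\<exists>v\<in>perm_avg \<eta>. \<forall>j<?L. \<xi> (N k + j) / d k \<le> v j"
    proof (rule finite_majorization)
      show "\<xi> (N k + j) / d k \<le> \<xi> (N k + i) / d k" if "i \<le> j" for i j
        using \<xi>_anti[of "N k + i" "N k + j"] that d[of k] by (simp add: divide_right_mono)
      show "(\<Sum>j<m. \<xi> (N k + j) / d k) \<le> (\<Sum>j<m. \<eta> j)" for m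
        using N(2)[where k = k and m = m] d[of k]
        by (simp add: sum_divide_distrib[symmetric] divide_le_eq mult.commute)
    qed (rule \<eta>0)
    then obtain v where v: "v \<in> perm_avg \<eta>" "\<And>j. j < ?L \<Longrightarrow> \<xi> (N k + j) / d k \<le> v j" by blast
    let ?\<tau> = "\<lambda>i. if i < N k then i + ?L else if i < N k + ?L then i - N k else i"
    have "\<xi> i \<le> d k * v (?\<tau> i)" if "N k \<le> i" "i < ?L" for i
      using v(2)[of "i - N k"] that d[of k] by (simp add: divide_le_eq mult.commute)
    then show "\<exists>u. u \<in> perm_avg \<eta> \<and> (\<forall>i. N k \<le> i \<longrightarrow> i < ?L \<longrightarrow> \<xi> i \<le> d k * u i)"
      using perm_avg_reindex[OF v(1) bij_block_swap[of "N k" ?L]]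
      by (intro exI[of _ "\<lambda>i. v (?\<tau> i)"]) simp
  qed
  from choice[OF this] obtain u where u: "\<And>k. u k \<in> perm_avg \<eta>"
    "\<And>k i. N k \<le> i \<Longrightarrow> i < N (Suc k) \<Longrightarrow> \<xi> i \<le> d k * u k i" by blast
  note u_bounds = perm_avg_bounds[OF u(1) \<eta>0]
  \<comment> \<open>Matched to \<open>d k\<close>: the quotient \<open>d k / w k\<close> is
    \<open>2 * A\<close> for every \<open>k\<close>, the constant of the final estimate.\<close>
  define w where "w k = (1/2 :: real) ^ Suc k" for k
  have w: "w sums 1" unfolding w_def using power_half_series by simp
  have w0: "0 \<le> w k" for k by (simp add: w_def)
  have sm: "summable (\<lambda>k. w k * u k i)" for i
    by (rule summable_comparison_test'[OF summable_mult2[OF sums_summable[OF w], of "\<eta> 0"], of 0])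
      (use u_bounds w0 in \<open>auto simp: abs_mult intro!: mult_left_mono\<close>)
  define v where "v i = (\<Sum>k. w k * u k i)" for i
  have "v \<in> perm_avg \<eta>"
    by (rule perm_avg_convex[where u = u, OF \<eta>0(1) u(1) w0 w]) (simp add: v_def summable_sums sm)
  moreover have "\<xi> i \<le> (2 * A) * v i" for i
  proof -
    have "i < N (Suc i)" using N(1)[of "Suc i"] by simp
    \<comment> \<open>For the least such \<open>k\<close> also \<open>N k \<le> i\<close>, by
      minimality or because \<open>N 0 = 0\<close>.\<close>
    then obtain k where k: "i < N (Suc k)" "\<And>l. l < k \<Longrightarrow> \<not> i < N (Suc l)"
      using exists_least_iff[of "\<lambda>k. i < N (Suc k)"] by blast
    have "N k \<le> i"
      using k(2)[of "k - 1"] by (cases k) (auto simp: N_def[of 0] not_less)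
    then have "\<xi> i \<le> d k * u k i" using u(2) k(1) by blast
    also have "\<dots> = (2 * A) * (w k * u k i)" by (simp add: d_def w_def)
    also have "\<dots> \<le> (2 * A) * v i"
    proof (rule mult_left_mono)
      show "w k * u k i \<le> v i"
        unfolding v_def using sum_le_suminf[OF sm, of "{k}" i] u_bounds w0 by simp
    qed (use A in simp)
    finally show ?thesis .
  qed
  ultimately show ?thesis by blast
qed

text \<open>Each permuted copy of \<eta> is null, as an injection of the naturals tends to infinity;
  domination by \<open>t k * \<eta> 0\<close> carries the limit through the sum. The rearrangement
  of \<open>u\<close> is meaningful only for null \<open>u\<close>.\<close>

lemma perm_avg_tendsto_0:
  assumes u: "u \<in> perm_avg \<eta>" and \<eta>: "\<eta> \<in> c0_star"
  shows "u \<longlonglongrightarrow> 0"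
proof -
  obtain t \<sigma> where t: "\<And>k. bij (\<sigma> k)" "\<And>k. 0 \<le> t k" "t sums 1"
    "\<And>i. (\<lambda>k. t k * \<eta> (\<sigma> k i)) sums u i" by (rule perm_avgE[OF u], rule that) assumption+
  have \<eta>0: "0 \<le> \<eta> n" "\<eta> n \<le> \<eta> 0" for n using \<eta> by (auto simp: c0_star_def antimono_def)
  have lim: "(\<lambda>i. t k * \<eta> (\<sigma> k i)) \<longlonglongrightarrow> 0" for k
  proof -
    have "finite {i. \<not> Z \<le> \<sigma> k i}" for Z
      using finite_vimageI[OF finite_lessThan bij_is_inj[OF t(1)], of k Z]
      by (simp add: vimage_def not_le)
    then have "filterlim (\<sigma> k) at_top sequentially"
      unfolding filterlim_at_top by (simp add: eventually_cofinite flip: cofinite_eq_sequentially)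
    moreover have "\<eta> \<longlonglongrightarrow> 0" using \<eta> by (simp add: c0_star_def)
    ultimately have "(\<lambda>i. \<eta> (\<sigma> k i)) \<longlonglongrightarrow> 0" by (rule filterlim_compose[rotated])
    from tendsto_mult[OF tendsto_const[of "t k"] this] show ?thesis by simp
  qed
  have "norm (t k * \<eta> (\<sigma> k i)) \<le> t k * \<eta> 0" for k i
    using t(2) \<eta>0 by (simp add: abs_mult mult_left_mono)
  then have dom: "\<forall>\<^sub>F (k, i) in at_top \<times>\<^sub>F sequentially. norm (t k * \<eta> (\<sigma> k i)) \<le> t k * \<eta> 0"
    by (intro always_eventually) (simp add: case_prod_unfold)
  have "summable (\<lambda>k. t k * \<eta> 0)" by (rule summable_mult2[OF sums_summable[OF t(3)]])
  from tannerys_theorem[OF lim dom this sequentially_bot]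
  have "(\<lambda>i. suminf (\<lambda>k. t k * \<eta> (\<sigma> k i))) \<longlonglongrightarrow> suminf (\<lambda>k::nat. 0::real)"
    by (elim conjE)
  moreover have "suminf (\<lambda>k. t k * \<eta> (\<sigma> k i)) = u i" for i
    using sums_unique[OF t(4)] by simp
  ultimately show ?thesis by simp
qed

lemma perm_avg_eq_mat_apply:
  assumes u: "u \<in> perm_avg \<eta>" and \<eta>: "\<And>i. 0 \<le> \<eta> i"
  shows "\<exists>P\<in>\<C>. mat_apply P \<eta> = u"
proof -
  obtain t \<sigma> where t: "\<And>k. bij (\<sigma> k)" "\<And>k. 0 \<le> t k" "t sums 1"
    "\<And>i. (\<lambda>k. t k * \<eta> (\<sigma> k i)) sums u i" by (rule perm_avgE[OF u], rule that) assumption+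
  \<comment> \<open>A permutation matrix of \<sigma> has the 1 of column \<open>j\<close> in row
    \<open>\<sigma> j\<close>; the inverse is taken so that row \<open>i\<close> selects entry
    \<open>\<sigma> k i\<close>.\<close>
  define Q :: "nat \<Rightarrow> inf_matrix" where "Q k = (\<lambda>i j. if i = inv (\<sigma> k) j then 1 else 0)" for k
  define P :: inf_matrix where "P = (\<lambda>i j. \<Sum>k. t k * Q k i j)"
  have "permutation_matrix (Q k)" for k
    unfolding permutation_matrix_def Q_def using bij_imp_bij_inv[OF t(1)] by blast
  moreover have t1: "t k \<le> 1" for k
    using sum_le_suminf[OF sums_summable[OF t(3)], of "{k}"] t(2) sums_unique[OF t(3)] by simp
  ultimately have "P \<in> \<C>"
    unfolding infinite_convex_permutations_def P_def using t(2,3) by blast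
  moreover have "mat_apply P \<eta> i = u i" for i
  proof -
    have Q_eq: "Q k i j = (if j = \<sigma> k i then 1 else 0)" for k j
      using t(1)[of k] unfolding Q_def
      by (metis bij_inv_eq_iff)
    have row: "(\<lambda>j. t k * Q k i j * \<eta> j) sums (t k * \<eta> (\<sigma> k i))" for k
      using sums_single[of "\<sigma> k i" "\<lambda>j. t k * \<eta> j"] by (simp add: Q_eq if_distrib if_distribR cong: if_cong)
    have "((\<lambda>(k, j). t k * Q k i j * \<eta> j) has_sum u i) (UNIV \<times> UNIV)"
      by (rule has_sum_iterated_sums[OF _ row t(4)]) (use t(2) \<eta> in \<open>simp add: Q_eq\<close>)
    then have "((\<lambda>(j, k). t k * Q k i j * \<eta> j) has_sum u i) (UNIV \<times> UNIV)"
      by (subst (asm) has_sum_swap) simp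
    moreover have "((\<lambda>k. case (j, k) of (j, k) \<Rightarrow> t k * Q k i j * \<eta> j) has_sum (P i j * \<eta> j)) UNIV" for j
    proof -
      have "summable (\<lambda>k. t k * Q k i j)"
        by (rule summable_comparison_test'[OF sums_summable[OF t(3)], of 0])
          (use t(2) in \<open>simp add: Q_eq\<close>)
      then have "(\<lambda>k. t k * Q k i j * \<eta> j) sums (P i j * \<eta> j)"
        unfolding P_def by (intro sums_mult2 summable_sums)
      then show ?thesis
        using sums_nonneg_imp_has_sum t(2) \<eta> by (simp add: Q_eq)
    qed
    ultimately have "((\<lambda>j. P i j * \<eta> j) has_sum u i) UNIV"
      by (rule has_sum_SigmaD)
    then show ?thesis
      unfolding mat_apply_def using has_sum_imp_sums sums_unique by metis
  qed
  ultimately show ?thesis by blast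
qed

text \<open>Abel summation in inductive form: \<open>\<alpha> m * D m\<close> stays below the
  weighted difference because \<alpha> decreases. It carries a majorization over to the products
  tested by soft complementedness.\<close>

lemma weighted_partial_sums_le:
  fixes \<alpha> x z :: "nat \<Rightarrow> real"
  assumes \<alpha>: "antimono \<alpha>" "\<And>n. 0 \<le> \<alpha> n" and le: "\<And>m. (\<Sum>j<m. x j) \<le> (\<Sum>j<m. z j)"
  shows "(\<Sum>j<m. \<alpha> j * x j) \<le> (\<Sum>j<m. \<alpha> j * z j)"
proof -
  define D where "D m = (\<Sum>j<m. z j - x j)" for m
  have D: "0 \<le> D m" for m using le by (simp add: D_def sum_subtractf)
  have "\<alpha> m * D m \<le> (\<Sum>j<m. \<alpha> j * (z j - x j))" for m
  proof (induction m)
    case (Suc m)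
    have "\<alpha> (Suc m) * D (Suc m) \<le> \<alpha> m * D (Suc m)"
      using antimonoD[OF \<alpha>(1), of m "Suc m"] D by (intro mult_right_mono) auto
    also have "\<dots> = \<alpha> m * D m + \<alpha> m * (z m - x m)" by (simp add: D_def distrib_left)
    finally show ?case using Suc by simp
  qed (simp add: D_def)
  from order_trans[OF mult_nonneg_nonneg[OF \<alpha>(2) D] this]
  show ?thesis by (simp add: right_diff_distrib sum_subtractf)
qed

subsection \<open>Arithmetic means\<close>

lemma arith_mean_c0_star:
  assumes \<xi>: "\<xi> \<in> c0_star"
  shows "arith_mean \<xi> \<in> c0_star"
proof -
  have \<xi>0: "0 \<le> \<xi> n" for n using \<xi> by (simp add: c0_star_def)
  have anti: "m \<le> n \<Longrightarrow> \<xi> n \<le> \<xi> m" for m n using \<xi> by (auto simp: c0_star_def antimono_def)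
  have "arith_mean \<xi> (Suc n) \<le> arith_mean \<xi> n" for n
  proof -
    have "(\<Sum>j\<le>n. \<xi> (Suc n)) \<le> (\<Sum>j\<le>n. \<xi> j)" by (intro sum_mono anti) auto
    then have "real (n + 1) * \<xi> (Suc n) \<le> (\<Sum>j\<le>n. \<xi> j)" by simp
    then have le: "\<xi> (Suc n) \<le> arith_mean \<xi> n"
      unfolding arith_mean_def mult.commute[of _ "\<xi> (Suc n)"] by (subst pos_le_divide_eq) simp_all
    have "(\<Sum>j\<le>n. \<xi> j) = arith_mean \<xi> n * real (n + 1)" by (simp add: arith_mean_def)
    then have "(\<Sum>j\<le>Suc n. \<xi> j) \<le> arith_mean \<xi> n * real (n + 1) + arith_mean \<xi> n"
      using le by simp
    also have "\<dots> = arith_mean \<xi> n * real (Suc n + 1)" by (simp add: distrib_left)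
    finally show ?thesis
      unfolding arith_mean_def[of \<xi> "Suc n"] by (subst pos_divide_le_eq) simp_all
  qed
  then have "antimono (arith_mean \<xi>)" by (rule decseq_SucI)
  moreover have pos: "0 \<le> arith_mean \<xi> n" for n
    by (simp add: arith_mean_def sum_nonneg \<xi>0)
  moreover have "arith_mean \<xi> \<longlonglongrightarrow> 0"
  proof (rule LIMSEQ_I)
    fix r :: real assume r: "r > 0"
    have "\<xi> \<longlonglongrightarrow> 0" using \<xi> by (simp add: c0_star_def)
    then obtain N where N: "\<And>n. n \<ge> N \<Longrightarrow> \<xi> n < r / 2"
      using order_tendstoD(2)[of \<xi> 0 sequentially "r / 2"] r by (auto simp: eventually_sequentially)
    let ?K = "\<Sum>j<N. \<xi> j"
    have "(\<lambda>n. ?K * inverse (real (Suc n))) \<longlonglongrightarrow> ?K * 0"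
      by (intro tendsto_mult tendsto_const LIMSEQ_inverse_real_of_nat)
    then have "\<forall>\<^sub>F n in sequentially. ?K * inverse (real (Suc n)) < r / 2"
      using r by (intro order_tendstoD(2)) auto
    then obtain M where M: "\<And>n. n \<ge> M \<Longrightarrow> ?K * inverse (real (Suc n)) < r / 2"
      by (auto simp: eventually_sequentially)
    have "arith_mean \<xi> n < r" if "n \<ge> M" for n
    proof -
      have "\<xi> j \<le> (if j < N then \<xi> j else 0) + r / 2" for j using N[of j] r by auto
      then have "(\<Sum>j\<le>n. \<xi> j) \<le> (\<Sum>j\<le>n. (if j < N then \<xi> j else 0) + r / 2)"
        by (rule sum_mono)
      also have "\<dots> = (\<Sum>j\<in>{..n} \<inter> {..<N}. \<xi> j) + real (Suc n) * (r / 2)"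
        by (simp add: sum.distrib sum.inter_restrict)
      also have "(\<Sum>j\<in>{..n} \<inter> {..<N}. \<xi> j) \<le> ?K" by (intro sum_mono2) (use \<xi>0 in auto)
      finally have "(\<Sum>j\<le>n. \<xi> j) \<le> ?K + real (Suc n) * (r / 2)" by simp
      then have "arith_mean \<xi> n \<le> (?K + real (Suc n) * (r / 2)) / real (Suc n)"
        unfolding arith_mean_def by (simp add: divide_right_mono)
      also have "\<dots> = ?K * inverse (real (Suc n)) + r / 2"
        by (subst add_divide_distrib, subst nonzero_mult_div_cancel_left)
          (simp_all only: divide_inverse of_nat_0_eq_iff nat.distinct not_False_eq_True)
      finally show ?thesis using M[OF that] by simp
    qed
    then show "\<exists>M. \<forall>n\<ge>M. norm (arith_mean \<xi> n - 0) < r" using pos by auto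
  qed
  ultimately show ?thesis by (simp add: c0_star_def)
qed

text \<open>Halving the index drops nonnegative terms, and \<open>n div 2 + 1\<close> is at least
  half of \<open>n + 1\<close>. This makes the am-ideal stable under 2-fold ampliation.\<close>

lemma arith_mean_div2_le:
  assumes "\<And>n. 0 \<le> \<eta> n"
  shows "arith_mean \<eta> (n div 2) \<le> 2 * arith_mean \<eta> n"
proof -
  have "(\<Sum>j\<le>n div 2. \<eta> j) / real (n div 2 + 1) \<le> (\<Sum>j\<le>n. \<eta> j) / (real (n + 1) / 2)"
    by (rule frac_le) (use assms in \<open>auto intro!: sum_nonneg sum_mono2\<close>)
  then show ?thesis by (simp add: arith_mean_def mult.commute)
qed

lemma arith_mean_add: "arith_mean (\<lambda>n. \<xi> n + \<zeta> n) n = arith_mean \<xi> n + arith_mean \<zeta> n"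
  by (simp add: arith_mean_def sum.distrib add_divide_distrib)

lemma arith_mean_nonneg: "(\<And>n. 0 \<le> \<eta> n) \<Longrightarrow> 0 \<le> arith_mean \<eta> n"
  by (simp add: arith_mean_def sum_nonneg)

lemma c0_star_mult:
  assumes "\<alpha> \<in> c0_star" "\<xi> \<in> c0_star"
  shows "(\<lambda>n. \<alpha> n * \<xi> n) \<in> c0_star"
  using assms tendsto_mult[of \<alpha> 0 sequentially \<xi> 0]
  by (auto simp: c0_star_def antimono_def intro!: mult_mono)

lemma c0_star_scale:
  assumes "\<xi> \<in> c0_star" "0 \<le> c"
  shows "(\<lambda>n. c * \<xi> n) \<in> c0_star"
  using assms tendsto_mult_right_zero[of \<xi> sequentially c]
  by (auto simp: c0_star_def antimono_def intro!: mult_left_mono)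

lemma c0_star_add_div2:
  assumes "\<xi> \<in> c0_star" "\<zeta> \<in> c0_star"
  shows "(\<lambda>n. \<xi> (n div 2) + \<zeta> (n div 2)) \<in> c0_star"
proof -
  have "filterlim (\<lambda>n::nat. n div 2) at_top sequentially"
    unfolding filterlim_at_top
  proof
    show "\<forall>\<^sub>F n in sequentially. Z \<le> n div 2" for Z :: nat
      using eventually_ge_at_top[of "2 * Z"] by eventually_elim linarith
  qed
  note lim = filterlim_compose[OF _ this]
  have "\<xi> \<longlonglongrightarrow> 0" "\<zeta> \<longlonglongrightarrow> 0" using assms by (simp_all add: c0_star_def)
  from tendsto_add_zero[OF lim[OF this(1)] lim[OF this(2)]]
  have "(\<lambda>n. \<xi> (n div 2) + \<zeta> (n div 2)) \<longlonglongrightarrow> 0" .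
  then show ?thesis
    using assms by (auto simp: c0_star_def antimono_def div_le_mono intro!: add_mono)
qed

section \<open>The am-ideal, majorization within an ideal, and am-closedness\<close>

context separable_hilbert
begin

lemma char_set_solid:
  assumes I: "operator_ideal (I :: ('a \<Rightarrow>\<^sub>L 'a) set)" and \<zeta>: "\<zeta> \<in> char_set I"
    and \<xi>: "\<xi> \<in> c0_star" "\<And>n. \<xi> n \<le> c * \<zeta> n"
  shows "\<xi> \<in> char_set I"
proof -
  have c: "\<zeta> \<in> c0_star" using char_set_subset_c0_star[OF I] \<zeta> by blast
  then have "monotone_rearrangement \<zeta> = \<zeta>"
    unfolding monotone_rearrangement_def by (intro decreasing_list_eq) auto
  then show ?thesis
    using char_set_of_le_rearrangement[OF I _ _ _ \<xi>] c \<zeta> by (simp add: c0_star_def)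
qed

text \<open>\<open>am_ideal\<close> is a definite description, so nothing is known about its
  characteristic set until an ideal with the set on the right has been produced.\<close>

lemma char_set_am_ideal:
  assumes I: "operator_ideal (I :: ('a \<Rightarrow>\<^sub>L 'a) set)"
  shows "char_set (am_ideal I) =
      {\<xi>\<in>c0_star. \<exists>\<eta>\<in>char_set I. \<exists>C. \<forall>n. \<xi> n \<le> C * arith_mean \<eta> n}" (is "_ = ?S")
proof -
  note sub = subsetD[OF char_set_subset_c0_star[OF I]]
  have nonneg: "0 \<le> \<eta> n" if "\<eta> \<in> char_set I" for \<eta> n using sub[OF that] by (simp add: c0_star_def)
  have bound: "\<xi> (n div 2) \<le> max 0 C * (2 * (arith_mean \<eta> n + arith_mean \<eta>' n))"
    if "\<And>n. \<xi> n \<le> C * arith_mean \<eta> n" "\<eta> \<in> char_set I" "\<eta>' \<in> char_set I" for \<xi> \<eta> \<eta>' C n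
  proof -
    have am: "0 \<le> arith_mean \<theta> m" if "\<theta> \<in> char_set I" for \<theta> m
      by (rule arith_mean_nonneg) (rule nonneg[OF that])
    have "\<xi> (n div 2) \<le> C * arith_mean \<eta> (n div 2)" by (rule that(1))
    \<comment> \<open>The constant of the O-relation may be negative; \<open>max 0 C\<close> makes
      the multiplication monotone.\<close>
    also have "\<dots> \<le> max 0 C * arith_mean \<eta> (n div 2)"
      by (intro mult_right_mono am that) auto
    also have "arith_mean \<eta> (n div 2) \<le> 2 * (arith_mean \<eta> n + arith_mean \<eta>' n)"
      using arith_mean_div2_le[where \<eta> = \<eta> and n = n, OF nonneg[OF that(2)]] am[OF that(3), of n] by simp
    finally show ?thesis by (simp add: mult_left_mono)
  qed
  obtain J :: "('a \<Rightarrow>\<^sub>L 'a) set" where J: "operator_ideal J" "char_set J = ?S"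
  proof (rule exists_ideal_of_char_set[of ?S])
    have "0 \<in> I" using I by (simp add: operator_ideal_def)
    then obtain \<eta> where "\<eta> \<in> char_set I" by (auto simp: char_set_def)
    then show "(\<lambda>_. 0) \<in> ?S"
      by (auto simp: c0_star_def antimono_def intro!: bexI[of _ \<eta>] exI[of _ 0])
    show "(\<lambda>n. c * \<xi> n) \<in> ?S" if \<xi>: "\<xi> \<in> ?S" and c: "0 \<le> c" for \<xi> c
    proof -
      from \<xi> obtain \<eta> C where \<eta>: "\<eta> \<in> char_set I" "\<And>n. \<xi> n \<le> C * arith_mean \<eta> n" by blast
      have "c * \<xi> n \<le> (c * C) * arith_mean \<eta> n" for n
        using mult_left_mono[OF \<eta>(2) c] by (simp add: mult.assoc)
      then show ?thesis using \<eta>(1) \<xi> c c0_star_scale by blast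
    qed
    show "(\<lambda>n. \<xi> (n div 2) + \<zeta> (n div 2)) \<in> ?S" if \<xi>: "\<xi> \<in> ?S" and \<zeta>: "\<zeta> \<in> ?S" for \<xi> \<zeta>
    proof -
      obtain \<eta> C where \<eta>: "\<eta> \<in> char_set I" "\<And>n. \<xi> n \<le> C * arith_mean \<eta> n" using \<xi> by blast
      obtain \<eta>' C' where \<eta>': "\<eta>' \<in> char_set I" "\<And>n. \<zeta> n \<le> C' * arith_mean \<eta>' n" using \<zeta> by blast
      have "\<xi> (n div 2) + \<zeta> (n div 2) \<le>
          (2 * (max 0 C + max 0 C')) * arith_mean (\<lambda>n. \<eta> n + \<eta>' n) n" for n
        using bound[OF \<eta>(2,1) \<eta>'(1), where n = n] bound[OF \<eta>'(2,1) \<eta>(1), where n = n]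
        by (simp add: arith_mean_add algebra_simps)
      then show ?thesis
        using \<xi> \<zeta> c0_star_add_div2 char_set_add[OF I \<eta>(1) \<eta>'(1)] by blast
    qed
    show "\<xi> \<in> ?S" if \<xi>: "\<xi> \<in> c0_star" and \<zeta>: "\<zeta> \<in> ?S" and le: "\<And>n. \<xi> n \<le> \<zeta> n" for \<xi> \<zeta>
    proof -
      obtain \<eta> C where \<eta>: "\<eta> \<in> char_set I" "\<And>n. \<zeta> n \<le> C * arith_mean \<eta> n" using \<zeta> by blast
      have "\<xi> n \<le> C * arith_mean \<eta> n" for n by (rule order_trans[OF le \<eta>(2)])
      then show ?thesis using \<xi> \<eta>(1) by blast
    qed
  qed auto
  then show ?thesis
    using ideal_of_char_set_eq[OF J(1)] by (simp add: am_ideal_def)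
qed

text \<open>Invariance enters here: a single matrix of \<C> turns \<eta> into a sequence dominating
  \<xi> up to a constant. The tail lemma requires \<open>\<eta> 0 > 0\<close>; when this fails,
  \<eta> vanishes and forces \<xi> to vanish.\<close>

lemma char_set_majorized:
  assumes I: "operator_ideal (I :: ('a \<Rightarrow>\<^sub>L 'a) set)" and inv: "invariant_under I \<C>"
    and \<eta>: "\<eta> \<in> char_set I" and \<beta>: "\<beta> \<in> c0_star" and \<xi>: "\<xi> \<in> c0_star"
    and maj: "\<And>m. (\<Sum>j<m. \<xi> j) \<le> (\<Sum>j<m. \<beta> j * \<eta> j)"
  shows "\<xi> \<in> char_set I"
proof (cases "\<eta> 0 > 0")
  case True
  have \<eta>c: "\<eta> \<in> c0_star" using \<eta> char_set_subset_c0_star[OF I] by blast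
  then have \<eta>0: "0 \<le> \<eta> n" "\<eta> n \<le> \<eta> 0" for n by (auto simp: c0_star_def antimono_def)
  obtain u c where u: "u \<in> perm_avg \<eta>" "\<And>i. \<xi> i \<le> c * u i"
    using majorized_le_perm_avg[OF \<xi> \<eta>c True \<beta> maj] by blast
  obtain P where P: "P \<in> \<C>" "mat_apply P \<eta> = u"
    using perm_avg_eq_mat_apply[OF u(1) \<eta>0(1)] by blast
  have "monotone_rearrangement u \<in> char_set I"
    using inv \<eta> P unfolding invariant_under_def by blast
  then show ?thesis
    using char_set_of_le_rearrangement[OF I perm_avg_tendsto_0[OF u(1) \<eta>c]
        perm_avg_bounds(1)[OF u(1) \<eta>0] _ \<xi> u(2)] by blast
next
  case False
  have "\<eta> \<in> c0_star" using \<eta> char_set_subset_c0_star[OF I] by blast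
  then have \<eta>_0: "\<eta> n = 0" for n
    using False antimonoD[of \<eta> 0 n] by (force simp: c0_star_def intro: antisym)
  have "\<xi> 0 \<le> 0" using maj[of 1] \<eta>_0 by simp
  moreover have "\<xi> n \<le> \<xi> 0" for n using \<xi> by (auto simp: c0_star_def antimono_def)
  ultimately have "\<xi> n \<le> 1 * \<eta> n" for n
    using order_trans[of "\<xi> n" "\<xi> 0" 0] \<eta>_0[of n] by simp
  then show ?thesis by (rule char_set_solid[OF I \<eta> \<xi>])
qed

end

theorem theorem4p9:
  fixes I :: "('a::complex_hilbert_space \<Rightarrow>\<^sub>L 'a) set"
  assumes "separable_space (euclidean :: 'a topology)"
    and "infinite_dimensional TYPE('a)"
    and "operator_ideal I"
    and "invariant_under I \<C>"
    and "soft_edged I \<or> soft_complemented I"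
  shows "am_closed I"
proof -
  obtain h :: "nat \<Rightarrow> 'a" where "orthonormal_basis h"
    using exists_orthonormal_basis[OF assms(1,2)] by blast
  then interpret separable_hilbert h using assms(2) by unfold_locales
  note I = assms(3)
  note sub = subsetD[OF char_set_subset_c0_star[OF I]]
  \<comment> \<open>The null factor comes from a factorization of \<eta> in the soft-edged case, and
    is the arbitrary multiplier \<alpha> of \<xi> in the soft-complemented case.\<close>
  have majorized: "\<xi> \<in> char_set I"
    if \<xi>: "\<xi> \<in> c0_star" and \<eta>: "\<eta> \<in> char_set I" and C: "C \<ge> 0"
      and maj: "\<And>m. (\<Sum>j<m. \<xi> j) \<le> (\<Sum>j<m. C * \<eta> j)" for \<xi> \<eta> C
  proof (cases "soft_edged I")
    case True
    then obtain \<alpha> \<eta>' where \<alpha>: "\<alpha> \<in> c0_star" "\<eta>' \<in> char_set I" "\<eta> = (\<lambda>n. \<alpha> n * \<eta>' n)"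
      using \<eta> unfolding soft_edged_def by blast
    show ?thesis
      by (rule char_set_majorized[OF I assms(4) \<alpha>(2) c0_star_scale[OF \<alpha>(1) C] \<xi>])
        (use maj \<alpha>(3) in \<open>simp add: mult.assoc\<close>)
  next
    case False
    then have "soft_complemented I" using assms(5) by blast
    moreover have "(\<lambda>n. \<alpha> n * \<xi> n) \<in> char_set I" if \<alpha>: "\<alpha> \<in> c0_star" for \<alpha>
    proof (rule char_set_majorized[OF I assms(4) \<eta> c0_star_scale[OF \<alpha> C] c0_star_mult[OF \<alpha> \<xi>]])
      fix m
      have "(\<Sum>j<m. \<alpha> j * \<xi> j) \<le> (\<Sum>j<m. \<alpha> j * (C * \<eta> j))"
        by (rule weighted_partial_sums_le) (use \<alpha> maj in \<open>auto simp: c0_star_def\<close>)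
      then show "(\<Sum>j<m. \<alpha> j * \<xi> j) \<le> (\<Sum>j<m. C * \<alpha> j * \<eta> j)" by (simp add: mult_ac)
    qed
    ultimately show ?thesis using \<xi> unfolding soft_complemented_def by blast
  qed
  have "{\<xi>\<in>c0_star. arith_mean \<xi> \<in> char_set (am_ideal I)} = char_set I"
  proof (intro subset_antisym subsetI)
    fix \<xi> assume "\<xi> \<in> {\<xi>\<in>c0_star. arith_mean \<xi> \<in> char_set (am_ideal I)}"
    then obtain \<eta> C where \<xi>: "\<xi> \<in> c0_star" and \<eta>: "\<eta> \<in> char_set I"
      and C: "\<And>n. arith_mean \<xi> n \<le> C * arith_mean \<eta> n"
      unfolding char_set_am_ideal[OF I] by blast
    have \<eta>0: "0 \<le> \<eta> n" for n using sub[OF \<eta>] by (simp add: c0_star_def)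
    show "\<xi> \<in> char_set I"
    proof (rule majorized[OF \<xi> \<eta>, of "max 0 C"])
      fix m
      show "(\<Sum>j<m. \<xi> j) \<le> (\<Sum>j<m. max 0 C * \<eta> j)"
      proof (cases m)
        case (Suc n)
        have "arith_mean \<xi> n \<le> max 0 C * arith_mean \<eta> n"
          by (rule order_trans[OF C]) (intro mult_right_mono arith_mean_nonneg \<eta>0, simp)
        then have "(\<Sum>j\<le>n. \<xi> j) \<le> max 0 C * (\<Sum>j\<le>n. \<eta> j)"
          by (simp add: arith_mean_def divide_le_cancel)
        then show ?thesis by (simp add: Suc lessThan_Suc_atMost sum_distrib_left)
      qed simp
    qed simp
  next
    fix \<xi> assume \<xi>: "\<xi> \<in> char_set I"
    have "arith_mean \<xi> n \<le> 1 * arith_mean \<xi> n" for n by simp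
    then show "\<xi> \<in> {\<xi>\<in>c0_star. arith_mean \<xi> \<in> char_set (am_ideal I)}"
      unfolding char_set_am_ideal[OF I] using arith_mean_c0_star[OF sub[OF \<xi>]] sub[OF \<xi>] \<xi> by blast
  qed
  \<comment> \<open>The set describing \<open>am_closure I\<close> has been identified with
    \<open>char_set I\<close>, and \<open>I\<close> is the only ideal having it.\<close>
  then show ?thesis
    unfolding am_closed_def am_closure_def pre_am_ideal_def
    using ideal_of_char_set_eq[OF I] by simp
qed

end
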